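(* Let $v\in\mathbb{X}$, let $f\colon\mathbf{G}\to\mathbb{R}$ be measurable and let $0<t_0<t_1<\infty$. Assume that $\mathbb{E}_t|F(\xi^v)|<\infty$ for each $t\in[t_0,t_1]$ and that for each $\varepsilon\in(0,t_1-t_0)$ $$\lim_{n\to\infty}\ \sup_{t\in[t_0+\varepsilon,t_1]}\ \sum_{k>n}\mathbb{E}_t\big|M^v_tF_k(\xi^v)\big|=0 .$$ Assume moreover that for each $t\in[t_0,t_1]$ $$\mathbb{E}_t\big[|F(\xi^v)|\,(|C^v|+\varphi_\lambda(C^v))\big]<\infty .$$ Then $t\mapsto f^v(t)=\mathbb{E}_tF(\xi^v)$ is continuously differentiable on $(t_0,t_1]$ (with one-sided derivative at $t_1$), with derivative given by $$\frac{d}{dt}f^v(t)=t^{-1}\,\mathbb{E}_t\int\nabla_xF(\xi^v)\,C^{v!}(dx).$$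
   Context: Setting. $\mathbb{X}$ is a complete separable metric space with Borel $\sigma$-field; $\lambda$ is a locally finite (finite on bounded Borel sets) and diffuse measure on $\mathbb{X}$; $\varphi\colon\mathbb{X}^2\to[0,1]$ is measurable and symmetric with $D_\varphi(x):=\int\varphi(x,y)\,\lambda(dy)<\infty$ for $\lambda$-a.e. $x\in\mathbb{X}$. $\mathbf{G}$ is the space of undirected loop-free graphs $\mu$ whose vertex set $V(\mu)$ is a locally finite subset of $\mathbb{X}$; formally $\mu$ is a counting measure with one atom $(x,\psi_x)$ per vertex $x$, where $\psi_x$ is the (counting measure of the) set of neighbours of $x$, and $\mathbf{G}$ carries the standard $\sigma$-field generated by the evaluation maps. $|\mu|=|V(\mu)|$ is the number of vertices. $\mu-\delta_x$ is the graph obtained from $\mu$ by deleting the vertex $x$ and its edges. $C^v(\mu)$ is the connected component of $v$ in $\mu$, as a graph. For $t>0$, under $\mathbb{P}_t$ (expectation $\mathbb{E}_t$), $\eta$ is a Poisson process on $\mathbb{X}$ with intensity measure $t\lambda$. For $v\in\mathbb{X}$, $\xi^v$ is the random graph with vertex set $\eta\cup\{v\}$ in which, given $\eta$, each pair of distinct vertices $x,y$ is joined by an edge with probability $\varphi(x,y)$, independently for different pairs. $C^v:=C^v(\xi^v)$; integration with respect to $C^{v!}$ means summation over the vertices of $C^v$ other than $v$. For a graph $\mu$, $\varphi_\lambda(\mu):=\int\big(1-\prod_{y\in V(\mu)}(1-\varphi(x,y))\big)\lambda(dx)$, and $M^v_t:=|C^v|-1-t\varphi_\lambda(C^v)$.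 For $\mu\in\mathbf{G}$ put $F_n(\mu):=f(C^v(\mu))\mathbf{1}\{|C^v(\mu)|=n\}$ ($n\in\mathbb{N}$), $F(\mu):=f(C^v(\mu))\mathbf{1}\{|C^v(\mu)|<\infty\}$, $\nabla_xF(\mu):=F(\mu)-F(\mu-\delta_x)$. Products involving $F$ or $F_n$ are understood as $0$ where $F$ respectively $F_n$ vanishes. *)

theory Defs
  imports "HOL-Probability.Probability"
begin

section \<open>Locally finite point sets and graphs\<close>

definition locally_finite_set :: "'a::metric_space set \<Rightarrow> bool" where
  "locally_finite_set V \<longleftrightarrow> (\<forall>B. bounded B \<longrightarrow> finite (V \<inter> B))"

abbreviation npoints :: "'a set \<Rightarrow> ennreal" where
  "npoints A \<equiv> emeasure (count_space UNIV) A"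

text \<open>A locally finite set \<open>\<psi>\<close> stands for the simple counting measure \<open>B \<mapsto> npoints (\<psi> \<inter> B)\<close>;
  the \<open>\<sigma>\<close>-field is the one generated by the evaluation maps.\<close>

definition point_space :: "'a::metric_space set measure" where
  "point_space = sigma {\<psi>. locally_finite_set \<psi>}
     {{\<psi>. locally_finite_set \<psi> \<and> npoints (\<psi> \<inter> B) \<in> K} | B K.
        B \<in> sets borel \<and> K \<in> sets borel}"

datatype 'a graph = Graph (verts: "'a set") (edges: "'a set set")

definition vertex_pairs :: "'a set \<Rightarrow> 'a set set" where
  "vertex_pairs V = {e. e \<subseteq> V \<and> card e = 2}"

definition graphs :: "'a::metric_space graph set" where
  "graphs = {\<mu>. locally_finite_set (verts \<mu>) \<and> edges \<mu> \<subseteq> vertex_pairs (verts \<mu>)}"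

definition neighbours :: "'a graph \<Rightarrow> 'a \<Rightarrow> 'a set" where
  "neighbours \<mu> x = {y. {x, y} \<in> edges \<mu>}"

text \<open>The graph \<open>\<mu>\<close> viewed as the counting measure with one atom \<open>(x, neighbours \<mu> x)\<close> per
  vertex, evaluated at a set \<open>A\<close> of pairs.\<close>

definition graph_eval :: "'a graph \<Rightarrow> ('a \<times> 'a set) set \<Rightarrow> ennreal" where
  "graph_eval \<mu> A = npoints {x \<in> verts \<mu>. (x, neighbours \<mu> x) \<in> A}"

definition graph_space :: "'a::metric_space graph measure" where
  "graph_space = sigma graphs
     {{\<mu> \<in> graphs. graph_eval \<mu> A \<in> K} | A K.
        A \<in> sets (borel \<Otimes>\<^sub>M point_space) \<and> K \<in> sets borel}"

definition gsize :: "'a graph \<Rightarrow> ennreal" where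
  "gsize \<mu> = npoints (verts \<mu>)"

definition delete_vertex :: "'a \<Rightarrow> 'a graph \<Rightarrow> 'a graph" where
  "delete_vertex x \<mu> = Graph (verts \<mu> - {x}) {e \<in> edges \<mu>. x \<notin> e}"

text \<open>The component of a point that is not a vertex is the empty graph.\<close>

definition component_verts :: "'a \<Rightarrow> 'a graph \<Rightarrow> 'a set" where
  "component_verts v \<mu> =
     {w \<in> verts \<mu>. v \<in> verts \<mu> \<and> (v, w) \<in> {(x, y). {x, y} \<in> edges \<mu>}\<^sup>*}"

definition component :: "'a \<Rightarrow> 'a graph \<Rightarrow> 'a graph" where
  "component v \<mu> = Graph (component_verts v \<mu>) {e \<in> edges \<mu>. e \<subseteq> component_verts v \<mu>}"


section \<open>The Poisson driven random connection model\<close>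

text \<open>The probability mass function is written out because \<^const>\<open>poisson_pmf\<close> does not
  cover rate 0.\<close>

definition poisson_process ::
    "'w measure \<Rightarrow> ('w \<Rightarrow> 'a::metric_space set) \<Rightarrow> 'a measure \<Rightarrow> bool" where
  "poisson_process M \<eta> \<Lambda> \<longleftrightarrow>
     \<eta> \<in> measurable M point_space \<and>
     (\<forall>B \<in> sets borel. emeasure \<Lambda> B < \<infinity> \<longrightarrow>
        (\<forall>k::nat. measure M {\<omega> \<in> space M. npoints (\<eta> \<omega> \<inter> B) = of_nat k}
           = measure \<Lambda> B ^ k / fact k * exp (- measure \<Lambda> B))) \<and>
     (\<forall>B \<in> sets borel. emeasure \<Lambda> B = \<infinity> \<longrightarrow> (AE \<omega> in M. npoints (\<eta> \<omega> \<inter> B) = \<infinity>)) \<and>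
     (\<forall>(n::nat) B. B ` {..<n} \<subseteq> sets borel \<and> disjoint_family_on B {..<n} \<longrightarrow>
        prob_space.indep_vars M (\<lambda>_. borel) (\<lambda>i \<omega>. npoints (\<eta> \<omega> \<inter> B i)) {..<n})"

text \<open>For symmetric \<open>\<phi>\<close>, the common value of \<open>\<phi> x y\<close> and \<open>\<phi> y x\<close> at \<open>e = {x, y}\<close>.\<close>

definition pair_prob :: "('a \<Rightarrow> 'a \<Rightarrow> real) \<Rightarrow> 'a set \<Rightarrow> real" where
  "pair_prob \<phi> e = (THE p. \<exists>x y. e = {x, y} \<and> p = \<phi> x y)"

lemma pair_prob_insert:
  assumes "\<And>x y. \<phi> x y = \<phi> y x"
  shows "pair_prob \<phi> {x, y} = \<phi> x y"
  unfolding pair_prob_def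
  by (rule the_equality) (use assms in \<open>auto simp: doubleton_eq_iff\<close>)

text \<open>The law of the random graph with vertex set \<open>V\<close> in which the pairs of distinct vertices
  are edges independently of each other, the pair \<open>e\<close> with probability \<open>pair_prob \<phi> e\<close>.\<close>

definition random_edges_law :: "('a::metric_space \<Rightarrow> 'a \<Rightarrow> real) \<Rightarrow> 'a set \<Rightarrow> 'a graph measure" where
  "random_edges_law \<phi> V =
     distr (\<Pi>\<^sub>M e \<in> vertex_pairs V. measure_pmf (bernoulli_pmf (pair_prob \<phi> e)))
       graph_space (\<lambda>b. Graph V {e \<in> vertex_pairs V. b e})"

text \<open>\<open>\<eta>\<close> is a Poisson process with intensity measure \<open>t lam\<close>, and \<open>\<xi>\<close> is a random graph on
  \<open>\<eta> \<union> {v}\<close> whose regular conditional distribution given \<open>\<eta>\<close> is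
  \<open>random_edges_law \<phi> (\<eta> \<union> {v})\<close>.\<close>

definition random_connection_model ::
    "'w measure \<Rightarrow> ('w \<Rightarrow> 'a::metric_space set) \<Rightarrow> ('w \<Rightarrow> 'a graph) \<Rightarrow>
     real \<Rightarrow> 'a measure \<Rightarrow> ('a \<Rightarrow> 'a \<Rightarrow> real) \<Rightarrow> 'a \<Rightarrow> bool" where
  "random_connection_model M \<eta> \<xi> t lam \<phi> v \<longleftrightarrow>
     prob_space M \<and>
     poisson_process M \<eta> (scale_measure (ennreal t) lam) \<and>
     \<xi> \<in> measurable M graph_space \<and>
     (\<forall>\<omega> \<in> space M. verts (\<xi> \<omega>) = insert v (\<eta> \<omega>)) \<and>
     (\<forall>B \<in> sets point_space. \<forall>A \<in> sets graph_space.
        emeasure M {\<omega> \<in> space M. \<eta> \<omega> \<in> B \<and> \<xi> \<omega> \<in> A} =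
        (\<integral>\<^sup>+\<omega>. indicator B (\<eta> \<omega>) * emeasure (random_edges_law \<phi> (insert v (\<eta> \<omega>))) A \<partial>M))"


section \<open>Functionals of graphs\<close>

text \<open>The product over a possibly infinite vertex set, with factors in \<open>[0,1]\<close>, is the infimum
  of its finite subproducts (\<^const>\<open>prod\<close> is \<open>1\<close> on infinite sets).\<close>

definition unit_prod :: "('a \<Rightarrow> real) \<Rightarrow> 'a set \<Rightarrow> real" where
  "unit_prod g V = (INF W \<in> {W. finite W \<and> W \<subseteq> V}. \<Prod>y\<in>W. g y)"

lemma unit_prod_finite:
  assumes "finite V" "\<And>y. y \<in> V \<Longrightarrow> 0 \<le> g y \<and> g y \<le> 1"
  shows "unit_prod g V = (\<Prod>y\<in>V. g y)"
  unfolding unit_prod_def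
proof (rule cInf_eq_minimum)
  show "prod g V \<in> prod g ` {W. finite W \<and> W \<subseteq> V}"
    using assms(1) by blast
next
  fix p assume "p \<in> prod g ` {W. finite W \<and> W \<subseteq> V}"
  then obtain W where W: "W \<subseteq> V" "p = prod g W" by blast
  have "prod g V = prod g (V - W) * prod g W"
    using assms(1) W(1) by (rule prod.subset_diff[rotated])
  also have "\<dots> \<le> prod g W"
    using assms(2) W(1)
    by (intro mult_left_le_one_le prod_nonneg prod_le_1) auto
  finally show "prod g V \<le> p" using W(2) by simp
qed

definition phi_lambda ::
    "'a measure \<Rightarrow> ('a \<Rightarrow> 'a \<Rightarrow> real) \<Rightarrow> 'a graph \<Rightarrow> ennreal" where
  "phi_lambda lam \<phi> \<mu> = (\<integral>\<^sup>+x. ennreal (1 - unit_prod (\<lambda>y. 1 - \<phi> x y) (verts \<mu>)) \<partial>lam)"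

text \<open>Extended-real valued because the size and \<^const>\<open>phi_lambda\<close> of the component may be
  infinite. In \<^typ>\<open>ereal\<close> (and \<^typ>\<open>ennreal\<close>) multiplication by \<open>0\<close> gives \<open>0\<close>, whatever the
  other factor is.\<close>

definition M_comp ::
    "'a measure \<Rightarrow> ('a \<Rightarrow> 'a \<Rightarrow> real) \<Rightarrow> 'a \<Rightarrow> real \<Rightarrow> 'a graph \<Rightarrow> ereal" where
  "M_comp lam \<phi> v t \<mu> =
     enn2ereal (gsize (component v \<mu>)) - 1
       - ereal t * enn2ereal (phi_lambda lam \<phi> (component v \<mu>))"

definition F_fin :: "('a graph \<Rightarrow> real) \<Rightarrow> 'a \<Rightarrow> 'a graph \<Rightarrow> real" where
  "F_fin f v \<mu> = (if gsize (component v \<mu>) < \<infinity> then f (component v \<mu>) else 0)"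

definition F_size :: "('a graph \<Rightarrow> real) \<Rightarrow> 'a \<Rightarrow> nat \<Rightarrow> 'a graph \<Rightarrow> real" where
  "F_size f v n \<mu> = (if gsize (component v \<mu>) = of_nat n then f (component v \<mu>) else 0)"

definition nabla :: "('a graph \<Rightarrow> real) \<Rightarrow> 'a \<Rightarrow> 'a graph \<Rightarrow> real" where
  "nabla F x \<mu> = F \<mu> - F (delete_vertex x \<mu>)"

text \<open>Counting measure on the vertices of the component of \<open>v\<close> other than \<open>v\<close>.\<close>

definition comp_others :: "'a \<Rightarrow> 'a graph \<Rightarrow> 'a measure" where
  "comp_others v \<mu> = count_space (verts (component v \<mu>) - {v})"

end

theory Submission
  imports Defs
begin

text \<open>
  The increment formula is a statement about the component of \<open>v\<close> alone, and the law of a finite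
  component depends on the intensity in an explicit way. A component with \<open>m\<close> vertices besides
  \<open>v\<close> arises by choosing these \<open>m\<close> points from the Poisson process, which contributes a factor
  \<open>t ^ m\<close>, and by requiring that no other point of the process is joined to it, which has
  probability \<open>exp (- t \<phi>\<^sub>\<lambda>(C))\<close>; everything else is independent of \<open>t\<close>. Consequently, on the event
  that the component has size \<open>m + 1\<close>, its laws under the intensities \<open>s\<close> and \<open>t\<close> have the relative
  density \<open>(s / t) ^ m * exp (- (s - t) \<phi>\<^sub>\<lambda>(C))\<close> (\<open>change_intensity\<close>). With the intensity \<open>t0\<close>
  as reference, the mean of \<open>F_size f v (m + 1)\<close> becomes a power of \<open>s\<close> times an
  exponential transform, which can be differentiated under the integral for \<open>s > t0\<close>
  (\<open>size_derivative\<close>); its derivative is the mean of \<open>(m - s \<phi>\<^sub>\<lambda>(C)) F_size f v (m + 1)\<close> divided by \<open>s\<close>.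
  The hypothesis on the tails says that these derivatives, summed over the sizes, converge uniformly
  on \<open>[t0 + \<epsilon>, t1]\<close>. So the series may be differentiated term by term, and the derivative
  \<open>t\<inverse> \<E>\<^sub>t[M\<^sub>t F]\<close> is continuous.

  It remains to recognise \<open>\<E>\<^sub>t[M\<^sub>t F]\<close> as the expected sum of increments (\<open>mean_nabla\<close>). The
  terms \<open>F(\<xi>)\<close> of the increments contribute \<open>(|C| - 1) F\<close>. The terms \<open>F(\<xi> - \<delta>\<^sub>x)\<close> are summed over those
  points \<open>x\<close> of the Poisson process that belong to the component. A point belongs to it if and
  only if it is joined to the component that remains when the point is deleted. The Mecke equation
  therefore turns this sum into \<open>t \<E>\<^sub>t[F \<phi>\<^sub>\<lambda>(C)]\<close> (\<open>mean_sum_delete\<close>).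

  Both arguments use the Mecke equation (\<open>mecke\<close>) and the Laplace functional
  (\<open>laplace_functional\<close>), which follow from the distribution and the independence of the counts,
  and the independence of disjoint families of edges, which gives the law of the graph after adding
  a vertex (\<open>random_edges_law_add_vertex\<close>) and the probability that a finite set of vertices is cut
  off from all others (\<open>random_edges_law_cut\<close>). Measurability of components, of deletions and of the
  law of the edges as a function of the vertex set is reduced to void events: that a
  region contains no vertex, and that no edge lies in a given set of pairs. These events are stable
  under intersection, they generate the \<open>\<sigma>\<close>-fields of point sets and graphs, and their
  probabilities are explicit.
\<close>

section \<open>Kernels\<close>

text \<open>A Dynkin class argument. Finiteness of the measures makes the class closed under complements,
  because there the measure of a complement is a difference.\<close>

lemma finite_kernel_generated:
  fixes N :: "'w \<Rightarrow> 's measure"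
  assumes E: "Int_stable E" "E \<subseteq> Pow \<Omega>"
    and sets: "\<And>\<omega>. \<omega> \<in> space M \<Longrightarrow> sets (N \<omega>) = sigma_sets \<Omega> E"
    and fin: "\<And>\<omega>. \<omega> \<in> space M \<Longrightarrow> emeasure (N \<omega>) \<Omega> \<noteq> \<infinity>"
    and total: "(\<lambda>\<omega>. emeasure (N \<omega>) \<Omega>) \<in> borel_measurable M"
    and gen: "\<And>A. A \<in> E \<Longrightarrow> (\<lambda>\<omega>. emeasure (N \<omega>) A) \<in> borel_measurable M"
    and A: "A \<in> sigma_sets \<Omega> E"
  shows "(\<lambda>\<omega>. emeasure (N \<omega>) A) \<in> borel_measurable M"
  using E A
proof (induction rule: sigma_sets_induct_disjoint)
  case (basic A) then show ?case by (rule gen)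
next
  case empty show ?case by simp
next
  case (compl A)
  have sp: "space (N \<omega>) = \<Omega>" if "\<omega> \<in> space M" for \<omega>
    using sets[OF that] E(2) by (metis sets_eq_imp_space_eq sets_measure_of space_measure_of)
  have "(\<lambda>\<omega>. emeasure (N \<omega>) \<Omega> - emeasure (N \<omega>) A) \<in> borel_measurable M"
    using compl total by measurable
  then show ?case
  proof (rule measurable_cong[THEN iffD1, rotated])
    fix \<omega> assume \<omega>: "\<omega> \<in> space M"
    have "emeasure (N \<omega>) A \<noteq> \<infinity>"
      using fin[OF \<omega>] emeasure_mono[of A \<Omega> "N \<omega>"] compl(1) sets[OF \<omega>] sp[OF \<omega>]
      by (metis emeasure_space infinity_ennreal_def neq_top_trans)
    then show "emeasure (N \<omega>) \<Omega> - emeasure (N \<omega>) A = emeasure (N \<omega>) (\<Omega> - A)"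
      using emeasure_compl[of A "N \<omega>"] compl(1) sets[OF \<omega>] sp[OF \<omega>] by simp
  qed
next
  case (union A)
  have "(\<lambda>\<omega>. \<Sum>i. emeasure (N \<omega>) (A i)) \<in> borel_measurable M"
    using union by measurable
  then show ?case
  proof (rule measurable_cong[THEN iffD1, rotated])
    fix \<omega> assume \<omega>: "\<omega> \<in> space M"
    show "(\<Sum>i. emeasure (N \<omega>) (A i)) = emeasure (N \<omega>) (\<Union>i. A i)"
      using union sets[OF \<omega>] by (intro suminf_emeasure) auto
  qed
qed

text \<open>The image measure under \<open>Pair \<omega>\<close> lives on the product space, where rectangles generate, so the
  \<open>\<omega>\<close>-dependence of the set is moved into the kernel.\<close>

lemma finite_kernel_pair:
  fixes N :: "'w \<Rightarrow> 's measure"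
  assumes sets: "\<And>\<omega>. \<omega> \<in> space M \<Longrightarrow> sets (N \<omega>) = sets S"
    and fin: "\<And>\<omega>. \<omega> \<in> space M \<Longrightarrow> emeasure (N \<omega>) (space S) \<noteq> \<infinity>"
    and N: "\<And>A. A \<in> sets S \<Longrightarrow> (\<lambda>\<omega>. emeasure (N \<omega>) A) \<in> borel_measurable M"
    and A: "A \<in> sets (M \<Otimes>\<^sub>M S)"
  shows "(\<lambda>\<omega>. emeasure (N \<omega>) (Pair \<omega> -` A)) \<in> borel_measurable M"
proof -
  have sp: "space (N \<omega>) = space S" if "\<omega> \<in> space M" for \<omega>
    using sets[OF that] by (rule sets_eq_imp_space_eq)
  define N' where "N' \<omega> = distr (N \<omega>) (M \<Otimes>\<^sub>M S) (Pair \<omega>)" for \<omega>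
  have pm: "Pair \<omega> \<in> measurable (N \<omega>) (M \<Otimes>\<^sub>M S)" if "\<omega> \<in> space M" for \<omega>
    using measurable_Pair1'[OF that, of S] sets[OF that] by (simp cong: measurable_cong_sets)
  have N'_eq: "emeasure (N' \<omega>) Z = emeasure (N \<omega>) (Pair \<omega> -` Z)"
    if "\<omega> \<in> space M" "Z \<in> sets (M \<Otimes>\<^sub>M S)" for \<omega> Z
  proof -
    have "Pair \<omega> -` Z \<inter> space (N \<omega>) = Pair \<omega> -` Z"
      using sets.sets_into_space[OF that(2)] sp[OF that(1)] by (auto simp: space_pair_measure)
    then show ?thesis unfolding N'_def using pm[OF that(1)] that(2) by (simp add: emeasure_distr)
  qed
  have rect: "Pair \<omega> -` (a \<times> b) = (if \<omega> \<in> a then b else {})" for \<omega> :: 'w and a and b :: "'s set"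
    by auto
  have rectm: "(\<lambda>\<omega>. emeasure (N \<omega>) (Pair \<omega> -` (a \<times> b))) \<in> borel_measurable M"
    if "a \<in> sets M" "b \<in> sets S" for a b
    unfolding rect if_distrib[of "emeasure _"] emeasure_empty
    using that N by (intro measurable_If) auto
  have "(\<lambda>\<omega>. emeasure (N' \<omega>) A) \<in> borel_measurable M"
  proof (rule finite_kernel_generated[OF Int_stable_pair_measure_generator pair_measure_closed])
    show "sets (N' \<omega>) = sigma_sets (space M \<times> space S) {a \<times> b |a b. a \<in> sets M \<and> b \<in> sets S}"
      for \<omega> by (simp add: N'_def sets_pair_measure)
    show "emeasure (N' \<omega>) (space M \<times> space S) \<noteq> \<infinity>" if "\<omega> \<in> space M" for \<omega>
      using N'_eq[OF that, of "space M \<times> space S"] fin[OF that] that by (simp add: rect)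
    show "(\<lambda>\<omega>. emeasure (N' \<omega>) (space M \<times> space S)) \<in> borel_measurable M"
      by (rule measurable_cong[THEN iffD2, OF N'_eq rectm]) auto
    show "(\<lambda>\<omega>. emeasure (N' \<omega>) Z) \<in> borel_measurable M"
      if "Z \<in> {a \<times> b |a b. a \<in> sets M \<and> b \<in> sets S}" for Z
      using that by (auto intro!: measurable_cong[THEN iffD2, OF N'_eq rectm])
    show "A \<in> sigma_sets (space M \<times> space S) {a \<times> b |a b. a \<in> sets M \<and> b \<in> sets S}"
      using A by (simp add: sets_pair_measure)
  qed
  then show ?thesis
    by (rule measurable_cong[THEN iffD1, rotated]) (use N'_eq A in auto)
qed

text \<open>Intended for the counting measures of locally finite sets: they are infinite, but finite on each
  window \<open>B n\<close>, uniformly in \<open>\<omega>\<close>.\<close>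

lemma kernel_nn_integral_measurable:
  fixes N :: "'w \<Rightarrow> 's measure"
  assumes sets: "\<And>\<omega>. \<omega> \<in> space M \<Longrightarrow> sets (N \<omega>) = sets S"
    and N: "\<And>A. A \<in> sets S \<Longrightarrow> (\<lambda>\<omega>. emeasure (N \<omega>) A) \<in> borel_measurable M"
    and B: "\<And>n::nat. B n \<in> sets S" "incseq B" "(\<Union>n. B n) = space S"
    and fin: "\<And>\<omega> n. \<omega> \<in> space M \<Longrightarrow> emeasure (N \<omega>) (B n) \<noteq> \<infinity>"
    and f: "f \<in> borel_measurable (M \<Otimes>\<^sub>M S)"
  shows "(\<lambda>\<omega>. \<integral>\<^sup>+x. f (\<omega>, x) \<partial>N \<omega>) \<in> borel_measurable M"
proof -
  have sec: "(\<lambda>x. u (\<omega>, x)) \<in> borel_measurable (N \<omega>)"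
    if "\<omega> \<in> space M" "u \<in> borel_measurable (M \<Otimes>\<^sub>M S)" for \<omega> and u :: "'w \<times> 's \<Rightarrow> ennreal"
    using measurable_compose[OF measurable_Pair1'[OF that(1)] that(2)] sets[OF that(1)]
    by (simp cong: measurable_cong_sets)
  show ?thesis
    using f
  proof (induction rule: borel_measurable_induct)
    case (cong f g)
    then show ?case
      by (subst measurable_cong[where g="\<lambda>\<omega>. \<integral>\<^sup>+x. g (\<omega>, x) \<partial>N \<omega>"])
         (auto intro!: nn_integral_cong simp: space_pair_measure sets_eq_imp_space_eq[OF sets])
  next
    case (set A)
    have cut: "Pair \<omega> -` A \<in> sets (N \<omega>)" if "\<omega> \<in> space M" for \<omega>
      using set that by (simp add: sets sets_Pair1)
    define R where "R n \<omega> = density (N \<omega>) (indicator (B n))" for n \<omega>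
    have R_eq: "emeasure (R n \<omega>) Z = emeasure (N \<omega>) (B n \<inter> Z)"
      if "\<omega> \<in> space M" "Z \<in> sets S" for n \<omega> Z
      using that B(1)[of n] sets[OF that(1)]
      by (simp add: R_def emeasure_density flip: indicator_inter_arith)
    have "(\<lambda>\<omega>. emeasure (R n \<omega>) (Pair \<omega> -` A)) \<in> borel_measurable M" for n
    proof (rule finite_kernel_pair[where S=S])
      show "sets (R n \<omega>) = sets S" if "\<omega> \<in> space M" for \<omega> by (simp add: R_def sets that)
      show "emeasure (R n \<omega>) (space S) \<noteq> \<infinity>" if "\<omega> \<in> space M" for \<omega>
        using R_eq[OF that sets.top] fin[OF that] B(1)[of n] by (metis sets.Int_space_eq2)
      show "(\<lambda>\<omega>. emeasure (R n \<omega>) Z) \<in> borel_measurable M" if "Z \<in> sets S" for Z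
        by (rule measurable_cong[THEN iffD2, OF R_eq[OF _ that] N]) (use that B(1) in auto)
    qed (fact set)
    then have "(\<lambda>\<omega>. SUP n. emeasure (R n \<omega>) (Pair \<omega> -` A)) \<in> borel_measurable M"
      by measurable
    then show ?case
    proof (rule measurable_cong[THEN iffD1, rotated])
      fix \<omega> assume \<omega>: "\<omega> \<in> space M"
      have Z: "Pair \<omega> -` A \<in> sets S" using cut[OF \<omega>] sets[OF \<omega>] by simp
      have "(SUP n. emeasure (R n \<omega>) (Pair \<omega> -` A)) = (SUP n. emeasure (N \<omega>) (B n \<inter> Pair \<omega> -` A))"
        using R_eq[OF \<omega> Z] by simp
      also have "\<dots> = emeasure (N \<omega>) (\<Union>n. B n \<inter> Pair \<omega> -` A)"
        using B Z sets[OF \<omega>] by (intro SUP_emeasure_incseq) (auto simp: incseq_def)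
      also have "(\<Union>n. B n \<inter> Pair \<omega> -` A) = Pair \<omega> -` A"
        using B(3) sets.sets_into_space[OF Z] by auto
      also have "emeasure (N \<omega>) \<dots> = (\<integral>\<^sup>+ x. indicator (Pair \<omega> -` A) x \<partial>N \<omega>)"
        using cut[OF \<omega>] by simp
      also have "\<dots> = (\<integral>\<^sup>+ x. indicator A (\<omega>, x) \<partial>N \<omega>)"
        by (auto intro!: nn_integral_cong split: split_indicator)
      finally show "(SUP n. emeasure (R n \<omega>) (Pair \<omega> -` A)) = (\<integral>\<^sup>+ x. indicator A (\<omega>, x) \<partial>N \<omega>)" .
    qed
  next
    case (mult u c)
    have "(\<lambda>\<omega>. c * (\<integral>\<^sup>+x. u (\<omega>, x) \<partial>N \<omega>)) \<in> borel_measurable M"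
      using mult by measurable
    then show ?case
    proof (rule measurable_cong[THEN iffD1, rotated])
      fix \<omega> assume \<omega>: "\<omega> \<in> space M"
      show "c * (\<integral>\<^sup>+x. u (\<omega>, x) \<partial>N \<omega>) = (\<integral>\<^sup>+x. c * u (\<omega>, x) \<partial>N \<omega>)"
        using sec[OF \<omega> mult(2)] by (simp add: nn_integral_cmult)
    qed
  next
    case (add u w)
    have "(\<lambda>\<omega>. (\<integral>\<^sup>+x. w (\<omega>, x) \<partial>N \<omega>) + (\<integral>\<^sup>+x. u (\<omega>, x) \<partial>N \<omega>)) \<in> borel_measurable M"
      using add by measurable
    then show ?case
    proof (rule measurable_cong[THEN iffD1, rotated])
      fix \<omega> assume \<omega>: "\<omega> \<in> space M"
      show "(\<integral>\<^sup>+x. w (\<omega>, x) \<partial>N \<omega>) + (\<integral>\<^sup>+x. u (\<omega>, x) \<partial>N \<omega>) = (\<integral>\<^sup>+x. w (\<omega>, x) + u (\<omega>, x) \<partial>N \<omega>)"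
        using sec[OF \<omega> add(1)] sec[OF \<omega> add(3)] by (simp add: nn_integral_add)
    qed
  next
    case (seq U)
    have "(\<lambda>\<omega>. SUP i. (\<integral>\<^sup>+x. U i (\<omega>, x) \<partial>N \<omega>)) \<in> borel_measurable M"
      using seq by measurable
    then show ?case
    proof (rule measurable_cong[THEN iffD1, rotated])
      fix \<omega> assume \<omega>: "\<omega> \<in> space M"
      have "(\<integral>\<^sup>+x. (SUP i. U i (\<omega>, x)) \<partial>N \<omega>) = (SUP i. (\<integral>\<^sup>+x. U i (\<omega>, x) \<partial>N \<omega>))"
        using seq(3) sec[OF \<omega> seq(1)] by (intro nn_integral_monotone_convergence_SUP) (auto simp: incseq_def le_fun_def)
      then show "(SUP i. (\<integral>\<^sup>+x. U i (\<omega>, x) \<partial>N \<omega>)) = (\<integral>\<^sup>+x. (SUP i. U i) (\<omega>, x) \<partial>N \<omega>)"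
        by (simp add: image_comp)
    qed
  qed
qed

text \<open>The mixture of a kernel that need not consist of finite measures. For the counting measure of a point
  process, carried along with the process, it is the Campbell measure.\<close>

definition mix :: "'w measure \<Rightarrow> 's measure \<Rightarrow> ('w \<Rightarrow> 's measure) \<Rightarrow> 's measure" where
  "mix M S N = measure_of (space S) (sets S) (\<lambda>A. \<integral>\<^sup>+\<omega>. emeasure (N \<omega>) A \<partial>M)"

lemma sets_mix [simp, measurable_cong]: "sets (mix M S N) = sets S"
  and space_mix [simp]: "space (mix M S N) = space S"
  by (simp_all add: mix_def)

lemma emeasure_mix:
  assumes sets: "\<And>\<omega>. \<omega> \<in> space M \<Longrightarrow> sets (N \<omega>) = sets S"
    and N: "\<And>A. A \<in> sets S \<Longrightarrow> (\<lambda>\<omega>. emeasure (N \<omega>) A) \<in> borel_measurable M"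
    and A: "A \<in> sets S"
  shows "emeasure (mix M S N) A = (\<integral>\<^sup>+\<omega>. emeasure (N \<omega>) A \<partial>M)"
  unfolding mix_def
proof (rule emeasure_measure_of_sigma)
  show "countably_additive (sets S) (\<lambda>A. \<integral>\<^sup>+\<omega>. emeasure (N \<omega>) A \<partial>M)"
  proof (rule countably_additiveI)
    fix F :: "nat \<Rightarrow> 'b set" assume F: "range F \<subseteq> sets S" "disjoint_family F"
    have "(\<Sum>i. \<integral>\<^sup>+\<omega>. emeasure (N \<omega>) (F i) \<partial>M) = (\<integral>\<^sup>+\<omega>. (\<Sum>i. emeasure (N \<omega>) (F i)) \<partial>M)"
      using F N by (intro nn_integral_suminf[symmetric]) auto
    also have "\<dots> = (\<integral>\<^sup>+\<omega>. emeasure (N \<omega>) (\<Union>i. F i) \<partial>M)"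
      using F sets by (intro nn_integral_cong suminf_emeasure) auto
    finally show "(\<Sum>i. \<integral>\<^sup>+\<omega>. emeasure (N \<omega>) (F i) \<partial>M) = (\<integral>\<^sup>+\<omega>. emeasure (N \<omega>) (\<Union>(range F)) \<partial>M)" .
  qed
qed (use A in \<open>auto simp: positive_def sets.sigma_algebra_axioms\<close>)

lemma nn_integral_mix:
  assumes sets: "\<And>\<omega>. \<omega> \<in> space M \<Longrightarrow> sets (N \<omega>) = sets S"
    and N: "\<And>A. A \<in> sets S \<Longrightarrow> (\<lambda>\<omega>. emeasure (N \<omega>) A) \<in> borel_measurable M"
    and f: "f \<in> borel_measurable S"
  shows "(\<integral>\<^sup>+x. f x \<partial>mix M S N) = (\<integral>\<^sup>+\<omega>. \<integral>\<^sup>+x. f x \<partial>N \<omega> \<partial>M)"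
    and "(\<lambda>\<omega>. \<integral>\<^sup>+x. f x \<partial>N \<omega>) \<in> borel_measurable M"
proof -
  have "(\<integral>\<^sup>+x. f x \<partial>mix M S N) = (\<integral>\<^sup>+\<omega>. \<integral>\<^sup>+x. f x \<partial>N \<omega> \<partial>M) \<and>
    (\<lambda>\<omega>. \<integral>\<^sup>+x. f x \<partial>N \<omega>) \<in> borel_measurable M"
    using f
  proof (induction rule: borel_measurable_induct)
    case (cong f g)
    have "(\<integral>\<^sup>+x. f x \<partial>mix M S N) = (\<integral>\<^sup>+x. g x \<partial>mix M S N)"
      using cong by (intro nn_integral_cong) auto
    moreover have *: "(\<integral>\<^sup>+x. f x \<partial>N \<omega>) = (\<integral>\<^sup>+x. g x \<partial>N \<omega>)" if "\<omega> \<in> space M" for \<omega>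
      using cong sets_eq_imp_space_eq[OF sets[OF that]] by (intro nn_integral_cong) auto
    ultimately show ?case
      using cong(4) by (simp cong: nn_integral_cong measurable_cong)
  next
    case (set A)
    have *: "(\<integral>\<^sup>+ x. indicator A x \<partial>N \<omega>) = emeasure (N \<omega>) A" if "\<omega> \<in> space M" for \<omega>
      using set sets[OF that] by simp
    show ?case
      using set N[OF set] emeasure_mix[OF sets N set]
      by (simp add: * cong: nn_integral_cong measurable_cong)
  next
    case (mult u c)
    have *: "(\<integral>\<^sup>+x. c * u x \<partial>N \<omega>) = c * (\<integral>\<^sup>+x. u x \<partial>N \<omega>)" if "\<omega> \<in> space M" for \<omega>
      using mult sets[OF that] by (intro nn_integral_cmult) (simp cong: measurable_cong_sets)
    have "u \<in> borel_measurable (mix M S N)" using mult by (simp cong: measurable_cong_sets)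
    moreover have [measurable]: "(\<lambda>\<omega>. \<integral>\<^sup>+x. u x \<partial>N \<omega>) \<in> borel_measurable M" using mult(4) by simp
    have "(\<lambda>\<omega>. c * (\<integral>\<^sup>+x. u x \<partial>N \<omega>)) \<in> borel_measurable M" by simp
    ultimately show ?case
      using mult by (simp add: nn_integral_cmult * cong: nn_integral_cong measurable_cong)
  next
    case (add u w)
    have *: "(\<integral>\<^sup>+x. w x + u x \<partial>N \<omega>) = (\<integral>\<^sup>+x. w x \<partial>N \<omega>) + (\<integral>\<^sup>+x. u x \<partial>N \<omega>)" if "\<omega> \<in> space M" for \<omega>
      using add sets[OF that] by (intro nn_integral_add) (simp_all cong: measurable_cong_sets)
    have "u \<in> borel_measurable (mix M S N)" "w \<in> borel_measurable (mix M S N)"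
      using add by (simp_all cong: measurable_cong_sets)
    moreover have [measurable]: "(\<lambda>\<omega>. \<integral>\<^sup>+x. u x \<partial>N \<omega>) \<in> borel_measurable M"
      "(\<lambda>\<omega>. \<integral>\<^sup>+x. w x \<partial>N \<omega>) \<in> borel_measurable M" using add(6,7) by simp_all
    have "(\<lambda>\<omega>. (\<integral>\<^sup>+x. w x \<partial>N \<omega>) + (\<integral>\<^sup>+x. u x \<partial>N \<omega>)) \<in> borel_measurable M" by simp
    ultimately show ?case
      using add by (simp add: nn_integral_add * cong: nn_integral_cong measurable_cong)
  next
    case (seq U)
    have mc: "(\<integral>\<^sup>+x. (SUP i. U i) x \<partial>K) = (SUP i. \<integral>\<^sup>+x. U i x \<partial>K)" if "sets K = sets S" for K
    proof -
      have "U i \<in> borel_measurable K" for i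
        using seq(1)[of i] that by (simp cong: measurable_cong_sets)
      then have "(\<integral>\<^sup>+x. (SUP i. U i x) \<partial>K) = (SUP i. \<integral>\<^sup>+x. U i x \<partial>K)"
        using seq(3) by (intro nn_integral_monotone_convergence_SUP) auto
      then show ?thesis by (simp add: image_comp)
    qed
    note * = mc[OF sets] and ** = mc[OF sets_mix]
    have "(\<integral>\<^sup>+\<omega>. (SUP i. \<integral>\<^sup>+x. U i x \<partial>N \<omega>) \<partial>M) = (SUP i. \<integral>\<^sup>+\<omega>. \<integral>\<^sup>+x. U i x \<partial>N \<omega> \<partial>M)"
      using seq(3,5) by (intro nn_integral_monotone_convergence_SUP)
        (auto simp: incseq_def le_fun_def intro!: nn_integral_mono)
    moreover have [measurable]: "(\<lambda>\<omega>. \<integral>\<^sup>+x. U i x \<partial>N \<omega>) \<in> borel_measurable M" for i using seq(5) by simp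
    have "(\<lambda>\<omega>. SUP i. \<integral>\<^sup>+x. U i x \<partial>N \<omega>) \<in> borel_measurable M" by simp
    moreover have "(\<integral>\<^sup>+\<omega>. \<integral>\<^sup>+x. (SUP i. U i) x \<partial>N \<omega> \<partial>M) = (\<integral>\<^sup>+\<omega>. (SUP i. \<integral>\<^sup>+x. U i x \<partial>N \<omega>) \<partial>M)"
      by (rule nn_integral_cong) (rule *)
    moreover have "(\<lambda>\<omega>. \<integral>\<^sup>+x. (SUP i. U i) x \<partial>N \<omega>) \<in> borel_measurable M \<longleftrightarrow>
        (\<lambda>\<omega>. SUP i. \<integral>\<^sup>+x. U i x \<partial>N \<omega>) \<in> borel_measurable M"
      by (rule measurable_cong) (rule *)
    moreover have "(\<integral>\<^sup>+x. (SUP i. U i) x \<partial>mix M S N) = (SUP i. \<integral>\<^sup>+\<omega>. \<integral>\<^sup>+x. U i x \<partial>N \<omega> \<partial>M)"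
      unfolding ** using seq(5) by (simp del: SUP_apply Sup_apply)
    ultimately show ?case by (simp only:)
  qed
  then show "(\<integral>\<^sup>+x. f x \<partial>mix M S N) = (\<integral>\<^sup>+\<omega>. \<integral>\<^sup>+x. f x \<partial>N \<omega> \<partial>M)"
    "(\<lambda>\<omega>. \<integral>\<^sup>+x. f x \<partial>N \<omega>) \<in> borel_measurable M" by auto
qed


section \<open>The space of locally finite point sets\<close>

lemma UN_cball_real: "(\<Union>n::nat. cball x (real n)) = UNIV"
  using real_arch_simple by auto

lemma locally_finite_set_countable:
  fixes V :: "'a::metric_space set"
  assumes "locally_finite_set V"
  shows "countable V"
proof -
  have "V = (\<Union>n::nat. V \<inter> cball undefined (real n))"
    by (simp add: UN_cball_real flip: Int_UN_distrib)
  moreover have "countable (\<Union>n::nat. V \<inter> cball undefined (real n))"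
    using assms by (intro countable_UN[OF countableI_type] countable_finite) (auto simp: locally_finite_set_def)
  ultimately show ?thesis by simp
qed

lemma locally_finite_set_subset: "locally_finite_set V \<Longrightarrow> U \<subseteq> V \<Longrightarrow> locally_finite_set U"
  unfolding locally_finite_set_def by (meson Int_mono finite_subset order_refl)

lemma locally_finite_set_insert [simp]: "locally_finite_set (insert x V) \<longleftrightarrow> locally_finite_set V"
  by (auto simp: locally_finite_set_def Int_insert_left)

lemma locally_finite_set_finite: "finite V \<Longrightarrow> locally_finite_set V"
  by (simp add: locally_finite_set_def)

lemma locally_finite_set_Un: "locally_finite_set U \<Longrightarrow> locally_finite_set V \<Longrightarrow> locally_finite_set (U \<union> V)"
  by (simp add: locally_finite_set_def Int_Un_distrib2)

lemma space_point_space: "space point_space = {V. locally_finite_set V}"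
  unfolding point_space_def by (intro space_measure_of) auto

text \<open>It suffices to test the generators of the \<open>\<sigma>\<close>-field, which are stated in terms of the counts.\<close>

lemma point_space_measurableI:
  fixes V :: "'w \<Rightarrow> 'a::metric_space set"
  assumes lf: "\<And>\<omega>. \<omega> \<in> space M \<Longrightarrow> locally_finite_set (V \<omega>)"
    and N: "\<And>B. B \<in> sets borel \<Longrightarrow> (\<lambda>\<omega>. npoints (V \<omega> \<inter> B)) \<in> borel_measurable M"
  shows "V \<in> measurable M point_space"
  unfolding point_space_def
proof (rule measurable_measure_of)
  fix y :: "'a set set" assume "y \<in> {{\<psi>. locally_finite_set \<psi> \<and> npoints (\<psi> \<inter> B) \<in> K} |B K. B \<in> sets borel \<and> K \<in> sets borel}"
  then obtain B :: "'a set" and K where y: "y = {\<psi>. locally_finite_set \<psi> \<and> npoints (\<psi> \<inter> B) \<in> K}"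
    "B \<in> sets borel" "K \<in> sets borel" by auto
  have "V -` y \<inter> space M = (\<lambda>\<omega>. npoints (V \<omega> \<inter> B)) -` K \<inter> space M"
    using lf y(1) by auto
  then show "V -` y \<inter> space M \<in> sets M"
    using measurable_sets[OF N[OF y(2)] y(3)] by simp
qed (use lf in auto)

lemma measurable_npoints:
  fixes V :: "'w \<Rightarrow> 'a::metric_space set"
  assumes V: "V \<in> measurable M point_space" and B: "B \<in> sets borel"
  shows "(\<lambda>\<omega>. npoints (V \<omega> \<inter> B)) \<in> borel_measurable M"
proof -
  have "(\<lambda>\<psi>. npoints (\<psi> \<inter> B)) \<in> borel_measurable (point_space :: 'a set measure)"
  proof (rule measurableI)
    fix K :: "ennreal set" assume "K \<in> sets borel"
    then have "{\<psi>. locally_finite_set \<psi> \<and> npoints (\<psi> \<inter> B) \<in> K} \<in> sets point_space"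
      unfolding point_space_def using B by (intro in_measure_of) auto
    also have "{\<psi>. locally_finite_set \<psi> \<and> npoints (\<psi> \<inter> B) \<in> K}
        = (\<lambda>\<psi>. npoints (\<psi> \<inter> B)) -` K \<inter> space point_space"
      by (auto simp: space_point_space)
    finally show "(\<lambda>\<psi>. npoints (\<psi> \<inter> B)) -` K \<inter> space (point_space :: 'a set measure) \<in> sets point_space" .
  qed simp
  from measurable_compose[OF V this] show ?thesis .
qed

lemma measurable_void:
  assumes V: "V \<in> measurable M point_space" and B: "B \<in> sets borel"
  shows "{\<omega> \<in> space M. V \<omega> \<inter> B = {}} \<in> sets M"
proof -
  have "{\<omega> \<in> space M. npoints (V \<omega> \<inter> B) = 0} \<in> sets M"
    using measurable_npoints[OF V B] by measurable
  also have "{\<omega> \<in> space M. npoints (V \<omega> \<inter> B) = 0} = {\<omega> \<in> space M. V \<omega> \<inter> B = {}}"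
    by (simp add: emeasure_count_space_eq_0)
  finally show ?thesis .
qed

lemma npoints_eq_nn_integral: "npoints (V \<inter> B) = (\<integral>\<^sup>+x. indicator B x \<partial>count_space V)"
proof -
  have "(\<integral>\<^sup>+x. indicator B x \<partial>count_space V) = (\<integral>\<^sup>+x. indicator (V \<inter> B) x \<partial>count_space UNIV)"
    by (subst nn_integral_count_space_indicator, simp, intro nn_integral_cong)
       (auto split: split_indicator)
  also have "\<dots> = npoints (V \<inter> B)" by (rule nn_integral_indicator) simp
  finally show ?thesis ..
qed

text \<open>The cells are the balls of radius \<open>1 / (k + 1)\<close> around the points of a countable dense set, made
  disjoint.\<close>

lemma dissecting_partitions:
  obtains P :: "nat \<Rightarrow> nat \<Rightarrow> 'a::polish_space set"
  where "\<And>k i. P k i \<in> sets borel" "\<And>k. disjoint_family (P k)" "\<And>k. (\<Union>i. P k i) = UNIV"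
    "\<And>k i x y. x \<in> P k i \<Longrightarrow> y \<in> P k i \<Longrightarrow> dist x y < 2 / real (Suc k)"
proof -
  obtain D :: "'a set" where D: "countable D" "\<And>X. open X \<Longrightarrow> X \<noteq> {} \<Longrightarrow> \<exists>d\<in>D. d \<in> X"
    using countable_dense_setE by blast
  have ne: "D \<noteq> {}" using D(2)[of UNIV] by auto
  define b where "b k i = ball (from_nat_into D i) (1 / real (Suc k))" for k i
  define P where "P k = disjointed (b k)" for k
  show thesis
  proof
    show "P k i \<in> sets borel" for k i
    proof -
      have "range (P k) \<subseteq> sets borel"
        unfolding P_def by (rule sets.range_disjointed_sets) (auto simp: b_def)
      then show ?thesis by auto
    qed
    show "disjoint_family (P k)" for k unfolding P_def by (rule disjoint_family_disjointed)
    show "(\<Union>i. P k i) = UNIV" for k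
    proof -
      have "x \<in> (\<Union>i. b k i)" for x
      proof -
        obtain d where "d \<in> D" "d \<in> ball x (1 / real (Suc k))"
          using D(2)[of "ball x (1 / real (Suc k))"] by (auto simp del: of_nat_Suc)
        moreover then obtain i where "d = from_nat_into D i"
          using from_nat_into_surj[OF D(1)] by metis
        ultimately show ?thesis by (auto simp: b_def dist_commute)
      qed
      then show ?thesis by (auto simp: P_def UN_disjointed_eq)
    qed
    fix k i and x y :: 'a assume "x \<in> P k i" "y \<in> P k i"
    then have "x \<in> b k i" "y \<in> b k i" using disjointed_subset[of "b k" i] by (auto simp: P_def)
    then have "dist x y < 1 / real (Suc k) + 1 / real (Suc k)"
      unfolding b_def by (intro dist_triangle_less_add[of _ "from_nat_into D i"]) (auto simp: dist_commute)
    then show "dist x y < 2 / real (Suc k)" by simp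
  qed
qed

text \<open>The count of a bounded set is the supremum, over finer and finer partitions, of the number of cells
  that contain a point: cells never overcount, and fine cells separate the finitely many points.\<close>

lemma point_space_measurable_voidI:
  fixes V :: "'w \<Rightarrow> 'a::polish_space set"
  assumes lf: "\<And>\<omega>. \<omega> \<in> space M \<Longrightarrow> locally_finite_set (V \<omega>)"
    and void: "\<And>B. B \<in> sets borel \<Longrightarrow> bounded B \<Longrightarrow> {\<omega> \<in> space M. V \<omega> \<inter> B = {}} \<in> sets M"
  shows "V \<in> measurable M point_space"
proof (rule point_space_measurableI)
  obtain P :: "nat \<Rightarrow> nat \<Rightarrow> 'a set" where P: "\<And>k i. P k i \<in> sets borel" "\<And>k. disjoint_family (P k)"
      "\<And>k. (\<Union>i. P k i) = UNIV"
      "\<And>k i x y. x \<in> P k i \<Longrightarrow> y \<in> P k i \<Longrightarrow> dist x y < 2 / real (Suc k)"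
    by (rule dissecting_partitions) blast
  have bd: "(\<lambda>\<omega>. npoints (V \<omega> \<inter> B)) \<in> borel_measurable M"
    if B: "B \<in> sets borel" "bounded B" for B
  proof -
    define h where "h k \<omega> = (\<Sum>i. of_bool (V \<omega> \<inter> (B \<inter> P k i) \<noteq> {}) :: ennreal)" for k \<omega>
    have hm: "h k \<in> borel_measurable M" for k
    proof -
      have "{\<omega> \<in> space M. V \<omega> \<inter> (B \<inter> P k i) = {}} \<in> sets M" for i
        using B P(1) by (intro void) (auto intro: bounded_subset)
      then have "(\<lambda>\<omega>. if V \<omega> \<inter> (B \<inter> P k i) = {} then 0 else 1 :: ennreal) \<in> borel_measurable M" for i
        by (intro measurable_If) auto
      then have "(\<lambda>\<omega>. \<Sum>i. if V \<omega> \<inter> (B \<inter> P k i) = {} then 0 else 1 :: ennreal) \<in> borel_measurable M"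
        by measurable
      then show ?thesis
        by (rule measurable_cong[THEN iffD1, rotated]) (auto simp: h_def intro!: suminf_cong)
    qed
    have "npoints (V \<omega> \<inter> B) = (SUP k. h k \<omega>)" if \<omega>: "\<omega> \<in> space M" for \<omega>
    proof (rule antisym)
      define F where "F = V \<omega> \<inter> B"
      have F: "finite F" using lf[OF \<omega>] B(2) by (auto simp: F_def locally_finite_set_def)
      have sp: "npoints F = (\<Sum>i. npoints (F \<inter> P k i))" for k
      proof -
        have "(\<Sum>i. npoints (F \<inter> P k i)) = npoints (\<Union>i. F \<inter> P k i)"
          using P(2)[of k] by (intro suminf_emeasure) (auto simp: disjoint_family_on_def)
        also have "(\<Union>i. F \<inter> P k i) = F" using P(3)[of k] by auto
        finally show ?thesis ..
      qed
      have one: "of_bool (A \<noteq> {}) \<le> npoints A" for A :: "'a set"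
      proof (cases "A = {}")
        case False
        then obtain a where "a \<in> A" by auto
        then have "npoints {a} \<le> npoints A" by (intro emeasure_mono) auto
        then show ?thesis using False by (simp add: emeasure_count_space_finite)
      qed simp
      show "(SUP k. h k \<omega>) \<le> npoints F"
      proof (rule SUP_least)
        fix k
        have "h k \<omega> \<le> (\<Sum>i. npoints (F \<inter> P k i))"
          unfolding h_def F_def by (intro suminf_le) (use one in \<open>auto simp: Int_assoc\<close>)
        then show "h k \<omega> \<le> npoints F" using sp[of k] by simp
      qed
      (* once the cells are smaller than the minimal distance of the finitely many points,
         every cell contains at most one of them *)
      obtain d where d: "d > 0" "\<And>x y. x \<in> F \<Longrightarrow> y \<in> F \<Longrightarrow> x \<noteq> y \<Longrightarrow> d \<le> dist x y"
      proof -
        define D where "D = insert 1 ((\<lambda>(x, y). dist x y) ` {(x, y) \<in> F \<times> F. x \<noteq> y})"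
        have "finite {(x, y) \<in> F \<times> F. x \<noteq> y}"
          by (rule finite_subset[of _ "F \<times> F"]) (use F in auto)
        then have D: "finite D" "D \<noteq> {}" by (auto simp: D_def)
        have "Min D \<in> D" using D by (rule Min_in)
        then have "Min D > 0" by (auto simp: D_def)
        moreover have "Min D \<le> dist x y" if "x \<in> F" "y \<in> F" "x \<noteq> y" for x y
          using that D by (intro Min_le) (auto simp: D_def)
        ultimately show thesis using that by blast
      qed
      obtain k where k: "2 / real (Suc k) < d"
      proof -
        obtain n where "2 / d < real n" using reals_Archimedean2 by blast
        then have "2 / d < real (Suc n)" by simp
        then have "2 / real (Suc n) < d" using d(1) by (simp add: field_simps)
        then show thesis using that by blast
      qed
      have "npoints (F \<inter> P k i) \<le> of_bool (V \<omega> \<inter> (B \<inter> P k i) \<noteq> {})" for i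
      proof (cases "F \<inter> P k i = {}")
        case False
        then obtain a where a: "a \<in> F" "a \<in> P k i" by auto
        have "F \<inter> P k i = {a}"
          using a d(2) P(4)[of _ k i] k by fastforce
        moreover have "V \<omega> \<inter> (B \<inter> P k i) \<noteq> {}" using a by (auto simp: F_def)
        ultimately show ?thesis by (simp add: emeasure_count_space_finite)
      qed simp
      then have "npoints F \<le> h k \<omega>"
        unfolding h_def sp[of k] by (intro suminf_le) auto
      then show "npoints F \<le> (SUP k. h k \<omega>)" by (rule order_trans) (rule SUP_upper, simp)
    qed
    then show ?thesis
      using hm by (subst measurable_cong[where g="\<lambda>\<omega>. SUP k. h k \<omega>"]) auto
  qed
  fix B :: "'a set" assume B: "B \<in> sets borel"
  define C where "C n = B \<inter> cball undefined (real n)" for n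
  have C: "C n \<in> sets borel" "bounded (C n)" for n
    using B by (auto simp: C_def intro: bounded_subset[OF bounded_cball])
  have "(\<lambda>\<omega>. SUP n. npoints (V \<omega> \<inter> C n)) \<in> borel_measurable M"
    using bd[OF C] by measurable
  also have "(\<lambda>\<omega>. SUP n. npoints (V \<omega> \<inter> C n)) = (\<lambda>\<omega>. npoints (V \<omega> \<inter> B))"
  proof
    fix \<omega>
    have "(SUP n. npoints (V \<omega> \<inter> C n)) = npoints (\<Union>n. V \<omega> \<inter> C n)"
      by (rule SUP_emeasure_incseq) (auto simp: incseq_def C_def)
    also have "(\<Union>n. V \<omega> \<inter> C n) = V \<omega> \<inter> B"
      by (simp add: C_def UN_cball_real flip: Int_UN_distrib Int_assoc)
    finally show "(SUP n. npoints (V \<omega> \<inter> C n)) = npoints (V \<omega> \<inter> B)" .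
  qed
  finally show "(\<lambda>\<omega>. npoints (V \<omega> \<inter> B)) \<in> borel_measurable M" .
qed (fact lf)

definition void_events :: "'a::metric_space set set set" where
  "void_events = {{V. locally_finite_set V \<and> V \<inter> B = {}} |B. B \<in> sets borel \<and> bounded B}"

lemma sets_point_space_void:
  "sets (point_space :: 'a::polish_space set measure) = sigma_sets {V. locally_finite_set V} void_events"
  (is "_ = sigma_sets ?\<Omega> ?E")
proof
  have sub: "?E \<subseteq> Pow ?\<Omega>" by (auto simp: void_events_def)
  have "(\<lambda>V. V) \<in> measurable (sigma ?\<Omega> ?E) point_space"
  proof (rule point_space_measurable_voidI)
    fix B :: "'a set" assume "B \<in> sets borel" "bounded B"
    then show "{\<omega> \<in> space (sigma ?\<Omega> ?E). \<omega> \<inter> B = {}} \<in> sets (sigma ?\<Omega> ?E)"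
      using sub by (auto simp: space_measure_of void_events_def)
  qed (use sub in \<open>simp add: space_measure_of\<close>)
  note id = this
  show "sets point_space \<subseteq> sigma_sets ?\<Omega> ?E"
  proof
    fix A :: "'a set set" assume A: "A \<in> sets point_space"
    have "A \<subseteq> ?\<Omega>" using sets.sets_into_space[OF A] by (simp add: space_point_space)
    then have "(\<lambda>V. V) -` A \<inter> space (sigma ?\<Omega> ?E) = A"
      using sub by (simp add: space_measure_of Int_absorb2)
    then show "A \<in> sigma_sets ?\<Omega> ?E"
      using measurable_sets[OF id A] sub by (simp add: sets_measure_of)
  qed
  have "{V. locally_finite_set V \<and> V \<inter> B = {}} \<in> sets point_space" if "B \<in> sets borel" for B :: "'a set"
    using measurable_void[OF measurable_ident that] by (simp add: space_point_space)
  then have "sigma_sets (space point_space) ?E \<subseteq> sets point_space"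
    by (intro sets.sigma_sets_subset) (auto simp: void_events_def)
  then show "sigma_sets ?\<Omega> ?E \<subseteq> sets point_space" by (simp add: space_point_space)
qed

text \<open>Having no point in \<open>A\<close> and none in \<open>B\<close> means having no point in \<open>A \<union> B\<close>.\<close>

lemma Int_stable_void: "Int_stable (void_events :: 'a::metric_space set set set)"
proof (rule Int_stableI)
  fix a b :: "'a set set" assume "a \<in> void_events" "b \<in> void_events"
  then obtain A B where "A \<in> sets borel" "bounded A" "B \<in> sets borel" "bounded B"
    "a = {V. locally_finite_set V \<and> V \<inter> A = {}}" "b = {V. locally_finite_set V \<and> V \<inter> B = {}}"
    by (auto simp: void_events_def)
  then show "a \<inter> b \<in> void_events"
    unfolding void_events_def by (intro CollectI exI[of _ "A \<union> B"]) auto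
qed

section \<open>Sums over the points of a random point set\<close>

text \<open>The counting measures of \<open>V \<omega>\<close> form a kernel that is finite on bounded sets.\<close>

lemma point_sum_measurable:
  fixes V :: "'w \<Rightarrow> 'a::metric_space set"
  assumes V: "V \<in> measurable M point_space"
    and f: "f \<in> borel_measurable (M \<Otimes>\<^sub>M borel)"
  shows "(\<lambda>\<omega>. \<integral>\<^sup>+x. f (\<omega>, x) \<partial>count_space (V \<omega>)) \<in> borel_measurable M"
proof -
  define N where "N \<omega> = distr (count_space (V \<omega>)) borel (\<lambda>x. x)" for \<omega>
  have N_eq: "emeasure (N \<omega>) B = npoints (V \<omega> \<inter> B)" if "B \<in> sets borel" for \<omega> B
  proof -
    have "emeasure (N \<omega>) B = (\<integral>\<^sup>+x. indicator B x \<partial>N \<omega>)" using that by (simp add: N_def)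
    also have "\<dots> = npoints (V \<omega> \<inter> B)"
      unfolding N_def npoints_eq_nn_integral using that by (subst nn_integral_distr) auto
    finally show ?thesis .
  qed
  have lf: "locally_finite_set (V \<omega>)" if "\<omega> \<in> space M" for \<omega>
    using measurable_space[OF V that] by (simp add: space_point_space)
  have "(\<lambda>\<omega>. \<integral>\<^sup>+x. f (\<omega>, x) \<partial>N \<omega>) \<in> borel_measurable M"
  proof (rule kernel_nn_integral_measurable[where S=borel and B="\<lambda>n. cball undefined (real n)"])
    show "(\<Union>n. cball (undefined :: 'a) (real n)) = space borel"
      by (simp add: UN_cball_real)
    show "emeasure (N \<omega>) (cball undefined (real n)) \<noteq> \<infinity>" if "\<omega> \<in> space M" for \<omega> n
      using lf[OF that] by (auto simp: N_eq locally_finite_set_def)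
    show "(\<lambda>\<omega>. emeasure (N \<omega>) A) \<in> borel_measurable M" if "A \<in> sets borel" for A
      using measurable_npoints[OF V that] by (simp add: N_eq that)
  qed (use f in \<open>auto simp: N_def incseq_def\<close>)
  then show ?thesis
  proof (rule measurable_cong[THEN iffD1, rotated])
    fix \<omega> assume \<omega>: "\<omega> \<in> space M"
    show "(\<integral>\<^sup>+x. f (\<omega>, x) \<partial>N \<omega>) = (\<integral>\<^sup>+x. f (\<omega>, x) \<partial>count_space (V \<omega>))"
      unfolding N_def using measurable_compose[OF measurable_Pair1'[OF \<omega>] f]
      by (subst nn_integral_distr) auto
  qed
qed


lemma void_events_bounds:
  "void_events \<subseteq> Pow {V. locally_finite_set V}" "{V. locally_finite_set V} \<in> void_events"
  by (auto simp: void_events_def intro!: exI[of _ "{}"])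

lemma sets_borel_point_space:
  "sets (borel \<Otimes>\<^sub>M (point_space :: 'a::polish_space set measure)) =
    sigma_sets (UNIV \<times> {V. locally_finite_set V}) {a \<times> b |a b. a \<in> sets (borel :: 'a measure) \<and> b \<in> void_events}"
proof -
  have "sets (borel \<Otimes>\<^sub>M (point_space :: 'a set measure)) =
    sets (sigma (space (borel :: 'a measure) \<times> space (point_space :: 'a set measure))
      {a \<times> b |a b. a \<in> sets (borel :: 'a measure) \<and> b \<in> void_events})"
  proof (rule sets_pair_eq[where Ca="{UNIV}" and Cb="{{V. locally_finite_set V}}"])
    show "sets (borel :: 'a measure) = sigma_sets (space borel) (sets borel)"
      by (metis sets.sigma_sets_eq)
  qed (use void_events_bounds in \<open>auto simp: space_point_space sets_point_space_void\<close>)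
  also have "\<dots> = sigma_sets (UNIV \<times> {V. locally_finite_set V})
      {a \<times> b |a b. a \<in> sets (borel :: 'a measure) \<and> b \<in> void_events}"
    using void_events_bounds(1) by (subst sets_measure_of) (auto simp: space_point_space)
  finally show ?thesis .
qed

lemma Int_stable_borel_void:
  "Int_stable {a \<times> b |a b. a \<in> sets (borel :: 'a::metric_space measure) \<and> b \<in> (void_events :: 'a set set set)}"
proof (rule Int_stableI)
  fix x y :: "('a \<times> 'a set) set" assume "x \<in> {a \<times> b |a b. a \<in> sets (borel :: 'a measure) \<and> b \<in> void_events}"
    "y \<in> {a \<times> b |a b. a \<in> sets (borel :: 'a measure) \<and> b \<in> void_events}"
  then obtain a b c d where *: "x = a \<times> b" "y = c \<times> d" "a \<in> sets borel" "c \<in> sets borel"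
    "b \<in> void_events" "d \<in> void_events" by blast
  have "x \<inter> y = (a \<inter> c) \<times> (b \<inter> d)" using * by auto
  then show "x \<inter> y \<in> {a \<times> b |a b. a \<in> sets (borel :: 'a measure) \<and> b \<in> (void_events :: 'a set set set)}"
    using * Int_stable_void[where 'a='a]
    by (intro CollectI exI[of _ "a \<inter> c"] exI[of _ "b \<inter> d"]) (auto simp: Int_stable_def)
qed

lemma measurable_of_bool_ennreal: "Measurable.pred M P \<Longrightarrow> (\<lambda>\<omega>. of_bool (P \<omega>) :: ennreal) \<in> borel_measurable M"
  by (rule measurable_compose[of P M "count_space UNIV" of_bool]) simp_all

lemma nn_integral_of_bool_count_space_eq_0:
  "(\<integral>\<^sup>+x. of_bool (Q x) \<partial>count_space V) = 0 \<longleftrightarrow> (\<forall>x\<in>V. \<not> Q x)"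
  by (simp add: nn_integral_0_iff_AE AE_count_space)

text \<open>A quantifier over the points of \<open>V \<omega>\<close> asks whether a sum over these points is positive.\<close>

lemma pred_ex_point:
  fixes V :: "'w \<Rightarrow> 'a::metric_space set"
  assumes V: "V \<in> measurable M point_space"
    and Q: "Measurable.pred (M \<Otimes>\<^sub>M borel) (\<lambda>(\<omega>, x). Q \<omega> x)"
  shows "Measurable.pred M (\<lambda>\<omega>. \<exists>x\<in>V \<omega>. Q \<omega> x)"
proof -
  define f where "f = (\<lambda>(\<omega>, x). of_bool (Q \<omega> x) :: ennreal)"
  have "f \<in> borel_measurable (M \<Otimes>\<^sub>M borel)"
    using measurable_compose[OF Q, of of_bool "borel :: ennreal measure"]
    by (simp add: f_def case_prod_beta)
  from point_sum_measurable[OF V this]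
  have "{\<omega> \<in> space M. (\<integral>\<^sup>+x. f (\<omega>, x) \<partial>count_space (V \<omega>)) \<noteq> 0} \<in> sets M"
    by measurable
  also have "{\<omega> \<in> space M. (\<integral>\<^sup>+x. f (\<omega>, x) \<partial>count_space (V \<omega>)) \<noteq> 0} = {\<omega> \<in> space M. \<exists>x\<in>V \<omega>. Q \<omega> x}"
    by (auto simp: f_def nn_integral_of_bool_count_space_eq_0)
  finally show ?thesis by (simp add: pred_def)
qed

lemma pred_mem_point:
  fixes V :: "'w \<Rightarrow> 'a::polish_space set"
  assumes V: "V \<in> measurable M point_space" and x: "x \<in> measurable M borel"
  shows "Measurable.pred M (\<lambda>\<omega>. x \<omega> \<in> V \<omega>)"
proof -
  note [measurable] = x
  have "Measurable.pred M (\<lambda>\<omega>. \<exists>y\<in>V \<omega>. x \<omega> = y)"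
    by (rule pred_ex_point[OF V]) measurable
  then show ?thesis by (rule measurable_cong[THEN iffD1, rotated]) auto
qed

lemma point_space_measurable_predI:
  fixes V :: "'w \<Rightarrow> 'a::polish_space set"
  assumes lf: "\<And>\<omega>. \<omega> \<in> space M \<Longrightarrow> locally_finite_set (V \<omega>)"
    and void: "\<And>B. B \<in> sets borel \<Longrightarrow> Measurable.pred M (\<lambda>\<omega>. V \<omega> \<inter> B = {})"
  shows "V \<in> measurable M point_space"
  using assms by (intro point_space_measurable_voidI) (auto simp: pred_def)

lemma pred_void:
  assumes "V \<in> measurable M point_space" "B \<in> sets borel"
  shows "Measurable.pred M (\<lambda>\<omega>. V \<omega> \<inter> B = {})"
  using measurable_void[OF assms] by (simp add: pred_def)

lemma measurable_point_lf:
  "V \<in> measurable M point_space \<Longrightarrow> \<omega> \<in> space M \<Longrightarrow> locally_finite_set (V \<omega>)"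
  using measurable_space[of V M point_space \<omega>] by (simp add: space_point_space)

lemma measurable_insert_point [measurable (raw)]:
  fixes V :: "'w \<Rightarrow> 'a::polish_space set"
  assumes V: "V \<in> measurable M point_space" and x [measurable]: "x \<in> measurable M borel"
  shows "(\<lambda>\<omega>. insert (x \<omega>) (V \<omega>)) \<in> measurable M point_space"
proof (rule point_space_measurable_predI)
  fix B :: "'a set" assume [measurable]: "B \<in> sets borel"
  have [measurable]: "Measurable.pred M (\<lambda>\<omega>. V \<omega> \<inter> B = {})" by (rule pred_void[OF V]) simp
  have "Measurable.pred M (\<lambda>\<omega>. x \<omega> \<notin> B \<and> V \<omega> \<inter> B = {})" by measurable
  then show "Measurable.pred M (\<lambda>\<omega>. insert (x \<omega>) (V \<omega>) \<inter> B = {})"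
    by (rule measurable_cong[THEN iffD1, rotated]) auto
qed (use measurable_point_lf[OF V] in simp)

lemma measurable_Un_point [measurable (raw)]:
  fixes V :: "'w \<Rightarrow> 'a::polish_space set"
  assumes V: "V \<in> measurable M point_space" and U: "U \<in> measurable M point_space"
  shows "(\<lambda>\<omega>. U \<omega> \<union> V \<omega>) \<in> measurable M point_space"
proof (rule point_space_measurable_predI)
  fix B :: "'a set" assume [measurable]: "B \<in> sets borel"
  have [measurable]: "Measurable.pred M (\<lambda>\<omega>. V \<omega> \<inter> B = {})" by (rule pred_void[OF V]) simp
  have [measurable]: "Measurable.pred M (\<lambda>\<omega>. U \<omega> \<inter> B = {})" by (rule pred_void[OF U]) simp
  have "Measurable.pred M (\<lambda>\<omega>. U \<omega> \<inter> B = {} \<and> V \<omega> \<inter> B = {})" by measurable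
  then show "Measurable.pred M (\<lambda>\<omega>. (U \<omega> \<union> V \<omega>) \<inter> B = {})"
    by (rule measurable_cong[THEN iffD1, rotated]) auto
qed (use measurable_point_lf[OF V] measurable_point_lf[OF U] in \<open>simp add: locally_finite_set_Un\<close>)

lemma measurable_filter_point:
  fixes V :: "'w \<Rightarrow> 'a::polish_space set"
  assumes V: "V \<in> measurable M point_space"
    and Q [measurable]: "Measurable.pred (M \<Otimes>\<^sub>M borel) (\<lambda>(\<omega>, x). Q \<omega> x)"
  shows "(\<lambda>\<omega>. {x \<in> V \<omega>. Q \<omega> x}) \<in> measurable M point_space"
proof (rule point_space_measurable_predI)
  fix B :: "'a set" assume [measurable]: "B \<in> sets borel"
  have "Measurable.pred M (\<lambda>\<omega>. \<exists>x\<in>V \<omega>. Q \<omega> x \<and> x \<in> B)"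
    by (rule pred_ex_point[OF V]) measurable
  then have "Measurable.pred M (\<lambda>\<omega>. \<not> (\<exists>x\<in>V \<omega>. Q \<omega> x \<and> x \<in> B))" by measurable
  then show "Measurable.pred M (\<lambda>\<omega>. {x \<in> V \<omega>. Q \<omega> x} \<inter> B = {})"
    by (rule measurable_cong[THEN iffD1, rotated]) auto
next
  fix \<omega> assume "\<omega> \<in> space M"
  from measurable_point_lf[OF V this] show "locally_finite_set {x \<in> V \<omega>. Q \<omega> x}"
    by (rule locally_finite_set_subset) auto
qed

lemma measurable_delete_point:
  fixes V :: "'w \<Rightarrow> 'a::polish_space set"
  assumes V: "V \<in> measurable M point_space" and x [measurable]: "x \<in> measurable M borel"
  shows "(\<lambda>\<omega>. V \<omega> - {x \<omega>}) \<in> measurable M point_space"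
proof -
  have "(\<lambda>\<omega>. {y \<in> V \<omega>. y \<noteq> x \<omega>}) \<in> measurable M point_space"
    by (rule measurable_filter_point[OF V]) measurable
  also have "(\<lambda>\<omega>. {y \<in> V \<omega>. y \<noteq> x \<omega>}) = (\<lambda>\<omega>. V \<omega> - {x \<omega>})" by auto
  finally show ?thesis .
qed

section \<open>The space of graphs\<close>

lemma space_graph_space: "space graph_space = graphs"
  unfolding graph_space_def by (intro space_measure_of) auto

lemma graphs_edgeD: "\<mu> \<in> graphs \<Longrightarrow> {x, y} \<in> edges \<mu> \<Longrightarrow> x \<in> verts \<mu> \<and> y \<in> verts \<mu> \<and> x \<noteq> y"
  by (auto simp: graphs_def vertex_pairs_def card_2_iff)

lemma neighbours_subset: "\<mu> \<in> graphs \<Longrightarrow> neighbours \<mu> x \<subseteq> verts \<mu>"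
  using graphs_edgeD by (fastforce simp: neighbours_def)

lemma locally_finite_neighbours: "\<mu> \<in> graphs \<Longrightarrow> locally_finite_set (neighbours \<mu> x)"
  using neighbours_subset[of \<mu> x] locally_finite_set_subset[of "verts \<mu>" "neighbours \<mu> x"]
  by (simp add: graphs_def)

lemma graph_space_measurableI:
  fixes \<mu> :: "'w \<Rightarrow> 'a::metric_space graph"
  assumes gr: "\<And>\<omega>. \<omega> \<in> space M \<Longrightarrow> \<mu> \<omega> \<in> graphs"
    and ev: "\<And>A. A \<in> sets (borel \<Otimes>\<^sub>M point_space) \<Longrightarrow> (\<lambda>\<omega>. graph_eval (\<mu> \<omega>) A) \<in> borel_measurable M"
  shows "\<mu> \<in> measurable M graph_space"
  unfolding graph_space_def
proof (rule measurable_measure_of)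
  fix y :: "'a graph set"
  assume "y \<in> {{\<mu> \<in> graphs. graph_eval \<mu> A \<in> K} |A K. A \<in> sets (borel \<Otimes>\<^sub>M point_space) \<and> K \<in> sets borel}"
  then obtain A :: "('a \<times> 'a set) set" and K where y: "y = {\<mu> \<in> graphs. graph_eval \<mu> A \<in> K}"
    "A \<in> sets (borel \<Otimes>\<^sub>M point_space)" "K \<in> sets borel" by auto
  have "\<mu> -` y \<inter> space M = (\<lambda>\<omega>. graph_eval (\<mu> \<omega>) A) -` K \<inter> space M"
    using gr y(1) by auto
  then show "\<mu> -` y \<inter> space M \<in> sets M"
    using measurable_sets[OF ev[OF y(2)] y(3)] by simp
qed (use gr in auto)

lemma measurable_graph_eval:
  fixes \<mu> :: "'w \<Rightarrow> 'a::metric_space graph"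
  assumes \<mu>: "\<mu> \<in> measurable M graph_space" and A: "A \<in> sets (borel \<Otimes>\<^sub>M point_space)"
  shows "(\<lambda>\<omega>. graph_eval (\<mu> \<omega>) A) \<in> borel_measurable M"
proof -
  have "(\<lambda>\<mu>. graph_eval \<mu> A) \<in> borel_measurable (graph_space :: 'a graph measure)"
  proof (rule measurableI)
    fix K :: "ennreal set" assume "K \<in> sets borel"
    then have "{\<mu> \<in> graphs. graph_eval \<mu> A \<in> K} \<in> sets graph_space"
      unfolding graph_space_def using A by (intro in_measure_of) auto
    also have "{\<mu> \<in> graphs. graph_eval \<mu> A \<in> K} = (\<lambda>\<mu>. graph_eval \<mu> A) -` K \<inter> space graph_space"
      by (auto simp: space_graph_space)
    finally show "(\<lambda>\<mu>. graph_eval \<mu> A) -` K \<inter> space (graph_space :: 'a graph measure) \<in> sets graph_space" .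
  qed simp
  from measurable_compose[OF \<mu> this] show ?thesis .
qed

lemma measurable_graphs: "\<mu> \<in> measurable M graph_space \<Longrightarrow> \<omega> \<in> space M \<Longrightarrow> \<mu> \<omega> \<in> graphs"
  using measurable_space[of \<mu> M graph_space \<omega>] by (simp add: space_graph_space)

lemma measurable_verts:
  fixes \<mu> :: "'w \<Rightarrow> 'a::metric_space graph"
  assumes \<mu>: "\<mu> \<in> measurable M graph_space"
  shows "(\<lambda>\<omega>. verts (\<mu> \<omega>)) \<in> measurable M point_space"
proof (rule point_space_measurableI)
  show "locally_finite_set (verts (\<mu> \<omega>))" if "\<omega> \<in> space M" for \<omega>
    using measurable_graphs[OF \<mu> that] by (simp add: graphs_def)
  fix B :: "'a set" assume B: "B \<in> sets borel"
  have "B \<times> space point_space \<in> sets (borel \<Otimes>\<^sub>M point_space)" using B by simp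
  from measurable_graph_eval[OF \<mu> this] show "(\<lambda>\<omega>. npoints (verts (\<mu> \<omega>) \<inter> B)) \<in> borel_measurable M"
  proof (rule measurable_cong[THEN iffD1, rotated])
    fix \<omega> assume "\<omega> \<in> space M"
    then have "{x \<in> verts (\<mu> \<omega>). (x, neighbours (\<mu> \<omega>) x) \<in> B \<times> space point_space} = verts (\<mu> \<omega>) \<inter> B"
      using locally_finite_neighbours[OF measurable_graphs[OF \<mu>]] by (auto simp: space_point_space)
    then show "graph_eval (\<mu> \<omega>) (B \<times> space point_space) = npoints (verts (\<mu> \<omega>) \<inter> B)"
      by (simp add: graph_eval_def)
  qed
qed

lemma graph_eval_eq_nn_integral:
  "graph_eval \<mu> A = (\<integral>\<^sup>+x. indicator A (x, neighbours \<mu> x) \<partial>count_space (verts \<mu>))"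
proof -
  have "{x \<in> verts \<mu>. (x, neighbours \<mu> x) \<in> A} = verts \<mu> \<inter> {x. (x, neighbours \<mu> x) \<in> A}" by auto
  then show ?thesis
    unfolding graph_eval_def by (simp add: npoints_eq_nn_integral) (simp add: indicator_def)
qed

text \<open>The version of \<open>point_sum_measurable\<close> for a graph, seen as the counting measure of the pairs of a
  vertex and its neighbourhood.\<close>

lemma vertex_sum_measurable:
  fixes \<mu> :: "'w \<Rightarrow> 'a::metric_space graph"
  assumes \<mu>: "\<mu> \<in> measurable M graph_space"
    and f: "f \<in> borel_measurable (M \<Otimes>\<^sub>M (borel \<Otimes>\<^sub>M point_space))"
  shows "(\<lambda>\<omega>. \<integral>\<^sup>+x. f (\<omega>, x, neighbours (\<mu> \<omega>) x) \<partial>count_space (verts (\<mu> \<omega>))) \<in> borel_measurable M"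
proof -
  let ?S = "borel \<Otimes>\<^sub>M (point_space :: 'a set measure)"
  define N where "N \<omega> = distr (count_space (verts (\<mu> \<omega>))) ?S (\<lambda>x. (x, neighbours (\<mu> \<omega>) x))" for \<omega>
  have m: "(\<lambda>x. (x, neighbours (\<mu> \<omega>) x)) \<in> measurable (count_space (verts (\<mu> \<omega>))) ?S"
    if "\<omega> \<in> space M" for \<omega>
    using locally_finite_neighbours[OF measurable_graphs[OF \<mu> that]]
    by (auto simp: space_pair_measure space_point_space)
  have N_eq: "(\<integral>\<^sup>+x. g x \<partial>N \<omega>) = (\<integral>\<^sup>+x. g (x, neighbours (\<mu> \<omega>) x) \<partial>count_space (verts (\<mu> \<omega>)))"
    if "\<omega> \<in> space M" "g \<in> borel_measurable ?S" for \<omega> g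
    unfolding N_def using m[OF that(1)] that(2) by (subst nn_integral_distr) auto
  have N_ev: "emeasure (N \<omega>) A = graph_eval (\<mu> \<omega>) A" if "\<omega> \<in> space M" "A \<in> sets ?S" for \<omega> A
    using N_eq[OF that(1), of "indicator A"] that(2) by (simp add: graph_eval_eq_nn_integral N_def)
  have "(\<lambda>\<omega>. \<integral>\<^sup>+x. f (\<omega>, x) \<partial>N \<omega>) \<in> borel_measurable M"
  proof (rule kernel_nn_integral_measurable[where S="?S" and B="\<lambda>n. cball undefined (real n) \<times> space point_space"])
    show "(\<Union>n. cball (undefined :: 'a) (real n) \<times> space point_space) = space ?S"
      using UN_cball_real[of "undefined :: 'a"] by (auto simp: space_pair_measure)
    show "emeasure (N \<omega>) (cball undefined (real n) \<times> space point_space) \<noteq> \<infinity>" if "\<omega> \<in> space M" for \<omega> n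
    proof -
      have "{x \<in> verts (\<mu> \<omega>). (x, neighbours (\<mu> \<omega>) x) \<in> cball undefined (real n) \<times> space point_space}
         \<subseteq> verts (\<mu> \<omega>) \<inter> cball undefined (real n)" by auto
      moreover have "finite (verts (\<mu> \<omega>) \<inter> cball undefined (real n))"
        using measurable_graphs[OF \<mu> that] by (auto simp: graphs_def locally_finite_set_def)
      ultimately have "finite {x \<in> verts (\<mu> \<omega>). (x, neighbours (\<mu> \<omega>) x) \<in> cball undefined (real n) \<times> space point_space}"
        by (rule finite_subset)
      then show ?thesis by (subst N_ev[OF that]) (auto simp: graph_eval_def)
    qed
    show "(\<lambda>\<omega>. emeasure (N \<omega>) A) \<in> borel_measurable M" if "A \<in> sets ?S" for A
      using measurable_graph_eval[OF \<mu> that] by (rule measurable_cong[THEN iffD1, rotated]) (simp add: N_ev that)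
    show "incseq (\<lambda>n. cball (undefined :: 'a) (real n) \<times> space (point_space :: 'a set measure))"
      by (auto simp: incseq_def)
  qed (use f in \<open>auto simp: N_def\<close>)
  then show ?thesis
  proof (rule measurable_cong[THEN iffD1, rotated])
    fix \<omega> assume \<omega>: "\<omega> \<in> space M"
    show "(\<integral>\<^sup>+x. f (\<omega>, x) \<partial>N \<omega>) =
        (\<integral>\<^sup>+x. f (\<omega>, x, neighbours (\<mu> \<omega>) x) \<partial>count_space (verts (\<mu> \<omega>)))"
      using N_eq[OF \<omega> measurable_compose[OF measurable_Pair1'[OF \<omega>] f]] .
  qed
qed

text \<open>The pair is an edge if the sum over all vertices \<open>z\<close> with \<open>z = x \<omega>\<close> and \<open>y \<omega>\<close> among the neighbours of
  \<open>z\<close> is positive.\<close>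

lemma pred_edge:
  fixes \<mu> :: "'w \<Rightarrow> 'a::polish_space graph"
  assumes \<mu>: "\<mu> \<in> measurable M graph_space"
    and x [measurable]: "x \<in> measurable M borel" and y [measurable]: "y \<in> measurable M borel"
  shows "Measurable.pred M (\<lambda>\<omega>. {x \<omega>, y \<omega>} \<in> edges (\<mu> \<omega>))"
proof -
  define f where "f = (\<lambda>(\<omega>, z, \<psi>). of_bool (z = x \<omega> \<and> y \<omega> \<in> \<psi>) :: ennreal)"
  have "Measurable.pred (M \<Otimes>\<^sub>M (borel \<Otimes>\<^sub>M point_space)) (\<lambda>p. y (fst p) \<in> snd (snd p))"
    by (rule pred_mem_point) measurable
  then have "Measurable.pred (M \<Otimes>\<^sub>M (borel \<Otimes>\<^sub>M point_space)) (\<lambda>p. fst (snd p) = x (fst p) \<and> y (fst p) \<in> snd (snd p))"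
    by measurable
  then have "f \<in> borel_measurable (M \<Otimes>\<^sub>M (borel \<Otimes>\<^sub>M point_space))"
    using measurable_compose[of _ _ _ of_bool "borel :: ennreal measure"]
    by (simp add: f_def case_prod_beta)
  from vertex_sum_measurable[OF \<mu> this]
  have "{\<omega> \<in> space M. (\<integral>\<^sup>+z. f (\<omega>, z, neighbours (\<mu> \<omega>) z) \<partial>count_space (verts (\<mu> \<omega>))) \<noteq> 0} \<in> sets M"
    by measurable
  also have "{\<omega> \<in> space M. (\<integral>\<^sup>+z. f (\<omega>, z, neighbours (\<mu> \<omega>) z) \<partial>count_space (verts (\<mu> \<omega>))) \<noteq> 0}
     = {\<omega> \<in> space M. {x \<omega>, y \<omega>} \<in> edges (\<mu> \<omega>)}"
    using graphs_edgeD[OF measurable_graphs[OF \<mu>]]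
    by (auto simp: f_def nn_integral_of_bool_count_space_eq_0 neighbours_def)
  finally show ?thesis by (simp add: pred_def)
qed

section \<open>Void events of graphs\<close>

text \<open>For a rectangle \<open>a \<times> {\<psi>. \<psi> \<inter> B = {}}\<close>, the evaluation counts the vertices in \<open>a\<close> minus those with a
  neighbour in \<open>B\<close>. The latter form a random point set whose void events say that there is no
  edge between two regions, so this count is measurable. Such rectangles generate, and within a bounded
  window all counts are finite, so that \<open>finite_kernel_generated\<close> applies.\<close>

lemma graph_space_measurable_voidI:
  fixes \<mu> :: "'w \<Rightarrow> 'a::polish_space graph"
  assumes gr: "\<And>\<omega>. \<omega> \<in> space M \<Longrightarrow> \<mu> \<omega> \<in> graphs"
    and void: "\<And>B. B \<in> sets borel \<Longrightarrow> {\<omega> \<in> space M. verts (\<mu> \<omega>) \<inter> B = {}} \<in> sets M"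
    and evoid: "\<And>D. D \<in> sets (borel \<Otimes>\<^sub>M borel) \<Longrightarrow>
      {\<omega> \<in> space M. \<forall>x y. (x, y) \<in> D \<longrightarrow> {x, y} \<notin> edges (\<mu> \<omega>)} \<in> sets M"
  shows "\<mu> \<in> measurable M graph_space"
proof (rule graph_space_measurableI[OF gr])
  have lf: "locally_finite_set (verts (\<mu> \<omega>))" if "\<omega> \<in> space M" for \<omega>
    using gr[OF that] by (simp add: graphs_def)
  have V: "(\<lambda>\<omega>. verts (\<mu> \<omega>)) \<in> measurable M point_space"
    using lf void by (intro point_space_measurable_voidI) auto
  let ?S = "borel \<Otimes>\<^sub>M (point_space :: 'a set measure)"
  define C where "C n = cball (undefined :: 'a) (real n)" for n
  define N where "N n \<omega> = distr (count_space (verts (\<mu> \<omega>) \<inter> C n)) ?S (\<lambda>x. (x, neighbours (\<mu> \<omega>) x))" for n \<omega>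
  have m: "(\<lambda>x. (x, neighbours (\<mu> \<omega>) x)) \<in> measurable (count_space (verts (\<mu> \<omega>) \<inter> C n)) ?S"
    if "\<omega> \<in> space M" for \<omega> n
    using locally_finite_neighbours[OF gr[OF that]]
    by (auto simp: space_pair_measure space_point_space)
  have N_ev: "emeasure (N n \<omega>) A = npoints {x \<in> verts (\<mu> \<omega>) \<inter> C n. (x, neighbours (\<mu> \<omega>) x) \<in> A}"
    if "\<omega> \<in> space M" "A \<in> sets ?S" for n \<omega> A
  proof -
    have "emeasure (N n \<omega>) A = emeasure (count_space (verts (\<mu> \<omega>) \<inter> C n))
      ((\<lambda>x. (x, neighbours (\<mu> \<omega>) x)) -` A \<inter> (verts (\<mu> \<omega>) \<inter> C n))"
      using m[OF that(1)] that(2) by (simp add: N_def emeasure_distr)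
    also have "(\<lambda>x. (x, neighbours (\<mu> \<omega>) x)) -` A \<inter> (verts (\<mu> \<omega>) \<inter> C n) =
       {x \<in> verts (\<mu> \<omega>) \<inter> C n. (x, neighbours (\<mu> \<omega>) x) \<in> A}" by auto
    also have "emeasure (count_space (verts (\<mu> \<omega>) \<inter> C n)) \<dots> = npoints \<dots>"
      by (subst (1 2) emeasure_count_space) auto
    finally show ?thesis .
  qed
  have fin: "finite (verts (\<mu> \<omega>) \<inter> C n)" if "\<omega> \<in> space M" for \<omega> n
    using lf[OF that] by (auto simp: locally_finite_set_def C_def)
  have NE: "(\<lambda>\<omega>. emeasure (N n \<omega>) (a \<times> b)) \<in> borel_measurable M"
    if a: "a \<in> sets borel" and b: "b \<in> void_events" for n a b
  proof -
    obtain B where B: "B \<in> sets borel" "b = {V. locally_finite_set V \<and> V \<inter> B = {}}"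
      using b by (auto simp: void_events_def)
    (* vertices of a in the window that have a neighbour in B *)
    define U where "U \<omega> = {x \<in> verts (\<mu> \<omega>) \<inter> C n \<inter> a. neighbours (\<mu> \<omega>) x \<inter> B \<noteq> {}}" for \<omega>
    have U: "U \<in> measurable M point_space"
    proof (rule point_space_measurable_voidI)
      show "locally_finite_set (U \<omega>)" if "\<omega> \<in> space M" for \<omega>
        using lf[OF that] by (rule locally_finite_set_subset) (auto simp: U_def)
      fix A :: "'a set" assume "A \<in> sets borel"
      then have "(A \<inter> C n \<inter> a) \<times> B \<in> sets (borel \<Otimes>\<^sub>M borel)" using a B(1) by (auto simp: C_def)
      from evoid[OF this] show "{\<omega> \<in> space M. U \<omega> \<inter> A = {}} \<in> sets M"
      proof (rule back_subst[of "\<lambda>Z. Z \<in> sets M"])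
        have "(\<forall>x y. (x, y) \<in> (A \<inter> C n \<inter> a) \<times> B \<longrightarrow> {x, y} \<notin> edges (\<mu> \<omega>)) \<longleftrightarrow> U \<omega> \<inter> A = {}"
          if "\<omega> \<in> space M" for \<omega>
          using graphs_edgeD[OF gr[OF that]] by (fastforce simp: U_def neighbours_def)
        then show "{\<omega> \<in> space M. \<forall>x y. (x, y) \<in> (A \<inter> C n \<inter> a) \<times> B \<longrightarrow> {x, y} \<notin> edges (\<mu> \<omega>)}
            = {\<omega> \<in> space M. U \<omega> \<inter> A = {}}" by auto
      qed
    qed
    have "UNIV \<in> sets (borel :: 'a measure)" "C n \<inter> a \<in> sets borel"
      using a by (auto simp: C_def)
    note [measurable] = measurable_npoints[OF U this(1)] measurable_npoints[OF V this(2)]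
    have "(\<lambda>\<omega>. npoints (verts (\<mu> \<omega>) \<inter> (C n \<inter> a)) - npoints (U \<omega> \<inter> UNIV)) \<in> borel_measurable M"
      by measurable
    then show ?thesis
    proof (rule measurable_cong[THEN iffD1, rotated])
      fix \<omega> assume \<omega>: "\<omega> \<in> space M"
      have "finite (U \<omega>)" using fin[OF \<omega>, of n] by (rule rev_finite_subset) (auto simp: U_def)
      then have "npoints (verts (\<mu> \<omega>) \<inter> (C n \<inter> a)) - npoints (U \<omega>) = npoints (verts (\<mu> \<omega>) \<inter> (C n \<inter> a) - U \<omega>)"
        by (intro emeasure_Diff[symmetric]) (auto simp: U_def emeasure_count_space_finite)
      also have "verts (\<mu> \<omega>) \<inter> (C n \<inter> a) - U \<omega> = {x \<in> verts (\<mu> \<omega>) \<inter> C n. (x, neighbours (\<mu> \<omega>) x) \<in> a \<times> b}"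
        using locally_finite_neighbours[OF gr[OF \<omega>]] by (auto simp: U_def B)
      also have "npoints \<dots> = emeasure (N n \<omega>) (a \<times> b)"
        using a b sets_point_space_void by (intro N_ev[OF \<omega>, symmetric] pair_measureI) auto
      finally show "npoints (verts (\<mu> \<omega>) \<inter> (C n \<inter> a)) - npoints (U \<omega> \<inter> UNIV) = emeasure (N n \<omega>) (a \<times> b)"
        by simp
    qed
  qed
  fix A :: "('a \<times> 'a set) set" assume A: "A \<in> sets ?S"
  have "(\<lambda>\<omega>. emeasure (N n \<omega>) A) \<in> borel_measurable M" for n
  proof (rule finite_kernel_generated[OF Int_stable_borel_void])
    show "{a \<times> b |a b. a \<in> sets borel \<and> b \<in> void_events} \<subseteq> Pow (UNIV \<times> {V. locally_finite_set V})"
      using void_events_bounds(1) by auto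
    show "sets (N n \<omega>) = sigma_sets (UNIV \<times> {V. locally_finite_set V})
       {a \<times> b |a b. a \<in> sets borel \<and> b \<in> void_events}" for \<omega>
      by (simp add: N_def sets_borel_point_space)
    show "emeasure (N n \<omega>) (UNIV \<times> {V. locally_finite_set V}) \<noteq> \<infinity>" if "\<omega> \<in> space M" for \<omega>
    proof -
      have "UNIV \<times> {V. locally_finite_set V} \<in> sets ?S"
        using sets.top[of ?S] by (simp add: space_pair_measure space_point_space)
      moreover have "finite {x \<in> verts (\<mu> \<omega>) \<inter> C n. (x, neighbours (\<mu> \<omega>) x) \<in> UNIV \<times> {V. locally_finite_set V}}"
        using fin[OF that, of n] by (rule rev_finite_subset) auto
      ultimately show ?thesis
        by (subst N_ev[OF that]) (simp_all only: emeasure_count_space_finite subset_UNIV, simp)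
    qed
    show "(\<lambda>\<omega>. emeasure (N n \<omega>) (UNIV \<times> {V. locally_finite_set V})) \<in> borel_measurable M"
      using void_events_bounds(2) by (intro NE) auto
    show "(\<lambda>\<omega>. emeasure (N n \<omega>) A) \<in> borel_measurable M"
      if "A \<in> {a \<times> b |a b. a \<in> sets borel \<and> b \<in> void_events}" for A
      using that NE by auto
    show "A \<in> sigma_sets (UNIV \<times> {V. locally_finite_set V}) {a \<times> b |a b. a \<in> sets borel \<and> b \<in> void_events}"
      using A by (simp add: sets_borel_point_space)
  qed
  then have "(\<lambda>\<omega>. SUP n. emeasure (N n \<omega>) A) \<in> borel_measurable M" by measurable
  then show "(\<lambda>\<omega>. graph_eval (\<mu> \<omega>) A) \<in> borel_measurable M"
  proof (rule measurable_cong[THEN iffD1, rotated])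
    fix \<omega> assume \<omega>: "\<omega> \<in> space M"
    have "(SUP n. emeasure (N n \<omega>) A) = (SUP n. npoints {x \<in> verts (\<mu> \<omega>) \<inter> C n. (x, neighbours (\<mu> \<omega>) x) \<in> A})"
      using N_ev[OF \<omega> A] by simp
    also have "\<dots> = npoints (\<Union>n. {x \<in> verts (\<mu> \<omega>) \<inter> C n. (x, neighbours (\<mu> \<omega>) x) \<in> A})"
      by (intro SUP_emeasure_incseq) (auto simp: incseq_def C_def)
    also have "(\<Union>n. {x \<in> verts (\<mu> \<omega>) \<inter> C n. (x, neighbours (\<mu> \<omega>) x) \<in> A})
        = {x \<in> verts (\<mu> \<omega>). (x, neighbours (\<mu> \<omega>) x) \<in> A}"
      using real_arch_simple by (auto simp: C_def)
    finally show "(SUP n. emeasure (N n \<omega>) A) = graph_eval (\<mu> \<omega>) A" by (simp add: graph_eval_def)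
  qed
qed


section \<open>Measurability of components and vertex deletion\<close>

text \<open>Both the component of \<open>v\<close> and the graph without a vertex are subgraphs of this form.\<close>

definition induced_subgraph :: "('a \<Rightarrow> bool) \<Rightarrow> 'a graph \<Rightarrow> 'a graph" where
  "induced_subgraph Q \<mu> = Graph {x \<in> verts \<mu>. Q x} {e \<in> edges \<mu>. \<forall>x\<in>e. Q x}"

lemma induced_subgraph_graphs: "\<mu> \<in> graphs \<Longrightarrow> induced_subgraph Q \<mu> \<in> graphs"
  using locally_finite_set_subset[of "verts \<mu>" "{x \<in> verts \<mu>. Q x}"]
  by (auto simp: graphs_def induced_subgraph_def vertex_pairs_def)

text \<open>An induced subgraph has no edge in \<open>D\<close> if no two vertices satisfying \<open>Q\<close> are joined by an edge in
  \<open>D\<close>, which quantifies over vertices of the original graph only.\<close>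

lemma measurable_induced_subgraph:
  fixes \<mu> :: "'w \<Rightarrow> 'a::polish_space graph"
  assumes \<mu>: "\<mu> \<in> measurable M graph_space"
    and Q: "Measurable.pred (M \<Otimes>\<^sub>M borel) (\<lambda>(\<omega>, x). Q \<omega> x)"
  shows "(\<lambda>\<omega>. induced_subgraph (Q \<omega>) (\<mu> \<omega>)) \<in> measurable M graph_space"
proof (rule graph_space_measurable_voidI)
  note V = measurable_verts[OF \<mu>]
  show "induced_subgraph (Q \<omega>) (\<mu> \<omega>) \<in> graphs" if "\<omega> \<in> space M" for \<omega>
    using measurable_graphs[OF \<mu> that] by (rule induced_subgraph_graphs)
  show "{\<omega> \<in> space M. verts (induced_subgraph (Q \<omega>) (\<mu> \<omega>)) \<inter> B = {}} \<in> sets M" if "B \<in> sets borel" for B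
    using measurable_void[OF measurable_filter_point[OF V Q] that] by (simp add: induced_subgraph_def)
  fix D :: "('a \<times> 'a) set" assume D [measurable]: "D \<in> sets (borel \<Otimes>\<^sub>M borel)"
  have V1: "(\<lambda>p. verts (\<mu> (fst p))) \<in> measurable (M \<Otimes>\<^sub>M borel) point_space"
    using measurable_compose[OF measurable_fst V] .
  have m1: "(\<lambda>p :: ('w \<times> 'a) \<times> 'a. \<mu> (fst (fst p))) \<in> measurable ((M \<Otimes>\<^sub>M borel) \<Otimes>\<^sub>M borel) graph_space"
    using \<mu> by measurable
  have [measurable]: "Measurable.pred ((M \<Otimes>\<^sub>M borel) \<Otimes>\<^sub>M borel) (\<lambda>p. {snd (fst p), snd p} \<in> edges (\<mu> (fst (fst p))))"
    by (rule pred_edge[OF m1]) measurable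
  have [measurable]: "Measurable.pred ((M \<Otimes>\<^sub>M borel) \<Otimes>\<^sub>M borel) (\<lambda>p. Q (fst (fst p)) (snd p))"
    "Measurable.pred ((M \<Otimes>\<^sub>M borel) \<Otimes>\<^sub>M borel) (\<lambda>p. Q (fst (fst p)) (snd (fst p)))"
    using measurable_compose[OF _ Q, of "\<lambda>p. (fst (fst p), snd p)" "(M \<Otimes>\<^sub>M borel) \<Otimes>\<^sub>M borel"]
      measurable_compose[OF measurable_fst Q, of borel]
    by (simp_all add: case_prod_beta)
  have "Measurable.pred ((M \<Otimes>\<^sub>M borel) \<Otimes>\<^sub>M borel) (\<lambda>(p, y). (snd p, y) \<in> D \<and>
      {snd p, y} \<in> edges (\<mu> (fst p)) \<and> Q (fst p) (snd p) \<and> Q (fst p) y)"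
    unfolding case_prod_beta by measurable
  from pred_ex_point[OF V1 this]
  have "Measurable.pred (M \<Otimes>\<^sub>M borel) (\<lambda>(\<omega>, x). \<exists>y\<in>verts (\<mu> \<omega>). (x, y) \<in> D \<and>
      {x, y} \<in> edges (\<mu> \<omega>) \<and> Q \<omega> x \<and> Q \<omega> y)"
    by (simp add: case_prod_beta)
  from pred_ex_point[OF V this]
  have "Measurable.pred M (\<lambda>\<omega>. \<not> (\<exists>x\<in>verts (\<mu> \<omega>). \<exists>y\<in>verts (\<mu> \<omega>). (x, y) \<in> D \<and>
      {x, y} \<in> edges (\<mu> \<omega>) \<and> Q \<omega> x \<and> Q \<omega> y))" by measurable
  then have "Measurable.pred M (\<lambda>\<omega>. \<forall>x y. (x, y) \<in> D \<longrightarrow> {x, y} \<notin> edges (induced_subgraph (Q \<omega>) (\<mu> \<omega>)))"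
    by (rule measurable_cong[THEN iffD1, rotated])
       (use graphs_edgeD[OF measurable_graphs[OF \<mu>]] in \<open>auto simp: induced_subgraph_def\<close>)
  then show "{\<omega> \<in> space M. \<forall>x y. (x, y) \<in> D \<longrightarrow> {x, y} \<notin> edges (induced_subgraph (Q \<omega>) (\<mu> \<omega>))} \<in> sets M"
    by (simp add: pred_def)
qed

lemma delete_vertex_eq_induced: "delete_vertex x \<mu> = induced_subgraph (\<lambda>y. y \<noteq> x) \<mu>"
  by (auto simp: delete_vertex_def induced_subgraph_def)

lemma measurable_delete_vertex:
  fixes \<mu> :: "'w \<Rightarrow> 'a::polish_space graph"
  assumes \<mu>: "\<mu> \<in> measurable M graph_space" and x [measurable]: "x \<in> measurable M borel"
  shows "(\<lambda>\<omega>. delete_vertex (x \<omega>) (\<mu> \<omega>)) \<in> measurable M graph_space"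
  unfolding delete_vertex_eq_induced by (rule measurable_induced_subgraph[OF \<mu>]) measurable

definition adjacency :: "'a graph \<Rightarrow> ('a \<times> 'a) set" where
  "adjacency \<mu> = {(x, y). {x, y} \<in> edges \<mu>}"

lemma mem_adjacency [simp]: "(x, y) \<in> adjacency \<mu> \<longleftrightarrow> {x, y} \<in> edges \<mu>"
  by (simp add: adjacency_def)

lemma component_verts_adjacency:
  "component_verts v \<mu> = {w \<in> verts \<mu>. v \<in> verts \<mu> \<and> (v, w) \<in> (adjacency \<mu>)\<^sup>*}"
  by (simp add: component_verts_def adjacency_def)

lemma adjacency_mono: "edges \<mu> \<subseteq> edges \<nu> \<Longrightarrow> adjacency \<mu> \<subseteq> adjacency \<nu>"
  by (auto simp: adjacency_def)

text \<open>By induction on the length of the path; its last vertex but one ranges over the vertices of the graph.\<close>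

lemma pred_adjacency_power:
  fixes v :: "'a::polish_space"
  shows "Measurable.pred (graph_space \<Otimes>\<^sub>M borel) (\<lambda>(\<mu>, x). (v, x) \<in> adjacency \<mu> ^^ k)"
proof (induction k)
  case 0
  have "Measurable.pred (graph_space \<Otimes>\<^sub>M borel) (\<lambda>p :: 'a graph \<times> 'a. v = snd p)" by measurable
  then show ?case by (simp add: case_prod_beta eq_commute)
next
  case (Suc k)
  have V: "(\<lambda>p :: 'a graph \<times> 'a. verts (fst p)) \<in> measurable (graph_space \<Otimes>\<^sub>M borel) point_space"
    by (rule measurable_verts) measurable
  have [measurable]: "Measurable.pred ((graph_space \<Otimes>\<^sub>M borel) \<Otimes>\<^sub>M borel)
      (\<lambda>p :: ('a graph \<times> 'a) \<times> 'a. {snd p, snd (fst p)} \<in> edges (fst (fst p)))"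
    by (rule pred_edge) measurable
  have [measurable]: "Measurable.pred ((graph_space \<Otimes>\<^sub>M borel) \<Otimes>\<^sub>M borel)
      (\<lambda>p :: ('a graph \<times> 'a) \<times> 'a. (v, snd p) \<in> adjacency (fst (fst p)) ^^ k)"
    using measurable_compose[OF _ Suc, of "\<lambda>p. (fst (fst p), snd p)" "(graph_space \<Otimes>\<^sub>M borel) \<Otimes>\<^sub>M borel"]
    by simp
  have "Measurable.pred ((graph_space \<Otimes>\<^sub>M borel) \<Otimes>\<^sub>M borel)
      (\<lambda>(p :: 'a graph \<times> 'a, y). (v, y) \<in> adjacency (fst p) ^^ k \<and> {y, snd p} \<in> edges (fst p))"
    unfolding case_prod_beta by measurable
  from pred_ex_point[OF V this] show ?case
  proof (rule measurable_cong[THEN iffD1, rotated])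
    fix p :: "'a graph \<times> 'a" assume "p \<in> space (graph_space \<Otimes>\<^sub>M borel)"
    then have "fst p \<in> graphs" by (auto simp: space_pair_measure space_graph_space)
    from graphs_edgeD[OF this] show
      "(\<exists>y\<in>verts (fst p). (v, y) \<in> adjacency (fst p) ^^ k \<and> {y, snd p} \<in> edges (fst p)) =
       (case p of (\<mu>, x) \<Rightarrow> (v, x) \<in> adjacency \<mu> ^^ Suc k)"
      by (auto simp: case_prod_beta)
  qed
qed

lemma pred_component_verts:
  fixes \<mu> :: "'w \<Rightarrow> 'a::polish_space graph"
  assumes \<mu> [measurable]: "\<mu> \<in> measurable M graph_space" and x [measurable]: "x \<in> measurable M borel"
  shows "Measurable.pred M (\<lambda>\<omega>. x \<omega> \<in> component_verts v (\<mu> \<omega>))"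
proof -
  have [measurable]: "Measurable.pred M (\<lambda>\<omega>. x \<omega> \<in> verts (\<mu> \<omega>))" "Measurable.pred M (\<lambda>\<omega>. v \<in> verts (\<mu> \<omega>))"
    by (rule pred_mem_point[OF measurable_verts[OF \<mu>]]; measurable)+
  have [measurable]: "Measurable.pred M (\<lambda>\<omega>. (v, x \<omega>) \<in> adjacency (\<mu> \<omega>) ^^ k)" for k
    using measurable_compose[OF _ pred_adjacency_power, of "\<lambda>\<omega>. (\<mu> \<omega>, x \<omega>)" M] by simp
  have "Measurable.pred M (\<lambda>\<omega>. x \<omega> \<in> verts (\<mu> \<omega>) \<and> v \<in> verts (\<mu> \<omega>) \<and> (\<exists>k. (v, x \<omega>) \<in> adjacency (\<mu> \<omega>) ^^ k))"
    by measurable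
  then show ?thesis by (simp add: component_verts_adjacency rtrancl_power)
qed

lemma component_eq_induced:
  "\<mu> \<in> graphs \<Longrightarrow> component v \<mu> = induced_subgraph (\<lambda>x. x \<in> component_verts v \<mu>) \<mu>"
  by (auto simp: component_def induced_subgraph_def component_verts_def)

lemma measurable_component [measurable]:
  fixes v :: "'a::polish_space"
  shows "component v \<in> measurable graph_space graph_space"
proof -
  have "(\<lambda>\<mu>. induced_subgraph (\<lambda>x. x \<in> component_verts v \<mu>) \<mu>) \<in> measurable graph_space graph_space"
  proof (rule measurable_induced_subgraph[where \<mu>="\<lambda>\<mu>. \<mu>"])
    show "Measurable.pred (graph_space \<Otimes>\<^sub>M borel) (\<lambda>(\<mu>, x :: 'a). x \<in> component_verts v \<mu>)"
      unfolding case_prod_beta by (rule pred_component_verts) measurable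
  qed simp
  then show ?thesis
    by (rule measurable_cong[THEN iffD1, rotated]) (simp add: component_eq_induced space_graph_space)
qed

lemma verts_component [simp]: "verts (component v \<mu>) = component_verts v \<mu>"
  by (simp add: component_def)

lemma component_verts_subset: "component_verts v \<mu> \<subseteq> verts \<mu>"
  by (auto simp: component_verts_def)

lemma mem_component_verts_self: "v \<in> verts \<mu> \<Longrightarrow> v \<in> component_verts v \<mu>"
  by (simp add: component_verts_def)

lemma measurable_gsize [measurable]: "gsize \<in> borel_measurable graph_space"
  using measurable_npoints[OF measurable_verts[OF measurable_ident], of UNIV] by (simp add: gsize_def[abs_def])

text \<open>A vertex joins the component of \<open>v\<close> through a vertex that is connected to \<open>v\<close> without it.\<close>

lemma mem_component_verts_iff_delete_vertex:
  assumes \<mu>: "\<mu> \<in> graphs" and v: "v \<in> verts \<mu>" and x: "x \<in> verts \<mu>" "x \<noteq> v"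
  shows "x \<in> component_verts v \<mu> \<longleftrightarrow> (\<exists>y\<in>component_verts v (delete_vertex x \<mu>). {x, y} \<in> edges \<mu>)"
proof
  let ?C = "component_verts v (delete_vertex x \<mu>)"
  assume "x \<in> component_verts v \<mu>"
  then have "(v, x) \<in> (adjacency \<mu>)\<^sup>*" by (simp add: component_verts_adjacency)
  moreover have "w \<in> ?C \<or> (\<exists>y\<in>?C. {x, y} \<in> edges \<mu>)" if "(v, w) \<in> (adjacency \<mu>)\<^sup>*" for w
    using that
  proof (induction rule: rtrancl_induct)
    case base
    show ?case using v x by (auto simp: component_verts_def delete_vertex_def)
  next
    case (step w z)
    have w: "{w, z} \<in> edges \<mu>" using step(2) by simp
    show ?case
    proof (cases "\<exists>y\<in>?C. {x, y} \<in> edges \<mu>")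
      case False
      then have wC: "w \<in> ?C" using step(3) by blast
      have "w \<noteq> x" using wC by (auto simp: component_verts_def delete_vertex_def)
      have "z \<noteq> x" using w wC False by (auto simp: insert_commute)
      with \<open>w \<noteq> x\<close> have "(w, z) \<in> adjacency (delete_vertex x \<mu>)" "z \<in> verts (delete_vertex x \<mu>)"
        using w graphs_edgeD[OF \<mu> w] by (auto simp: delete_vertex_def)
      then have "z \<in> ?C"
        using wC unfolding component_verts_adjacency by (auto intro: rtrancl_into_rtrancl)
      then show ?thesis ..
    qed auto
  qed
  moreover have "x \<notin> ?C" by (auto simp: component_verts_def delete_vertex_def)
  ultimately show "\<exists>y\<in>?C. {x, y} \<in> edges \<mu>" by blast
next
  assume "\<exists>y\<in>component_verts v (delete_vertex x \<mu>). {x, y} \<in> edges \<mu>"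
  then obtain y where y: "y \<in> component_verts v (delete_vertex x \<mu>)" "{x, y} \<in> edges \<mu>" by auto
  have "adjacency (delete_vertex x \<mu>) \<subseteq> adjacency \<mu>" by (auto simp: delete_vertex_def)
  then have "(v, y) \<in> (adjacency \<mu>)\<^sup>*"
    using y(1) rtrancl_mono unfolding component_verts_adjacency by blast
  moreover have "(y, x) \<in> adjacency \<mu>" using y(2) by (simp add: insert_commute)
  ultimately have "(v, x) \<in> (adjacency \<mu>)\<^sup>*" by (rule rtrancl_into_rtrancl)
  then show "x \<in> component_verts v \<mu>" using x v by (simp add: component_verts_adjacency)
qed

section \<open>Generation of the space of graphs by void events\<close>

definition graph_void_events :: "'a::metric_space graph set set" where
  "graph_void_events = {{\<mu> \<in> graphs. verts \<mu> \<inter> B = {} \<and> (\<forall>x y. (x, y) \<in> D \<longrightarrow> {x, y} \<notin> edges \<mu>)} |B D.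
      B \<in> sets borel \<and> D \<in> sets (borel \<Otimes>\<^sub>M borel)}"

lemma sets_graph_space_void:
  "sets (graph_space :: 'a::polish_space graph measure) =
    sigma_sets graphs graph_void_events"
  (is "_ = sigma_sets graphs ?E")
proof
  have sub: "?E \<subseteq> Pow graphs" by (auto simp: graph_void_events_def)
  have "(\<lambda>\<mu>. \<mu>) \<in> measurable (sigma graphs ?E) graph_space"
  proof (rule graph_space_measurable_voidI)
    show "\<omega> \<in> graphs" if "\<omega> \<in> space (sigma graphs ?E)" for \<omega>
      using that sub by (simp add: space_measure_of)
    fix B :: "'a set" assume "B \<in> sets borel"
    then have "{\<mu> \<in> graphs. verts \<mu> \<inter> B = {} \<and> (\<forall>x y. (x, y) \<in> {} \<longrightarrow> {x, y} \<notin> edges \<mu>)} \<in> ?E"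
      unfolding graph_void_events_def by blast
    then show "{\<omega> \<in> space (sigma graphs ?E). verts \<omega> \<inter> B = {}} \<in> sets (sigma graphs ?E)"
      using sub by (simp add: space_measure_of sets_measure_of sigma_sets.Basic)
  next
    fix D :: "('a \<times> 'a) set" assume "D \<in> sets (borel \<Otimes>\<^sub>M borel)"
    then have "{\<mu> \<in> graphs. verts \<mu> \<inter> {} = {} \<and> (\<forall>x y. (x, y) \<in> D \<longrightarrow> {x, y} \<notin> edges \<mu>)} \<in> ?E"
      unfolding graph_void_events_def by blast
    then show "{\<omega> \<in> space (sigma graphs ?E). \<forall>x y. (x, y) \<in> D \<longrightarrow> {x, y} \<notin> edges \<omega>} \<in> sets (sigma graphs ?E)"
      using sub by (simp add: space_measure_of sets_measure_of sigma_sets.Basic)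
  qed
  note id = this
  show "sets graph_space \<subseteq> sigma_sets graphs ?E"
  proof
    fix A :: "'a graph set" assume A: "A \<in> sets graph_space"
    have "A \<subseteq> graphs" using sets.sets_into_space[OF A] by (simp add: space_graph_space)
    then have "(\<lambda>V. V) -` A \<inter> space (sigma graphs ?E) = A"
      using sub by (simp add: space_measure_of Int_absorb2)
    then show "A \<in> sigma_sets graphs ?E"
      using measurable_sets[OF id A] sub by (simp add: sets_measure_of)
  qed
  have "{\<mu> \<in> graphs. verts \<mu> \<inter> B = {} \<and> (\<forall>x y. (x, y) \<in> D \<longrightarrow> {x, y} \<notin> edges \<mu>)} \<in> sets graph_space"
    if B: "B \<in> sets borel" and D [measurable]: "D \<in> sets (borel \<Otimes>\<^sub>M borel)" for B :: "'a set" and D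
  proof -
    have V: "verts \<in> measurable graph_space (point_space :: 'a set measure)"
      using measurable_verts[OF measurable_ident] by simp
    have V1: "(\<lambda>p. verts (fst p)) \<in> measurable (graph_space \<Otimes>\<^sub>M borel) (point_space :: 'a set measure)"
      using measurable_compose[OF measurable_fst V] .
    have [measurable]: "Measurable.pred graph_space (\<lambda>\<mu>. verts \<mu> \<inter> B = {})" by (rule pred_void[OF V B])
    have [measurable]: "Measurable.pred ((graph_space \<Otimes>\<^sub>M borel) \<Otimes>\<^sub>M borel)
       (\<lambda>p :: ('a graph \<times> 'a) \<times> 'a. {snd (fst p), snd p} \<in> edges (fst (fst p)))"
      by (rule pred_edge) measurable
    have "Measurable.pred ((graph_space \<Otimes>\<^sub>M borel) \<Otimes>\<^sub>M borel)
       (\<lambda>(p, y). (snd p, y) \<in> D \<and> {snd p, y} \<in> edges (fst p))"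
      unfolding case_prod_beta by measurable
    from pred_ex_point[OF V1 this]
    have "Measurable.pred (graph_space \<Otimes>\<^sub>M borel)
       (\<lambda>(\<mu>, x). \<exists>y\<in>verts \<mu>. (x, y) \<in> D \<and> {x, y} \<in> edges \<mu>)"
      by (simp add: case_prod_beta)
    note [measurable] = pred_ex_point[OF V this]
    have "{\<mu> \<in> space graph_space. verts \<mu> \<inter> B = {} \<and>
       \<not> (\<exists>x\<in>verts \<mu>. \<exists>y\<in>verts \<mu>. (x, y) \<in> D \<and> {x, y} \<in> edges \<mu>)} \<in> sets graph_space"
      by measurable
    also have "{\<mu> \<in> space graph_space. verts \<mu> \<inter> B = {} \<and>
        \<not> (\<exists>x\<in>verts \<mu>. \<exists>y\<in>verts \<mu>. (x, y) \<in> D \<and> {x, y} \<in> edges \<mu>)}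
      = {\<mu> \<in> graphs. verts \<mu> \<inter> B = {} \<and> (\<forall>x y. (x, y) \<in> D \<longrightarrow> {x, y} \<notin> edges \<mu>)}"
    proof (intro Collect_cong conj_cong refl)
      show "\<mu> \<in> space graph_space \<longleftrightarrow> \<mu> \<in> graphs" for \<mu> :: "'a graph" by (simp add: space_graph_space)
      fix \<mu> :: "'a graph" assume "\<mu> \<in> graphs"
      from graphs_edgeD[OF this]
      show "\<not> (\<exists>x\<in>verts \<mu>. \<exists>y\<in>verts \<mu>. (x, y) \<in> D \<and> {x, y} \<in> edges \<mu>) \<longleftrightarrow>
        (\<forall>x y. (x, y) \<in> D \<longrightarrow> {x, y} \<notin> edges \<mu>)" by blast
    qed
    finally show ?thesis .
  qed
  then have "sigma_sets (space graph_space) ?E \<subseteq> sets graph_space"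
    unfolding graph_void_events_def by (intro sets.sigma_sets_subset) blast
  then show "sigma_sets graphs ?E \<subseteq> sets graph_space" by (simp add: space_graph_space)
qed

lemma Int_stable_graph_void: "Int_stable (graph_void_events :: 'a::metric_space graph set set)"
proof (rule Int_stableI)
  fix a b :: "'a graph set" assume "a \<in> graph_void_events" "b \<in> graph_void_events"
  then obtain B D B' D' where *: "B \<in> sets borel" "D \<in> sets (borel \<Otimes>\<^sub>M borel)"
    "B' \<in> sets borel" "D' \<in> sets (borel \<Otimes>\<^sub>M borel)"
    "a = {\<mu> \<in> graphs. verts \<mu> \<inter> B = {} \<and> (\<forall>x y. (x, y) \<in> D \<longrightarrow> {x, y} \<notin> edges \<mu>)}"
    "b = {\<mu> \<in> graphs. verts \<mu> \<inter> B' = {} \<and> (\<forall>x y. (x, y) \<in> D' \<longrightarrow> {x, y} \<notin> edges \<mu>)}"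
    unfolding graph_void_events_def by blast
  then have "a \<inter> b = {\<mu> \<in> graphs. verts \<mu> \<inter> (B \<union> B') = {} \<and> (\<forall>x y. (x, y) \<in> D \<union> D' \<longrightarrow> {x, y} \<notin> edges \<mu>)}"
    by auto
  then show "a \<inter> b \<in> graph_void_events"
    unfolding graph_void_events_def using * by blast
qed


section \<open>Products as exponentials of sums\<close>

text \<open>The function \<open>exp (- a)\<close> on \<open>[0, \<infinity>]\<close>. Products over infinite sets of factors in \<open>[0,1]\<close> are written as
  \<open>expneg\<close> of a sum in \<open>[0, \<infinity>]\<close>, since sums over points are measurable and converge
  monotonically.\<close>

definition expneg :: "ennreal \<Rightarrow> real" where
  "expneg a = (if a = \<infinity> then 0 else exp (- enn2real a))"

lemma expneg_0 [simp]: "expneg 0 = 1"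
  and expneg_top [simp]: "expneg \<infinity> = 0" "expneg top = 0"
  and expneg_nonneg [simp]: "0 \<le> expneg a"
  and expneg_le_1 [simp]: "expneg a \<le> 1"
  by (simp_all add: expneg_def)

lemma expneg_ennreal: "0 \<le> r \<Longrightarrow> expneg (ennreal r) = exp (- r)"
  by (simp add: expneg_def)

lemma expneg_add: "expneg (a + b) = expneg a * expneg b"
  by (auto simp: expneg_def enn2real_plus exp_add[symmetric] less_top ennreal_add_eq_top)

lemma expneg_antimono: "a \<le> b \<Longrightarrow> expneg b \<le> expneg a"
  by (auto simp: expneg_def enn2real_mono less_top top_unique)

lemma expneg_sum: "finite A \<Longrightarrow> expneg (\<Sum>i\<in>A. f i) = (\<Prod>i\<in>A. expneg (f i))"
  by (induction A rule: finite_induct) (simp_all add: expneg_add)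

lemma measurable_expneg [measurable]: "expneg \<in> borel_measurable borel"
  unfolding expneg_def[abs_def] by measurable

lemma tendsto_expneg:
  fixes X :: "nat \<Rightarrow> ennreal"
  assumes X: "X \<longlonglongrightarrow> a"
  shows "(\<lambda>n. expneg (X n)) \<longlonglongrightarrow> expneg a"
proof (cases "a = \<infinity>")
  case False
  then have "a < top" by (simp add: less_top)
  then have ev: "\<forall>\<^sub>F n in sequentially. X n < top" using X by (rule order_tendstoD(2)[rotated])
  have "(\<lambda>n. exp (- enn2real (X n))) \<longlonglongrightarrow> exp (- enn2real a)"
    using X \<open>a < top\<close> by (intro tendsto_intros tendsto_enn2real) (auto simp: less_top)
  moreover have "\<forall>\<^sub>F n in sequentially. exp (- enn2real (X n)) = expneg (X n)"
    using ev by eventually_elim (auto simp: expneg_def)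
  ultimately have "(\<lambda>n. expneg (X n)) \<longlonglongrightarrow> exp (- enn2real a)"
    by (rule Lim_transform_eventually)
  then show ?thesis using False by (simp add: expneg_def)
next
  case True
  have "(\<lambda>n. expneg (X n)) \<longlonglongrightarrow> 0"
  proof (rule LIMSEQ_I)
    fix r :: real assume "0 < r"
    define R where "R = max 0 (1 - ln r)"
    have "ennreal R < a" using True by simp
    then have "\<forall>\<^sub>F n in sequentially. ennreal R < X n" using X by (rule order_tendstoD(1)[rotated])
    then obtain N where N: "\<And>n. n \<ge> N \<Longrightarrow> ennreal R < X n" by (auto simp: eventually_sequentially)
    have "exp (- R) < r"
    proof -
      have "- R < ln r" by (auto simp: R_def)
      then have "exp (- R) < exp (ln r)" by simp
      then show ?thesis using \<open>0 < r\<close> by simp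
    qed
    moreover have "expneg (ennreal R) = exp (- R)" by (rule expneg_ennreal) (simp add: R_def)
    then have "expneg (X n) \<le> exp (- R)" if "n \<ge> N" for n
      using expneg_antimono[of "ennreal R" "X n"] N[OF that] by simp
    ultimately show "\<exists>no. \<forall>n\<ge>no. norm (expneg (X n) - 0) < r"
      by (intro exI[of _ N]) (auto intro: le_less_trans)
  qed
  then show ?thesis using True by simp
qed

text \<open>The exponent that produces the factor \<open>1 - p\<close>.\<close>

definition neglog :: "real \<Rightarrow> ennreal" where
  "neglog p = (if p = 1 then \<infinity> else ennreal (- ln (1 - p)))"

lemma expneg_neglog: "0 \<le> p \<Longrightarrow> p \<le> 1 \<Longrightarrow> expneg (neglog p) = 1 - p"
  by (auto simp: neglog_def expneg_ennreal)

lemma measurable_neglog [measurable]: "neglog \<in> borel_measurable borel"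
  unfolding neglog_def[abs_def] by measurable

lemma unit_prod_le:
  assumes h: "\<And>e. e \<in> J \<Longrightarrow> 0 \<le> h e" and W: "finite W" "W \<subseteq> J"
  shows "unit_prod h J \<le> (\<Prod>e\<in>W. h e)"
  unfolding unit_prod_def
proof (rule cINF_lower)
  show "bdd_below (prod h ` {W. finite W \<and> W \<subseteq> J})"
    by (rule bdd_belowI[of _ 0]) (auto intro!: prod_nonneg h)
qed (use W in auto)

lemma unit_prod_greatest:
  assumes "\<And>W. finite W \<Longrightarrow> W \<subseteq> J \<Longrightarrow> c \<le> (\<Prod>e\<in>W. h e)"
  shows "c \<le> unit_prod h J"
  unfolding unit_prod_def by (rule cINF_greatest) (use assms in auto)

text \<open>The finite subproducts decrease along any enumeration, and every finite subset is eventually covered.\<close>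

lemma prod_tendsto_unit_prod:
  fixes g :: "nat \<Rightarrow> 'e"
  assumes h: "\<And>e. e \<in> J \<Longrightarrow> 0 \<le> h e \<and> h e \<le> 1" and g: "bij_betw g UNIV J"
  shows "(\<lambda>n. \<Prod>i<n. h (g i)) \<longlonglongrightarrow> unit_prod h J"
proof -
  have gJ: "g i \<in> J" for i using g by (auto simp: bij_betw_def)
  have inj: "inj_on g A" for A using g by (auto simp: bij_betw_def inj_on_def)
  have img: "(\<Prod>i<n. h (g i)) = (\<Prod>e\<in>g ` {..<n}. h e)" for n
    by (subst prod.reindex[OF inj]) simp
  have low: "unit_prod h J \<le> (\<Prod>i<n. h (g i))" for n
    unfolding img using h gJ by (intro unit_prod_le) auto
  have "decseq (\<lambda>n. \<Prod>i<n. h (g i))"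
    using h gJ by (intro decseq_SucI) (auto intro!: mult_right_le_one_le prod_nonneg)
  then obtain L where L: "(\<lambda>n. \<Prod>i<n. h (g i)) \<longlonglongrightarrow> L" "\<And>n. L \<le> (\<Prod>i<n. h (g i))"
    using decseq_convergent[of "\<lambda>n. \<Prod>i<n. h (g i)" "unit_prod h J"] low by blast
  have "unit_prod h J \<le> L" using L(1) low by (intro LIMSEQ_le_const) auto
  moreover have "L \<le> unit_prod h J"
  proof (rule unit_prod_greatest)
    fix W assume W: "finite W" "W \<subseteq> J"
    have "finite (g -` W)" using W inj by (intro finite_vimageI) auto
    then obtain n where n: "g -` W \<subseteq> {..<n}" using finite_nat_iff_bounded by blast
    have sub: "W \<subseteq> g ` {..<n}"
    proof
      fix w assume "w \<in> W"
      then obtain i where "w = g i" using W g by (auto simp: bij_betw_def)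
      then show "w \<in> g ` {..<n}" using n \<open>w \<in> W\<close> by auto
    qed
    have "L \<le> (\<Prod>e\<in>g ` {..<n}. h e)" using L(2)[of n] by (simp add: img)
    also have "\<dots> \<le> (\<Prod>e\<in>W. h e)"
    proof (subst prod.subset_diff[OF sub])
      show "finite (g ` {..<n})" by simp
      show "prod h (g ` {..<n} - W) * prod h W \<le> prod h W"
        using h gJ W by (intro mult_left_le_one_le prod_nonneg prod_le_1) auto
    qed
    finally show "L \<le> (\<Prod>e\<in>W. h e)" .
  qed
  ultimately show ?thesis using L(1) by simp
qed

lemma unit_prod_reindex:
  assumes "inj_on f C"
  shows "unit_prod h (f ` C) = unit_prod (\<lambda>x. h (f x)) C"
proof -
  have "prod h ` {W. finite W \<and> W \<subseteq> f ` C} = prod (\<lambda>x. h (f x)) ` {W. finite W \<and> W \<subseteq> C}"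
  proof (intro set_eqI iffI)
    fix p assume "p \<in> prod h ` {W. finite W \<and> W \<subseteq> f ` C}"
    then obtain W where W: "finite W" "W \<subseteq> f ` C" "p = prod h W" by blast
    then obtain U where U: "U \<subseteq> C" "finite U" "W = f ` U" using finite_subset_image by metis
    then have "p = prod (\<lambda>x. h (f x)) U"
      using W assms by (simp add: prod.reindex inj_on_subset)
    then show "p \<in> prod (\<lambda>x. h (f x)) ` {W. finite W \<and> W \<subseteq> C}" using U by blast
  next
    fix p assume "p \<in> prod (\<lambda>x. h (f x)) ` {W. finite W \<and> W \<subseteq> C}"
    then obtain U where U: "finite U" "U \<subseteq> C" "p = prod (\<lambda>x. h (f x)) U" by blast
    then have "p = prod h (f ` U)"
      using assms by (simp add: prod.reindex inj_on_subset)
    then show "p \<in> prod h ` {W. finite W \<and> W \<subseteq> f ` C}" using U by blast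
  qed
  then show ?thesis by (simp add: unit_prod_def)
qed

lemma unit_prod_eq_expneg:
  assumes J: "countable J" and p: "\<And>e. e \<in> J \<Longrightarrow> 0 \<le> p e \<and> p e \<le> 1"
  shows "unit_prod (\<lambda>e. 1 - p e) J = expneg (\<integral>\<^sup>+e. neglog (p e) \<partial>count_space J)"
proof (cases "finite J")
  case True
  have "unit_prod (\<lambda>e. 1 - p e) J = (\<Prod>e\<in>J. 1 - p e)"
    using True p by (intro unit_prod_finite) auto
  also have "\<dots> = (\<Prod>e\<in>J. expneg (neglog (p e)))"
    using p by (intro prod.cong) (auto simp: expneg_neglog)
  finally show ?thesis
    using True by (simp add: expneg_sum nn_integral_count_space_finite)
next
  case False
  define g where "g = from_nat_into J"
  have g: "bij_betw g UNIV J" unfolding g_def using J False by (rule bij_betw_from_nat_into)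
  have gJ: "g i \<in> J" for i using g by (auto simp: bij_betw_def)
  have "(\<integral>\<^sup>+e. neglog (p e) \<partial>count_space J) = (\<Sum>i. neglog (p (g i)))"
    using nn_integral_bij_count_space[OF g] by (simp add: nn_integral_count_space_nat flip: nn_integral_bij_count_space[OF g])
  moreover have "(\<lambda>n. expneg (\<Sum>i<n. neglog (p (g i)))) \<longlonglongrightarrow> expneg (\<Sum>i. neglog (p (g i)))"
    by (intro tendsto_expneg summable_LIMSEQ) simp
  moreover have "expneg (\<Sum>i<n. neglog (p (g i))) = (\<Prod>i<n. 1 - p (g i))" for n
    using p gJ by (simp add: expneg_sum expneg_neglog)
  moreover have "(\<lambda>n. \<Prod>i<n. 1 - p (g i)) \<longlonglongrightarrow> unit_prod (\<lambda>e. 1 - p e) J"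
    using p by (intro prod_tendsto_unit_prod[OF _ g, of "\<lambda>e. 1 - p e"]) auto
  ultimately show ?thesis using LIMSEQ_unique by auto
qed

section \<open>Sums over pairs of vertices\<close>

lemma countable_vertex_pairs: "countable V \<Longrightarrow> countable (vertex_pairs V)"
  by (rule countable_subset[of _ "(\<lambda>(x, y). {x, y}) ` (V \<times> V)"])
     (auto simp: vertex_pairs_def card_2_iff)

lemma nn_integral_count_space_filter:
  "(\<integral>\<^sup>+x. of_bool (Q x) * g x \<partial>count_space S) = (\<integral>\<^sup>+x. g x \<partial>count_space {x \<in> S. Q x})"
proof -
  have "(\<integral>\<^sup>+x. of_bool (Q x) * g x \<partial>count_space S)
      = (\<integral>\<^sup>+x. of_bool (Q x) * g x * indicator S x \<partial>count_space UNIV)"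
    by (subst nn_integral_count_space_indicator) auto
  also have "\<dots> = (\<integral>\<^sup>+x. g x * indicator {x \<in> S. Q x} x \<partial>count_space UNIV)"
    by (intro nn_integral_cong) (auto split: split_indicator)
  also have "\<dots> = (\<integral>\<^sup>+x. g x \<partial>count_space {x \<in> S. Q x})"
    by (subst nn_integral_count_space_indicator) auto
  finally show ?thesis .
qed

lemma nn_integral_indicator_single:
  assumes "a \<in> V"
  shows "(\<integral>\<^sup>+x. of_bool (x = a) * c \<partial>count_space V) = (c :: ennreal)"
  using assms nn_integral_count_space'[of "{a}" V "\<lambda>x. of_bool (x = a) * c"] by auto

text \<open>The factor \<open>2\<close> appears because the double integral meets every pair in both orders.\<close>

lemma nn_integral_vertex_pairs:
  fixes h :: "'a set \<Rightarrow> ennreal"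
  assumes V: "countable V"
  shows "(\<integral>\<^sup>+x. \<integral>\<^sup>+y. of_bool (x \<noteq> y) * h {x, y} \<partial>count_space V \<partial>count_space V)
     = 2 * (\<integral>\<^sup>+e. h e \<partial>count_space (vertex_pairs V))"
proof -
  let ?P = "vertex_pairs V"
  have P: "countable ?P" using V by (rule countable_vertex_pairs)
  have 1: "of_bool (x \<noteq> y) * h {x, y} = (\<integral>\<^sup>+e. of_bool (x \<noteq> y \<and> e = {x, y}) * h e \<partial>count_space ?P)"
    if "x \<in> V" "y \<in> V" for x y
  proof (cases "x = y")
    case False
    then have "{x, y} \<in> ?P" using that by (auto simp: vertex_pairs_def)
    then have "(\<integral>\<^sup>+e. of_bool (e = {x, y}) * h {x, y} \<partial>count_space ?P) = h {x, y}"
      by (rule nn_integral_indicator_single)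
    moreover have "(\<integral>\<^sup>+e. of_bool (e = {x, y}) * h {x, y} \<partial>count_space ?P)
        = (\<integral>\<^sup>+e. of_bool (x \<noteq> y \<and> e = {x, y}) * h e \<partial>count_space ?P)"
      using False by (intro nn_integral_cong) auto
    ultimately show ?thesis using False by simp
  qed simp
  have 2: "(\<integral>\<^sup>+x. \<integral>\<^sup>+y. of_bool (x \<noteq> y \<and> e = {x, y}) * h e \<partial>count_space V \<partial>count_space V) = 2 * h e"
    if e: "e \<in> ?P" for e
  proof -
    obtain a b where ab: "e = {a, b}" "a \<noteq> b" "a \<in> V" "b \<in> V"
      using e by (auto simp: vertex_pairs_def card_2_iff)
    have "(\<integral>\<^sup>+y. of_bool (x \<noteq> y \<and> e = {x, y}) * h e \<partial>count_space V)
       = of_bool (x = a) * h e + of_bool (x = b) * h e" for x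
    proof -
      consider "x = a" | "x = b" | "x \<noteq> a" "x \<noteq> b" by blast
      then show ?thesis
      proof cases
        case 1
        then have "(\<integral>\<^sup>+y. of_bool (x \<noteq> y \<and> e = {x, y}) * h e \<partial>count_space V)
            = (\<integral>\<^sup>+y. of_bool (y = b) * h e \<partial>count_space V)"
          using ab by (intro nn_integral_cong) (auto simp: doubleton_eq_iff)
        then show ?thesis using 1 ab by (simp add: nn_integral_indicator_single)
      next
        case 2
        then have "(\<integral>\<^sup>+y. of_bool (x \<noteq> y \<and> e = {x, y}) * h e \<partial>count_space V)
            = (\<integral>\<^sup>+y. of_bool (y = a) * h e \<partial>count_space V)"
          using ab by (intro nn_integral_cong) (auto simp: doubleton_eq_iff)
        then show ?thesis using 2 ab by (simp add: nn_integral_indicator_single)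
      next
        case 3
        then have "(\<integral>\<^sup>+y. of_bool (x \<noteq> y \<and> e = {x, y}) * h e \<partial>count_space V)
            = (\<integral>\<^sup>+y. 0 \<partial>count_space V)"
          using ab by (intro nn_integral_cong) (auto simp: doubleton_eq_iff)
        then show ?thesis using 3 by simp
      qed
    qed
    then have "(\<integral>\<^sup>+x. \<integral>\<^sup>+y. of_bool (x \<noteq> y \<and> e = {x, y}) * h e \<partial>count_space V \<partial>count_space V)
       = (\<integral>\<^sup>+x. of_bool (x = a) * h e + of_bool (x = b) * h e \<partial>count_space V)" by simp
    also have "\<dots> = (\<integral>\<^sup>+x. of_bool (x = a) * h e \<partial>count_space V) + (\<integral>\<^sup>+x. of_bool (x = b) * h e \<partial>count_space V)"
      by (rule nn_integral_add) auto
    also have "\<dots> = 2 * h e"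
      using ab by (simp only: nn_integral_indicator_single mult_2)
    finally show ?thesis .
  qed
  have "(\<integral>\<^sup>+x. \<integral>\<^sup>+y. of_bool (x \<noteq> y) * h {x, y} \<partial>count_space V \<partial>count_space V)
     = (\<integral>\<^sup>+x. \<integral>\<^sup>+y. \<integral>\<^sup>+e. of_bool (x \<noteq> y \<and> e = {x, y}) * h e \<partial>count_space ?P \<partial>count_space V \<partial>count_space V)"
    using 1 by (auto intro!: nn_integral_cong)
  also have "\<dots> = (\<integral>\<^sup>+x. \<integral>\<^sup>+e. \<integral>\<^sup>+y. of_bool (x \<noteq> y \<and> e = {x, y}) * h e \<partial>count_space V \<partial>count_space ?P \<partial>count_space V)"
    by (intro nn_integral_cong nn_integral_count_space_nn_integral P) simp
  also have "\<dots> = (\<integral>\<^sup>+e. \<integral>\<^sup>+x. \<integral>\<^sup>+y. of_bool (x \<noteq> y \<and> e = {x, y}) * h e \<partial>count_space V \<partial>count_space V \<partial>count_space ?P)"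
    by (intro nn_integral_count_space_nn_integral P) simp
  also have "\<dots> = (\<integral>\<^sup>+e. 2 * h e \<partial>count_space ?P)"
    using 2 by (intro nn_integral_cong) auto
  also have "\<dots> = 2 * (\<integral>\<^sup>+e. h e \<partial>count_space ?P)" by (rule nn_integral_cmult) simp
  finally show ?thesis .
qed

lemma nn_integral_count_space_Times:
  "(\<integral>\<^sup>+p. f p \<partial>count_space (A \<times> B)) = (\<integral>\<^sup>+x. \<integral>\<^sup>+y. f (x, y) \<partial>count_space B \<partial>count_space A)"
proof -
  have "(\<integral>\<^sup>+p. f p \<partial>count_space (A \<times> B)) = (\<integral>\<^sup>+p. f p * indicator (A \<times> B) p \<partial>count_space UNIV)"
    by (rule nn_integral_count_space_indicator) simp
  also have "\<dots> = (\<integral>\<^sup>+x. \<integral>\<^sup>+y. f (x, y) * indicator (A \<times> B) (x, y) \<partial>count_space UNIV \<partial>count_space UNIV)"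
    by (rule nn_integral_fst_count_space[symmetric])
  also have "\<dots> = (\<integral>\<^sup>+x. (\<integral>\<^sup>+y. f (x, y) * indicator B y \<partial>count_space UNIV) * indicator A x \<partial>count_space UNIV)"
    by (auto intro!: nn_integral_cong split: split_indicator)
  also have "\<dots> = (\<integral>\<^sup>+x. (\<integral>\<^sup>+y. f (x, y) \<partial>count_space B) * indicator A x \<partial>count_space UNIV)"
    by (subst nn_integral_count_space_indicator) auto
  also have "\<dots> = (\<integral>\<^sup>+x. (\<integral>\<^sup>+y. f (x, y) \<partial>count_space B) \<partial>count_space A)"
    by (rule nn_integral_count_space_indicator[symmetric]) simp
  finally show ?thesis .
qed

section \<open>The law of the random edges\<close>

locale connection_function =
  fixes \<phi> :: "'a::polish_space \<Rightarrow> 'a \<Rightarrow> real"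
  assumes measurable_phi: "(\<lambda>(x, y). \<phi> x y) \<in> borel_measurable (borel \<Otimes>\<^sub>M borel)"
    and phi_bounds: "\<And>x y. 0 \<le> \<phi> x y \<and> \<phi> x y \<le> 1"
    and phi_sym: "\<And>x y. \<phi> x y = \<phi> y x"
begin

definition edge_measure :: "'a set set \<Rightarrow> ('a set \<Rightarrow> bool) measure" where
  "edge_measure I = (\<Pi>\<^sub>M e\<in>I. measure_pmf (bernoulli_pmf (pair_prob \<phi> e)))"

definition edge_graph :: "'a set \<Rightarrow> ('a set \<Rightarrow> bool) \<Rightarrow> 'a graph" where
  "edge_graph V b = Graph V {e \<in> vertex_pairs V. b e}"

lemma random_edges_law_eq:
  "random_edges_law \<phi> V = distr (edge_measure (vertex_pairs V)) graph_space (edge_graph V)"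
  by (simp add: random_edges_law_def edge_measure_def edge_graph_def[abs_def])

lemma pair_prob_pair [simp]: "pair_prob \<phi> {x, y} = \<phi> x y"
  using phi_sym by (rule pair_prob_insert)

lemma pair_prob_bounds: "e \<in> vertex_pairs V \<Longrightarrow> 0 \<le> pair_prob \<phi> e \<and> pair_prob \<phi> e \<le> 1"
  using phi_bounds by (auto simp: vertex_pairs_def card_2_iff)

lemma product_prob_space_edges:
  "product_prob_space (\<lambda>e. measure_pmf (bernoulli_pmf (pair_prob \<phi> e)))"
  by (intro product_prob_spaceI measure_pmf.prob_space_axioms)

lemma prob_space_edge_measure: "prob_space (edge_measure I)"
  unfolding edge_measure_def by (intro prob_space_PiM measure_pmf.prob_space_axioms)

lemma space_edge_measure: "space (edge_measure I) = extensional I"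
  by (auto simp: edge_measure_def space_PiM PiE_def)

lemma measurable_edge_coordinate:
  "e \<in> I \<Longrightarrow> (\<lambda>b. b e) \<in> measurable (edge_measure I) (count_space UNIV)"
  unfolding edge_measure_def by measurable

lemma emeasure_bernoulli_False: "0 \<le> p \<Longrightarrow> p \<le> 1 \<Longrightarrow>
    emeasure (measure_pmf (bernoulli_pmf p)) {False} = ennreal (1 - p)"
  by (simp add: emeasure_pmf_single)

text \<open>For finitely many edges this is independence; for infinitely many the void events of finite
  subfamilies decrease.\<close>

lemma emeasure_edges_void:
  assumes J: "J \<subseteq> I" "countable J" and pairs: "J \<subseteq> vertex_pairs V"
  shows "emeasure (edge_measure I) {b \<in> space (edge_measure I). \<forall>e\<in>J. \<not> b e}
    = ennreal (unit_prod (\<lambda>e. 1 - pair_prob \<phi> e) J)"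
proof -
  interpret P: product_prob_space "\<lambda>e. measure_pmf (bernoulli_pmf (pair_prob \<phi> e))" I
    by (rule product_prob_space_edges)
  interpret E: prob_space "edge_measure I" by (rule prob_space_edge_measure)
  have p: "0 \<le> pair_prob \<phi> e \<and> pair_prob \<phi> e \<le> 1" if "e \<in> J" for e
    using that pairs pair_prob_bounds by blast
  have fin: "emeasure (edge_measure I) {b \<in> space (edge_measure I). \<forall>e\<in>W. \<not> b e}
      = ennreal (\<Prod>e\<in>W. 1 - pair_prob \<phi> e)" if W: "finite W" "W \<subseteq> J" for W
  proof -
    have "emeasure (edge_measure I) {b \<in> space (edge_measure I). \<forall>e\<in>W. b e \<in> {False}}
       = (\<Prod>e\<in>W. emeasure (measure_pmf (bernoulli_pmf (pair_prob \<phi> e))) {False})"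
      unfolding edge_measure_def using W J(1) by (intro P.emeasure_PiM_Collect) auto
    also have "\<dots> = (\<Prod>e\<in>W. ennreal (1 - pair_prob \<phi> e))"
      using p W(2) by (intro prod.cong refl emeasure_bernoulli_False) auto
    also have "\<dots> = ennreal (\<Prod>e\<in>W. 1 - pair_prob \<phi> e)"
      using p W(2) by (intro prod_ennreal) auto
    finally show ?thesis by simp
  qed
  show ?thesis
  proof (cases "finite J")
    case True
    then show ?thesis using fin[OF True order_refl] p by (simp add: unit_prod_finite)
  next
    case False
    define g where "g = from_nat_into J"
    have g: "bij_betw g UNIV J" unfolding g_def using J(2) False by (rule bij_betw_from_nat_into)
    have gJ: "g i \<in> J" for i using g by (auto simp: bij_betw_def)
    have inj: "inj_on g A" for A using g by (auto simp: bij_betw_def inj_on_def)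
    define A where "A n = {b \<in> space (edge_measure I). \<forall>e\<in>g ` {..<n}. \<not> b e}" for n
    have "A n \<in> sets (edge_measure I)" for n
    proof -
      have "g i \<in> I" for i using gJ J(1) by auto
      note [measurable] = measurable_edge_coordinate[OF this]
      have "A n = {b \<in> space (edge_measure I). \<forall>i\<in>{..<n}. \<not> b (g i)}" by (auto simp: A_def)
      also have "\<dots> \<in> sets (edge_measure I)" by measurable
      finally show ?thesis .
    qed
    then have lim1: "(\<lambda>n. emeasure (edge_measure I) (A n)) \<longlonglongrightarrow> emeasure (edge_measure I) (\<Inter>n. A n)"
    proof (intro Lim_emeasure_decseq)
      show "decseq A" unfolding A_def by (rule decseq_SucI) auto
      show "emeasure (edge_measure I) (A i) \<noteq> \<infinity>" for i using E.emeasure_finite by simp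
    qed auto
    have eqI: "(\<Inter>n. A n) = {b \<in> space (edge_measure I). \<forall>e\<in>J. \<not> b e}"
    proof (rule set_eqI)
      fix b
      have "b \<in> (\<Inter>n. A n) \<longleftrightarrow> b \<in> space (edge_measure I) \<and> (\<forall>i. \<not> b (g i))"
        by (auto simp: A_def intro: lessI)
      also have "(\<forall>i. \<not> b (g i)) \<longleftrightarrow> (\<forall>e\<in>range g. \<not> b e)" by blast
      also have "range g = J" using g by (simp add: bij_betw_def)
      finally show "b \<in> (\<Inter>n. A n) \<longleftrightarrow> b \<in> {b \<in> space (edge_measure I). \<forall>e\<in>J. \<not> b e}" by simp
    qed
    have eqn: "emeasure (edge_measure I) (A n) = ennreal (\<Prod>i<n. 1 - pair_prob \<phi> (g i))" for n
      unfolding A_def using fin[of "g ` {..<n}"] gJ prod.reindex[OF inj[of "{..<n}"], of "\<lambda>e. 1 - pair_prob \<phi> e"]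
      by (simp add: image_subset_iff)
    have lim2: "(\<lambda>n. ennreal (\<Prod>i<n. 1 - pair_prob \<phi> (g i))) \<longlonglongrightarrow> ennreal (unit_prod (\<lambda>e. 1 - pair_prob \<phi> e) J)"
      using p by (intro tendsto_ennrealI prod_tendsto_unit_prod[OF _ g, of "\<lambda>e. 1 - pair_prob \<phi> e"]) auto
    show ?thesis using LIMSEQ_unique[OF lim1[unfolded eqn eqI] lim2] .
  qed
qed

lemma edge_graph_graphs: "locally_finite_set V \<Longrightarrow> edge_graph V b \<in> graphs"
  by (auto simp: edge_graph_def graphs_def)

lemma measurable_edge_graph:
  assumes V: "locally_finite_set V"
  shows "edge_graph V \<in> measurable (edge_measure (vertex_pairs V)) graph_space"
proof (rule graph_space_measurable_voidI)
  show "edge_graph V b \<in> graphs" for b using V by (rule edge_graph_graphs)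
  show "{b \<in> space (edge_measure (vertex_pairs V)). verts (edge_graph V b) \<inter> B = {}} \<in> sets (edge_measure (vertex_pairs V))"
    for B by (simp add: edge_graph_def)
  fix D :: "('a \<times> 'a) set"
  let ?M = "edge_measure (vertex_pairs V)"
  have c: "countable {e \<in> vertex_pairs V. \<exists>x y. (x, y) \<in> D \<and> e = {x, y}}"
    using countable_vertex_pairs[OF locally_finite_set_countable[OF V]] by (rule countable_subset[rotated]) auto
  have "{b \<in> space ?M. \<forall>e\<in>{e \<in> vertex_pairs V. \<exists>x y. (x, y) \<in> D \<and> e = {x, y}}. \<not> b e} \<in> sets ?M"
  proof -
    let ?J = "{e \<in> vertex_pairs V. \<exists>x y. (x, y) \<in> D \<and> e = {x, y}}"
    have "{b \<in> space ?M. b e} \<in> sets ?M" if "e \<in> ?J" for e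
    proof -
      have "e \<in> vertex_pairs V" using that by simp
      from measurable_edge_coordinate[OF this] show ?thesis unfolding pred_def .
    qed
    then have "space ?M - (\<Union>e\<in>?J. {b \<in> space ?M. b e}) \<in> sets ?M"
      using c by (intro sets.Diff sets.top sets.countable_UN') auto
    also have "space ?M - (\<Union>e\<in>?J. {b \<in> space ?M. b e}) = {b \<in> space ?M. \<forall>e\<in>?J. \<not> b e}" by auto
    finally show ?thesis .
  qed
  also have "{b \<in> space ?M. \<forall>e\<in>{e \<in> vertex_pairs V. \<exists>x y. (x, y) \<in> D \<and> e = {x, y}}. \<not> b e}
     = {b \<in> space ?M. \<forall>x y. (x, y) \<in> D \<longrightarrow> {x, y} \<notin> edges (edge_graph V b)}"
    by (auto simp: edge_graph_def)
  finally show "{b \<in> space ?M. \<forall>x y. (x, y) \<in> D \<longrightarrow> {x, y} \<notin> edges (edge_graph V b)} \<in> sets ?M" .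
qed

lemma prob_space_random_edges_law: "locally_finite_set V \<Longrightarrow> prob_space (random_edges_law \<phi> V)"
  unfolding random_edges_law_eq
  by (intro prob_space.prob_space_distr prob_space_edge_measure measurable_edge_graph)

lemma sets_random_edges_law [simp, measurable_cong]: "sets (random_edges_law \<phi> V) = sets graph_space"
  by (simp add: random_edges_law_def)

lemma nn_integral_random_edges_law:
  assumes "locally_finite_set V" "g \<in> borel_measurable graph_space"
  shows "(\<integral>\<^sup>+\<mu>. g \<mu> \<partial>random_edges_law \<phi> V) = (\<integral>\<^sup>+b. g (edge_graph V b) \<partial>edge_measure (vertex_pairs V))"
  unfolding random_edges_law_eq using assms by (subst nn_integral_distr) (auto intro: measurable_edge_graph)

text \<open>It suffices to consider void events. Given the vertex set \<open>V\<close>, the probability that no edge lies in \<open>D\<close> is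
  a product over the pairs in \<open>V\<close>, that is, \<open>expneg\<close> of half the double sum over \<open>V\<close> of the
  exponents \<open>neglog\<close>, and this sum depends measurably on \<open>V\<close>.\<close>

lemma measurable_random_edges_law:
  "random_edges_law \<phi> \<in> measurable point_space (prob_algebra graph_space)"
proof (rule measurable_prob_algebra_generated[OF sets_graph_space_void Int_stable_graph_void])
  fix A :: "'a graph set"
  assume "A \<in> graph_void_events"
  then obtain B D where A: "A = {\<mu> \<in> graphs. verts \<mu> \<inter> B = {} \<and> (\<forall>x y. (x, y) \<in> D \<longrightarrow> {x, y} \<notin> edges \<mu>)}"
    and B [measurable]: "B \<in> sets borel" and D [measurable]: "D \<in> sets (borel \<Otimes>\<^sub>M borel)"
    unfolding graph_void_events_def by blast
  have As: "A \<in> sets graph_space"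
    unfolding sets_graph_space_void using \<open>A \<in> graph_void_events\<close> by (rule sigma_sets.Basic)
  define h where "h e = of_bool (\<exists>x y. (x, y) \<in> D \<and> e = {x, y}) * neglog (pair_prob \<phi> e)" for e
  define H where "H V = (\<integral>\<^sup>+x. \<integral>\<^sup>+y. of_bool (x \<noteq> y) * h {x, y} \<partial>count_space V \<partial>count_space V)" for V
  have hxy: "h {x, y} = of_bool ((x, y) \<in> D \<or> (y, x) \<in> D) * neglog (\<phi> x y)" for x y
    by (auto simp: h_def doubleton_eq_iff)
  have phi_m: "(\<lambda>p. \<phi> (fst p) (snd p)) \<in> borel_measurable (borel \<Otimes>\<^sub>M borel)"
    using measurable_phi by (simp add: case_prod_beta)
  have Hm: "H \<in> borel_measurable point_space"
  proof -
    have "(\<lambda>q :: ('a set \<times> 'a) \<times> 'a. of_bool (snd (fst q) \<noteq> snd q) * h {snd (fst q), snd q})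
       \<in> borel_measurable ((point_space \<Otimes>\<^sub>M borel) \<Otimes>\<^sub>M borel)"
    proof -
      have D': "Measurable.pred (borel \<Otimes>\<^sub>M borel) (\<lambda>p. p \<in> D)"
        by (rule pred_sets2[OF D]) simp
      have Dm: "Measurable.pred (borel \<Otimes>\<^sub>M borel) (\<lambda>p :: 'a \<times> 'a. (fst p, snd p) \<in> D)"
        "Measurable.pred (borel \<Otimes>\<^sub>M borel) (\<lambda>p :: 'a \<times> 'a. (snd p, fst p) \<in> D)"
        by (rule measurable_compose[OF _ D'], intro measurable_Pair measurable_fst measurable_snd)+
      define k where "k p = (if fst p \<noteq> snd p \<and> ((fst p, snd p) \<in> D \<or> (snd p, fst p) \<in> D)
        then neglog (\<phi> (fst p) (snd p)) else 0)" for p :: "'a \<times> 'a"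
      have "k \<in> borel_measurable (borel \<Otimes>\<^sub>M borel)"
        unfolding k_def[abs_def]
      proof (rule measurable_If)
        show "(\<lambda>p. neglog (\<phi> (fst p) (snd p))) \<in> borel_measurable (borel \<Otimes>\<^sub>M borel)"
          by (rule measurable_compose[OF phi_m measurable_neglog])
        have "Measurable.pred (borel \<Otimes>\<^sub>M borel) (\<lambda>p :: 'a \<times> 'a. fst p \<noteq> snd p \<and>
            ((fst p, snd p) \<in> D \<or> (snd p, fst p) \<in> D))"
          by (intro pred_intros_logic Dm) measurable
        then show "{p \<in> space (borel \<Otimes>\<^sub>M borel). fst p \<noteq> snd p \<and>
            ((fst p, snd p) \<in> D \<or> (snd p, fst p) \<in> D)} \<in> sets (borel \<Otimes>\<^sub>M borel)" by (simp only: pred_def)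
      qed simp
      from measurable_compose[OF measurable_Pair[OF measurable_compose[OF measurable_fst measurable_snd] measurable_snd] this]
      have "(\<lambda>q. k (snd (fst q), snd q)) \<in> borel_measurable (((point_space :: 'a set measure) \<Otimes>\<^sub>M borel) \<Otimes>\<^sub>M borel)" .
      also have "(\<lambda>q :: ('a set \<times> 'a) \<times> 'a. k (snd (fst q), snd q)) =
          (\<lambda>q. of_bool (snd (fst q) \<noteq> snd q) * h {snd (fst q), snd q})"
        by (rule ext) (simp add: k_def hxy)
      finally show ?thesis .
    qed
    from point_sum_measurable[OF measurable_fst this]
    have "(\<lambda>p :: 'a set \<times> 'a. \<integral>\<^sup>+y. of_bool (snd p \<noteq> y) * h {snd p, y} \<partial>count_space (fst p))
       \<in> borel_measurable (point_space \<Otimes>\<^sub>M borel)" by simp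
    from point_sum_measurable[OF measurable_ident_sets[OF refl] this] show ?thesis
      by (simp only: H_def[abs_def] fst_conv snd_conv)
  qed
  have "(\<lambda>V. if V \<inter> B = {} then ennreal (expneg (H V / 2)) else 0) \<in> borel_measurable point_space"
  proof (rule measurable_If)
    show "(\<lambda>V. ennreal (expneg (H V / 2))) \<in> borel_measurable point_space"
      using Hm by measurable
    show "{V \<in> space point_space. V \<inter> B = {}} \<in> sets point_space"
      by (rule measurable_void[OF measurable_ident_sets[OF refl] B])
  qed simp
  then show "(\<lambda>V. emeasure (random_edges_law \<phi> V) A) \<in> borel_measurable point_space"
  proof (rule measurable_cong[THEN iffD1, rotated])
    fix V :: "'a set" assume "V \<in> space point_space"
    then have V: "locally_finite_set V" by (simp add: space_point_space)
    let ?M = "edge_measure (vertex_pairs V)"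
    define J where "J = {e \<in> vertex_pairs V. \<exists>x y. (x, y) \<in> D \<and> e = {x, y}}"
    have JV: "J \<subseteq> vertex_pairs V" by (auto simp: J_def)
    have cp: "countable (vertex_pairs V)"
      by (rule countable_vertex_pairs[OF locally_finite_set_countable[OF V]])
    have c: "countable J" using cp JV by (rule countable_subset[rotated])
    have "H V = 2 * (\<integral>\<^sup>+e. h e \<partial>count_space (vertex_pairs V))"
      unfolding H_def by (rule nn_integral_vertex_pairs[OF locally_finite_set_countable[OF V]])
    also have "(\<integral>\<^sup>+e. h e \<partial>count_space (vertex_pairs V)) = (\<integral>\<^sup>+e. neglog (pair_prob \<phi> e) \<partial>count_space J)"
      unfolding h_def J_def by (rule nn_integral_count_space_filter)
    finally have H2: "H V / 2 = (\<integral>\<^sup>+e. neglog (pair_prob \<phi> e) \<partial>count_space J)"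
      by (simp only: mult.commute[of 2]) (rule ennreal_mult_divide_eq, auto)
    have "edge_graph V b \<in> A \<longleftrightarrow> V \<inter> B = {} \<and> (\<forall>e\<in>J. \<not> b e)" for b
    proof -
      have "(\<forall>x y. (x, y) \<in> D \<longrightarrow> {x, y} \<notin> {e \<in> vertex_pairs V. b e}) \<longleftrightarrow> (\<forall>e\<in>J. \<not> b e)"
        unfolding J_def by blast
      then show ?thesis using edge_graph_graphs[OF V, of b] by (simp add: A edge_graph_def)
    qed
    note iff = this
    have pre: "edge_graph V -` A \<inter> space ?M = (if V \<inter> B = {} then {b \<in> space ?M. \<forall>e\<in>J. \<not> b e} else {})"
    proof (rule set_eqI)
      show "b \<in> edge_graph V -` A \<inter> space ?M \<longleftrightarrow>
          b \<in> (if V \<inter> B = {} then {b \<in> space ?M. \<forall>e\<in>J. \<not> b e} else {})" for b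
        using iff[of b] by (cases "V \<inter> B = {}") (simp_all add: conj_commute)
    qed
    have "emeasure (random_edges_law \<phi> V) A = emeasure ?M (edge_graph V -` A \<inter> space ?M)"
      unfolding random_edges_law_eq by (rule emeasure_distr[OF measurable_edge_graph[OF V] As])
    also have "\<dots> = (if V \<inter> B = {} then emeasure ?M {b \<in> space ?M. \<forall>e\<in>J. \<not> b e} else 0)"
      unfolding pre by (simp only: if_distrib[of "emeasure ?M"] emeasure_empty)
    also have "emeasure ?M {b \<in> space ?M. \<forall>e\<in>J. \<not> b e} = ennreal (unit_prod (\<lambda>e. 1 - pair_prob \<phi> e) J)"
      using c JV by (intro emeasure_edges_void) auto
    also have "unit_prod (\<lambda>e. 1 - pair_prob \<phi> e) J = expneg (H V / 2)"
      unfolding H2 using JV by (intro unit_prod_eq_expneg c pair_prob_bounds) auto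
    finally show "(if V \<inter> B = {} then ennreal (expneg (H V / 2)) else 0) = emeasure (random_edges_law \<phi> V) A" ..
  qed
next
  show "graph_void_events \<subseteq> Pow (graphs :: 'a graph set)" by (auto simp: graph_void_events_def)
  show "prob_space (random_edges_law \<phi> V)" if "V \<in> space point_space" for V
    using that by (simp add: prob_space_random_edges_law space_point_space)
qed (rule sets_random_edges_law)

end


context connection_function
begin

lemma pair_prob_swap: "pair_prob \<phi> {x, y} = \<phi> y x"
  using pair_prob_pair[of x y] phi_sym[of x y] by simp

lemma unit_prod_phi_eq_expneg:
  "countable U \<Longrightarrow> unit_prod (\<lambda>y. 1 - \<phi> x y) U = expneg (\<integral>\<^sup>+y. neglog (\<phi> x y) \<partial>count_space U)"
  by (rule unit_prod_eq_expneg) (use phi_bounds in auto)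

lemma measurable_phi': "(\<lambda>p. \<phi> (fst p) (snd p)) \<in> borel_measurable (borel \<Otimes>\<^sub>M borel)"
  using measurable_phi by (simp add: case_prod_beta)

lemma measurable_unit_prod_phi:
  assumes U: "U \<in> measurable M point_space" and x: "x \<in> measurable M borel"
  shows "(\<lambda>\<omega>. unit_prod (\<lambda>y. 1 - \<phi> (x \<omega>) y) (U \<omega>)) \<in> borel_measurable M"
proof -
  have "(\<lambda>p. (x (fst p), snd p)) \<in> measurable (M \<Otimes>\<^sub>M borel) (borel \<Otimes>\<^sub>M borel)"
    by (intro measurable_Pair measurable_compose[OF measurable_fst x] measurable_snd)
  from measurable_compose[OF measurable_compose[OF this measurable_phi'] measurable_neglog]
  have "(\<lambda>p. neglog (\<phi> (x (fst p)) (snd p))) \<in> borel_measurable (M \<Otimes>\<^sub>M borel)" by (simp only: fst_conv snd_conv)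
  from measurable_compose[OF point_sum_measurable[OF U this] measurable_expneg]
  show ?thesis
  proof (rule measurable_cong[THEN iffD1, rotated])
    fix \<omega> assume "\<omega> \<in> space M"
    then have "countable (U \<omega>)" using measurable_point_lf[OF U] locally_finite_set_countable by blast
    then show "expneg (\<integral>\<^sup>+y. neglog (\<phi> (x (fst (\<omega>, y))) (snd (\<omega>, y))) \<partial>count_space (U \<omega>))
        = unit_prod (\<lambda>y. 1 - \<phi> (x \<omega>) y) (U \<omega>)"
      by (simp only: unit_prod_phi_eq_expneg fst_conv snd_conv)
  qed
qed

lemma measurable_component_verts: "component_verts v \<in> measurable graph_space (point_space :: 'a set measure)"
  using measurable_verts[OF measurable_component[of v]] by simp

lemma verts_edge_graph [simp]: "verts (edge_graph V b) = V"
  by (simp add: edge_graph_def)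

lemma edge_graph_restrict: "vertex_pairs V \<subseteq> J \<Longrightarrow> edge_graph V (restrict b J) = edge_graph V b"
  by (auto simp: edge_graph_def)

lemma indep_edges:
  "prob_space.indep_vars (edge_measure I) (\<lambda>e. measure_pmf (bernoulli_pmf (pair_prob \<phi> e))) (\<lambda>e b. b e) I"
proof -
  let ?B = "\<lambda>e. measure_pmf (bernoulli_pmf (pair_prob \<phi> e))"
  interpret P: product_prob_space ?B I by (rule product_prob_space_edges)
  interpret E: prob_space "edge_measure I" by (rule prob_space_edge_measure)
  show ?thesis
  proof (cases "I = {}")
    case True
    then show ?thesis unfolding E.indep_vars_def E.indep_sets_def by blast
  next
    case False
    have rv: "(\<lambda>b. b e) \<in> measurable (edge_measure I) (?B e)" if "e \<in> I" for e
      using that unfolding edge_measure_def by (rule measurable_component_singleton)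
    have "distr (edge_measure I) (\<Pi>\<^sub>M e\<in>I. ?B e) (\<lambda>b. \<lambda>e\<in>I. b e) = distr (edge_measure I) (edge_measure I) (\<lambda>b. b)"
      by (rule distr_cong) (auto simp: edge_measure_def space_PiM PiE_def extensional_restrict)
    also have "\<dots> = edge_measure I" by simp
    also have "\<dots> = (\<Pi>\<^sub>M e\<in>I. distr (edge_measure I) (?B e) (\<lambda>b. b e))"
      unfolding edge_measure_def by (intro PiM_cong refl) (simp only: P.PiM_component)
    finally have eq: "distr (edge_measure I) (\<Pi>\<^sub>M e\<in>I. ?B e) (\<lambda>b. \<lambda>e\<in>I. b e) =
        (\<Pi>\<^sub>M e\<in>I. distr (edge_measure I) (?B e) (\<lambda>b. b e))" .
    show ?thesis
      by (rule E.indep_vars_iff_distr_eq_PiM'[where M'="?B" and X="\<lambda>e b. b e", OF False, THEN iffD2, OF rv eq])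
  qed
qed

lemma distr_edge_measure_restrict:
  assumes "J \<subseteq> I"
  shows "distr (edge_measure I) (edge_measure J) (\<lambda>b. restrict b J) = edge_measure J"
  unfolding edge_measure_def
  by (rule distr_PiM_reindex[where f="\<lambda>e. e"]) (use assms in \<open>auto simp: measure_pmf.prob_space_axioms\<close>)

lemma edge_measure_split:
  assumes I: "I1 \<inter> I2 = {}" "I1 \<subseteq> I" "I2 \<subseteq> I"
  shows "distr (edge_measure I) (edge_measure I1 \<Otimes>\<^sub>M edge_measure I2) (\<lambda>b. (restrict b I1, restrict b I2))
    = edge_measure I1 \<Otimes>\<^sub>M edge_measure I2"
proof -
  interpret E: prob_space "edge_measure I" by (rule prob_space_edge_measure)
  from E.indep_var_restrict[OF indep_edges I]
  have "E.indep_var (edge_measure I1) (\<lambda>b. restrict b I1) (edge_measure I2) (\<lambda>b. restrict b I2)"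
    unfolding edge_measure_def[of I1] edge_measure_def[of I2] by (simp add: restrict_def)
  then show ?thesis
    using distr_edge_measure_restrict[OF I(2)] distr_edge_measure_restrict[OF I(3)]
    unfolding E.indep_var_distribution_eq by simp
qed

lemma measurable_edge_restrict:
  "J \<subseteq> I \<Longrightarrow> (\<lambda>b. restrict b J) \<in> measurable (edge_measure I) (edge_measure J)"
  unfolding edge_measure_def by (rule measurable_restrict_subset)

lemma nn_integral_edge_measure_split:
  assumes I: "I1 \<inter> I2 = {}" "I1 \<subseteq> I" "I2 \<subseteq> I"
    and H: "H \<in> borel_measurable (edge_measure I1 \<Otimes>\<^sub>M edge_measure I2)"
  shows "(\<integral>\<^sup>+b. H (restrict b I1, restrict b I2) \<partial>edge_measure I)
    = (\<integral>\<^sup>+b1. \<integral>\<^sup>+b2. H (b1, b2) \<partial>edge_measure I2 \<partial>edge_measure I1)"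
proof -
  interpret E2: prob_space "edge_measure I2" by (rule prob_space_edge_measure)
  have "(\<integral>\<^sup>+b1. \<integral>\<^sup>+b2. H (b1, b2) \<partial>edge_measure I2 \<partial>edge_measure I1) = (\<integral>\<^sup>+p. H p \<partial>(edge_measure I1 \<Otimes>\<^sub>M edge_measure I2))"
    by (rule E2.nn_integral_fst[OF H])
  also have "\<dots> = (\<integral>\<^sup>+p. H p \<partial>distr (edge_measure I) (edge_measure I1 \<Otimes>\<^sub>M edge_measure I2) (\<lambda>b. (restrict b I1, restrict b I2)))"
    by (simp only: edge_measure_split[OF I])
  also have "\<dots> = (\<integral>\<^sup>+b. H (restrict b I1, restrict b I2) \<partial>edge_measure I)"
    by (intro nn_integral_distr measurable_Pair measurable_edge_restrict I) (simp add: H)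
  finally show ?thesis ..
qed

section \<open>Adding a vertex\<close>

text \<open>The edges at the new vertex \<open>x\<close> are independent of the graph on \<open>V\<close>, and \<open>x\<close> is in the component of \<open>v\<close>
  unless all edges from \<open>x\<close> to the component in \<open>V\<close> are absent.\<close>

lemma random_edges_law_add_vertex:
  assumes V: "locally_finite_set V" "x \<notin> V" "v \<in> V" and g: "g \<in> borel_measurable graph_space"
  shows "(\<integral>\<^sup>+\<mu>. of_bool (x \<in> component_verts v \<mu>) * g (component v (delete_vertex x \<mu>)) \<partial>random_edges_law \<phi> (insert x V))
    = (\<integral>\<^sup>+\<mu>. g (component v \<mu>) * ennreal (1 - unit_prod (\<lambda>y. 1 - \<phi> x y) (component_verts v \<mu>)) \<partial>random_edges_law \<phi> V)"
proof -
  define I where "I = vertex_pairs (insert x V)"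
  define I1 where "I1 = vertex_pairs V"
  define I2 where "I2 = (\<lambda>y. {x, y}) ` V"
  have I: "I1 \<inter> I2 = {}" "I1 \<subseteq> I" "I2 \<subseteq> I"
    using V(2) by (auto simp: I_def I1_def I2_def vertex_pairs_def card_insert_if)
  have CV: "component_verts v (edge_graph V b) \<subseteq> V" for b
    using component_verts_subset[of v "edge_graph V b"] by (simp add: edge_graph_def)
  have cV: "countable V" by (rule locally_finite_set_countable[OF V(1)])
  interpret E2: prob_space "edge_measure I2" by (rule prob_space_edge_measure)
  have lfx: "locally_finite_set (insert x V)" using V(1) by simp
  have gr [measurable]: "edge_graph V \<in> measurable (edge_measure I1) graph_space"
    unfolding I1_def by (rule measurable_edge_graph[OF V(1)])
  define G where "G b1 = g (component v (edge_graph V b1))" for b1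
  have G [measurable]: "G \<in> borel_measurable (edge_measure I1)"
    unfolding G_def[abs_def] by (intro measurable_compose[OF _ g] measurable_compose[OF gr] measurable_component)
  define Q where "Q b1 b2 \<longleftrightarrow> (\<exists>y\<in>component_verts v (edge_graph V b1). b2 {x, y})" for b1 and b2 :: "'a set \<Rightarrow> bool"
  have Qc: "{p \<in> space (edge_measure I1 \<Otimes>\<^sub>M edge_measure I2). Q (fst p) (snd p)} \<in> sets (edge_measure I1 \<Otimes>\<^sub>M edge_measure I2)"
  proof -
    have "{p \<in> space (edge_measure I1 \<Otimes>\<^sub>M edge_measure I2). y \<in> component_verts v (edge_graph V (fst p)) \<and> snd p {x, y}}
       \<in> sets (edge_measure I1 \<Otimes>\<^sub>M edge_measure I2)" if "y \<in> V" for y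
    proof -
      have m1: "(\<lambda>p. edge_graph V (fst p)) \<in> measurable (edge_measure I1 \<Otimes>\<^sub>M edge_measure I2) graph_space"
        by (rule measurable_compose[OF measurable_fst gr])
      have "{x, y} \<in> I2" using that by (simp add: I2_def)
      from measurable_compose[OF measurable_snd measurable_edge_coordinate[OF this]]
      have m2: "Measurable.pred (edge_measure I1 \<Otimes>\<^sub>M edge_measure I2) (\<lambda>p. snd p {x, y})" .
      have "Measurable.pred (edge_measure I1 \<Otimes>\<^sub>M edge_measure I2)
          (\<lambda>p. y \<in> component_verts v (edge_graph V (fst p)) \<and> snd p {x, y})"
        by (intro pred_intros_logic pred_component_verts[OF m1] m2) simp
      then show ?thesis unfolding pred_def .
    qed
    then have "(\<Union>y\<in>V. {p \<in> space (edge_measure I1 \<Otimes>\<^sub>M edge_measure I2).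
        y \<in> component_verts v (edge_graph V (fst p)) \<and> snd p {x, y}}) \<in> sets (edge_measure I1 \<Otimes>\<^sub>M edge_measure I2)"
      using cV by (intro sets.countable_UN') auto
    also have "(\<Union>y\<in>V. {p \<in> space (edge_measure I1 \<Otimes>\<^sub>M edge_measure I2).
        y \<in> component_verts v (edge_graph V (fst p)) \<and> snd p {x, y}})
      = {p \<in> space (edge_measure I1 \<Otimes>\<^sub>M edge_measure I2). Q (fst p) (snd p)}"
    proof (rule set_eqI)
      fix p
      show "p \<in> (\<Union>y\<in>V. {p \<in> space (edge_measure I1 \<Otimes>\<^sub>M edge_measure I2).
          y \<in> component_verts v (edge_graph V (fst p)) \<and> snd p {x, y}}) \<longleftrightarrow>
        p \<in> {p \<in> space (edge_measure I1 \<Otimes>\<^sub>M edge_measure I2). Q (fst p) (snd p)}"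
        unfolding Q_def using CV[of "fst p"] by blast
    qed
    finally show ?thesis .
  qed
  have Qm: "Measurable.pred (edge_measure I1 \<Otimes>\<^sub>M edge_measure I2) (\<lambda>p. Q (fst p) (snd p))"
    using Qc unfolding pred_def .
  define H where "H p = (if Q (fst p) (snd p) then G (fst p) else 0)" for p
  have H: "H \<in> borel_measurable (edge_measure I1 \<Otimes>\<^sub>M edge_measure I2)"
    unfolding H_def[abs_def] by (rule measurable_If[OF measurable_compose[OF measurable_fst G] _ Qc]) simp
  have del: "delete_vertex x (edge_graph (insert x V) b) = edge_graph V b" for b
    using V(2) by (auto simp: delete_vertex_def edge_graph_def vertex_pairs_def)
  have "(\<lambda>\<mu>. component v (delete_vertex x \<mu>)) \<in> measurable graph_space graph_space"
    by (intro measurable_compose[OF _ measurable_component] measurable_delete_vertex) auto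
  from measurable_compose[OF this g]
  have m: "(\<lambda>\<mu>. of_bool (x \<in> component_verts v \<mu>) * g (component v (delete_vertex x \<mu>))) \<in> borel_measurable graph_space"
    by (intro borel_measurable_times_ennreal measurable_of_bool_ennreal pred_component_verts) auto
  have "(\<integral>\<^sup>+\<mu>. of_bool (x \<in> component_verts v \<mu>) * g (component v (delete_vertex x \<mu>)) \<partial>random_edges_law \<phi> (insert x V))
     = (\<integral>\<^sup>+b. of_bool (x \<in> component_verts v (edge_graph (insert x V) b)) * g (component v (edge_graph V b)) \<partial>edge_measure I)"
    unfolding I_def nn_integral_random_edges_law[OF lfx m] del ..
  also have "\<dots> = (\<integral>\<^sup>+b. H (restrict b I1, restrict b I2) \<partial>edge_measure I)"
  proof (rule nn_integral_cong)
    fix b assume "b \<in> space (edge_measure I)"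
    have "x \<noteq> v" using V by auto
    then have "x \<in> component_verts v (edge_graph (insert x V) b) \<longleftrightarrow>
        (\<exists>y\<in>component_verts v (edge_graph V b). {x, y} \<in> edges (edge_graph (insert x V) b))"
      using mem_component_verts_iff_delete_vertex[where v=v and x=x, OF edge_graph_graphs[OF lfx]] V(3)
      by (simp add: del)
    also have "\<dots> \<longleftrightarrow> Q (restrict b I1) (restrict b I2)"
    proof -
      have "{x, y} \<in> edges (edge_graph (insert x V) b) \<longleftrightarrow> restrict b I2 {x, y}"
        if "y \<in> component_verts v (edge_graph V b)" for y
      proof -
        have "y \<in> V" using that CV by blast
        then have "{x, y} \<in> I2" "{x, y} \<in> I" using I(3) by (auto simp: I2_def)
        then show ?thesis by (simp add: edge_graph_def I_def)
      qed
      then show ?thesis unfolding Q_def by (simp add: edge_graph_restrict I1_def)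
    qed
    finally show "of_bool (x \<in> component_verts v (edge_graph (insert x V) b)) * g (component v (edge_graph V b))
        = H (restrict b I1, restrict b I2)"
      by (simp add: H_def G_def edge_graph_restrict I1_def)
  qed
  also have "\<dots> = (\<integral>\<^sup>+b1. \<integral>\<^sup>+b2. H (b1, b2) \<partial>edge_measure I2 \<partial>edge_measure I1)"
    by (rule nn_integral_edge_measure_split[OF I H])
  also have "\<dots> = (\<integral>\<^sup>+b1. G b1 * ennreal (1 - unit_prod (\<lambda>y. 1 - \<phi> x y) (component_verts v (edge_graph V b1))) \<partial>edge_measure I1)"
  proof (rule nn_integral_cong)
    fix b1 assume b1: "b1 \<in> space (edge_measure I1)"
    define C where "C = component_verts v (edge_graph V b1)"
    have CV: "C \<subseteq> V" unfolding C_def by (rule CV)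
    define J where "J = (\<lambda>y. {x, y}) ` C"
    have J: "J \<subseteq> I2" "countable J" "J \<subseteq> vertex_pairs (insert x V)"
      using CV countable_subset[OF CV cV] I(3) by (auto simp: J_def I2_def I_def)
    have S: "{b2 \<in> space (edge_measure I2). Q b1 b2} \<in> sets (edge_measure I2)"
    proof -
      have "Measurable.pred (edge_measure I2) (\<lambda>b2. Q (fst (b1, b2)) (snd (b1, b2)))"
        by (rule measurable_compose[OF measurable_Pair1'[OF b1] Qm])
      then show ?thesis unfolding pred_def fst_conv snd_conv .
    qed
    have "space (edge_measure I2) - {b2 \<in> space (edge_measure I2). Q b1 b2}
        = {b2 \<in> space (edge_measure I2). \<forall>e\<in>J. \<not> b2 e}"
      by (auto simp: Q_def J_def C_def)
    then have void: "emeasure (edge_measure I2) (space (edge_measure I2) - {b2 \<in> space (edge_measure I2). Q b1 b2})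
        = ennreal (unit_prod (\<lambda>e. 1 - pair_prob \<phi> e) J)"
      by (simp only: emeasure_edges_void[OF J])
    have "unit_prod (\<lambda>e. 1 - pair_prob \<phi> e) J = unit_prod (\<lambda>y. 1 - \<phi> x y) C"
      unfolding J_def using V(2) CV by (subst unit_prod_reindex) (auto simp: inj_on_def doubleton_eq_iff)
    with void have void': "E2.prob (space (edge_measure I2) - {b2 \<in> space (edge_measure I2). Q b1 b2})
       = unit_prod (\<lambda>y. 1 - \<phi> x y) C"
      using phi_bounds by (simp add: E2.emeasure_eq_measure ennreal_inj unit_prod_greatest prod_nonneg)
    have "(\<integral>\<^sup>+b2. H (b1, b2) \<partial>edge_measure I2)
        = (\<integral>\<^sup>+b2. G b1 * indicator {b2 \<in> space (edge_measure I2). Q b1 b2} b2 \<partial>edge_measure I2)"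
      by (intro nn_integral_cong) (auto simp: H_def)
    also have "\<dots> = G b1 * emeasure (edge_measure I2) {b2 \<in> space (edge_measure I2). Q b1 b2}"
      using S by (rule nn_integral_cmult_indicator)
    also have "emeasure (edge_measure I2) {b2 \<in> space (edge_measure I2). Q b1 b2} = ennreal (1 - unit_prod (\<lambda>y. 1 - \<phi> x y) C)"
      using E2.prob_compl[OF S] void' by (simp add: E2.emeasure_eq_measure)
    finally show "(\<integral>\<^sup>+b2. H (b1, b2) \<partial>edge_measure I2)
        = G b1 * ennreal (1 - unit_prod (\<lambda>y. 1 - \<phi> x y) (component_verts v (edge_graph V b1)))"
      by (simp add: C_def)
  qed
  also have "\<dots> = (\<integral>\<^sup>+\<mu>. g (component v \<mu>) * ennreal (1 - unit_prod (\<lambda>y. 1 - \<phi> x y) (component_verts v \<mu>)) \<partial>random_edges_law \<phi> V)"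
  proof -
    have "(\<lambda>\<mu>. g (component v \<mu>) * ennreal (1 - unit_prod (\<lambda>y. 1 - \<phi> x y) (component_verts v \<mu>))) \<in> borel_measurable graph_space"
      by (intro borel_measurable_times_ennreal measurable_compose[OF measurable_component g]
        measurable_compose[OF _ measurable_ennreal] borel_measurable_diff borel_measurable_const
        measurable_unit_prod_phi[OF measurable_component_verts, where x="\<lambda>_. x"] measurable_const) simp
    from nn_integral_random_edges_law[OF V(1) this] show ?thesis by (simp only: G_def I1_def)
  qed
  finally show ?thesis .
qed

section \<open>Isolating a component\<close>

text \<open>If no edge leaves \<open>W\<close>, every path from \<open>v\<close> stays in \<open>W\<close>; if one does, its end belongs to the component.\<close>

lemma component_verts_eq_iff_cut:
  assumes W: "v \<in> W" "W \<inter> V = {}"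
  shows "component_verts v (edge_graph (W \<union> V) b) = W \<longleftrightarrow>
    component_verts v (edge_graph W b) = W \<and> (\<forall>x\<in>W. \<forall>y\<in>V. \<not> b {x, y})"
proof -
  let ?m = "edge_graph (W \<union> V) b" and ?n = "edge_graph W b"
  have sub: "component_verts v ?n \<subseteq> W" using component_verts_subset[of v ?n] by (simp add: edge_graph_def)
  have mono: "component_verts v ?n \<subseteq> component_verts v ?m"
  proof -
    have "adjacency ?n \<subseteq> adjacency ?m" by (rule adjacency_mono) (auto simp: edge_graph_def vertex_pairs_def)
    then show ?thesis
      using rtrancl_mono[of "adjacency ?n" "adjacency ?m"] W(1) by (auto simp: component_verts_adjacency)
  qed
  have stay: "w \<in> W \<and> (v, w) \<in> (adjacency ?n)\<^sup>*"
    if "\<forall>x\<in>W. \<forall>y\<in>V. \<not> b {x, y}" "(v, w) \<in> (adjacency ?m)\<^sup>*" for w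
    using that(2)
  proof (induction rule: rtrancl_induct)
    case (step y z)
    have e: "{y, z} \<in> vertex_pairs (W \<union> V)" "b {y, z}" using step(2) by (auto simp: edge_graph_def)
    then have "z \<in> W" using step(3) that(1) by (auto simp: vertex_pairs_def)
    moreover have "(y, z) \<in> adjacency ?n"
      using e step(3) \<open>z \<in> W\<close> by (auto simp: edge_graph_def vertex_pairs_def)
    ultimately show ?case using step(3) by (auto intro: rtrancl_into_rtrancl)
  qed (use W in simp)
  show ?thesis
  proof
    assume eq: "component_verts v ?m = W"
    have cross: "\<forall>x\<in>W. \<forall>y\<in>V. \<not> b {x, y}"
    proof (intro ballI notI)
      fix x y assume xy: "x \<in> W" "y \<in> V" "b {x, y}"
      then have "x \<noteq> y" using W by auto
      then have "(x, y) \<in> adjacency ?m" using xy by (auto simp: edge_graph_def vertex_pairs_def)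
      moreover have "(v, x) \<in> (adjacency ?m)\<^sup>*" using xy(1) eq by (auto simp: component_verts_adjacency)
      ultimately have "(v, y) \<in> (adjacency ?m)\<^sup>*" by (rule rtrancl_into_rtrancl[rotated])
      then have "y \<in> component_verts v ?m"
        using xy W by (simp add: component_verts_adjacency)
      then show False using eq xy W by auto
    qed
    have "W \<subseteq> component_verts v ?n"
    proof
      fix w assume "w \<in> W"
      then have "(v, w) \<in> (adjacency ?m)\<^sup>*" using eq by (auto simp: component_verts_adjacency)
      from stay[OF cross this] show "w \<in> component_verts v ?n"
        using W by (simp add: component_verts_adjacency)
    qed
    then show "component_verts v ?n = W \<and> (\<forall>x\<in>W. \<forall>y\<in>V. \<not> b {x, y})" using sub cross by blast
  next
    assume R: "component_verts v ?n = W \<and> (\<forall>x\<in>W. \<forall>y\<in>V. \<not> b {x, y})"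
    have "component_verts v ?m \<subseteq> W"
      using stay R by (auto simp: component_verts_adjacency)
    then show "component_verts v ?m = W" using mono R by blast
  qed
qed

lemma component_edge_graph_cut:
  assumes "component_verts v (edge_graph (W \<union> V) b) = W" "component_verts v (edge_graph W b) = W"
  shows "component v (edge_graph (W \<union> V) b) = component v (edge_graph W b)"
proof -
  have "{e \<in> edges (edge_graph (W \<union> V) b). e \<subseteq> W} = {e \<in> edges (edge_graph W b). e \<subseteq> W}"
    by (auto simp: edge_graph_def vertex_pairs_def)
  then show ?thesis by (simp add: component_def assms)
qed

text \<open>The right-hand side is visibly measurable in the graph.\<close>

lemma component_verts_eq_iff_size:
  assumes "finite W"
  shows "component_verts v \<mu> = W \<longleftrightarrow> W \<subseteq> component_verts v \<mu> \<and> gsize (component v \<mu>) = of_nat (card W)"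
proof
  assume "component_verts v \<mu> = W"
  then show "W \<subseteq> component_verts v \<mu> \<and> gsize (component v \<mu>) = of_nat (card W)"
    using assms by (simp add: gsize_def emeasure_count_space_finite)
next
  assume *: "W \<subseteq> component_verts v \<mu> \<and> gsize (component v \<mu>) = of_nat (card W)"
  then have fin: "finite (component_verts v \<mu>)"
    by (cases "finite (component_verts v \<mu>)") (auto simp: gsize_def)
  with * have "card (component_verts v \<mu>) = card W"
    by (simp add: gsize_def emeasure_count_space_finite)
  then show "component_verts v \<mu> = W" using * fin card_subset_eq by metis
qed

lemma pred_subset_component_verts:
  assumes "finite W"
  shows "Measurable.pred graph_space (\<lambda>\<mu>. W \<subseteq> component_verts v (\<mu> :: 'a graph))"
proof -
  have "Measurable.pred graph_space (\<lambda>\<mu>. \<forall>w\<in>W. w \<in> component_verts v (\<mu> :: 'a graph))"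
    using assms by (intro pred_intros_finite(3) pred_component_verts) simp_all
  then show ?thesis by (simp only: subset_eq)
qed

lemma pred_component_verts_eq:
  assumes "finite W"
  shows "Measurable.pred graph_space (\<lambda>\<mu>. component_verts v (\<mu> :: 'a graph) = W)"
proof -
  have "Measurable.pred graph_space (\<lambda>\<mu> :: 'a graph. gsize (component v \<mu>) = of_nat (card W))"
    using measurable_compose[OF measurable_component measurable_gsize] by measurable
  then show ?thesis
    unfolding component_verts_eq_iff_size[OF assms]
    by (intro pred_intros_logic pred_subset_component_verts[OF assms])
qed

text \<open>The component is \<open>W\<close> if \<open>W\<close> is connected by its own edges and no edge joins \<open>W\<close> to \<open>V\<close>. These two events
  depend on disjoint families of edges.\<close>

lemma random_edges_law_cut:
  assumes W: "finite W" "v \<in> W" and V: "locally_finite_set V" "W \<inter> V = {}"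
    and g: "g \<in> borel_measurable graph_space"
  shows "(\<integral>\<^sup>+\<mu>. of_bool (component_verts v \<mu> = W) * g (component v \<mu>) \<partial>random_edges_law \<phi> (W \<union> V))
    = (\<integral>\<^sup>+\<mu>. of_bool (component_verts v \<mu> = W) * g (component v \<mu>) \<partial>random_edges_law \<phi> W)
      * ennreal (expneg (\<integral>\<^sup>+y. (\<Sum>x\<in>W. neglog (\<phi> y x)) \<partial>count_space V))"
proof -
  define I where "I = vertex_pairs (W \<union> V)"
  define I1 where "I1 = vertex_pairs W"
  define I2 where "I2 = (\<lambda>(y, x). {x, y}) ` (V \<times> W)"
  have I: "I1 \<inter> I2 = {}" "I1 \<subseteq> I" "I2 \<subseteq> I"
    using V(2) by (auto simp: I_def I1_def I2_def vertex_pairs_def card_insert_if)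
  have cI2: "countable I2" unfolding I2_def
    using locally_finite_set_countable[OF V(1)] W(1) by (intro countable_image countable_SIGMA) (auto intro: countable_finite)
  interpret E2: prob_space "edge_measure I2" by (rule prob_space_edge_measure)
  have lfW: "locally_finite_set W" using W(1) by (rule locally_finite_set_finite)
  have lfWV: "locally_finite_set (W \<union> V)" by (rule locally_finite_set_Un[OF lfW V(1)])
  have gr: "edge_graph W \<in> measurable (edge_measure I1) graph_space"
    unfolding I1_def by (rule measurable_edge_graph[OF lfW])
  have gm: "(\<lambda>\<mu>. of_bool (component_verts v \<mu> = W) * g (component v \<mu>)) \<in> borel_measurable graph_space"
    by (intro borel_measurable_times_ennreal measurable_of_bool_ennreal pred_component_verts_eq W(1)
      measurable_compose[OF measurable_component g])
  define G where "G b1 = of_bool (component_verts v (edge_graph W b1) = W) * g (component v (edge_graph W b1))" for b1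
  have G: "G \<in> borel_measurable (edge_measure I1)"
    unfolding G_def[abs_def] by (rule measurable_compose[OF gr gm])
  define Z where "Z = {b2 \<in> space (edge_measure I2). \<forall>e\<in>I2. \<not> b2 e}"
  have Z: "Z \<in> sets (edge_measure I2)"
  proof -
    have "{b \<in> space (edge_measure I2). b e} \<in> sets (edge_measure I2)" if "e \<in> I2" for e
      using measurable_edge_coordinate[OF that] unfolding pred_def .
    then have "space (edge_measure I2) - (\<Union>e\<in>I2. {b \<in> space (edge_measure I2). b e}) \<in> sets (edge_measure I2)"
      using cI2 by (intro sets.Diff sets.top sets.countable_UN') auto
    also have "space (edge_measure I2) - (\<Union>e\<in>I2. {b \<in> space (edge_measure I2). b e}) = Z" by (auto simp: Z_def)
    finally show ?thesis .
  qed
  define H where "H p = G (fst p) * indicator Z (snd p)" for p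
  have H: "H \<in> borel_measurable (edge_measure I1 \<Otimes>\<^sub>M edge_measure I2)"
    unfolding H_def[abs_def]
    by (intro borel_measurable_times_ennreal measurable_compose[OF measurable_fst G]
      measurable_compose[OF measurable_snd borel_measurable_indicator[OF Z]])
  have "(\<integral>\<^sup>+\<mu>. of_bool (component_verts v \<mu> = W) * g (component v \<mu>) \<partial>random_edges_law \<phi> (W \<union> V))
     = (\<integral>\<^sup>+b. of_bool (component_verts v (edge_graph (W \<union> V) b) = W) * g (component v (edge_graph (W \<union> V) b)) \<partial>edge_measure I)"
    unfolding I_def by (rule nn_integral_random_edges_law[OF lfWV gm])
  also have "\<dots> = (\<integral>\<^sup>+b. H (restrict b I1, restrict b I2) \<partial>edge_measure I)"
  proof (rule nn_integral_cong)
    fix b assume "b \<in> space (edge_measure I)"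
    have "restrict b I2 \<in> Z \<longleftrightarrow> (\<forall>x\<in>W. \<forall>y\<in>V. \<not> b {x, y})"
      by (auto simp: Z_def I2_def space_edge_measure)
    moreover have "edge_graph W (restrict b I1) = edge_graph W b" by (simp add: edge_graph_restrict I1_def)
    ultimately show "of_bool (component_verts v (edge_graph (W \<union> V) b) = W) * g (component v (edge_graph (W \<union> V) b))
        = H (restrict b I1, restrict b I2)"
      using component_verts_eq_iff_cut[OF W(2) V(2), of b] component_edge_graph_cut[of v W V b]
      by (auto simp: H_def G_def indicator_def)
  qed
  also have "\<dots> = (\<integral>\<^sup>+b1. \<integral>\<^sup>+b2. H (b1, b2) \<partial>edge_measure I2 \<partial>edge_measure I1)"
    by (rule nn_integral_edge_measure_split[OF I H])
  also have "\<dots> = (\<integral>\<^sup>+b1. G b1 * emeasure (edge_measure I2) Z \<partial>edge_measure I1)"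
    by (simp only: H_def fst_conv snd_conv nn_integral_cmult_indicator[OF Z])
  also have "\<dots> = (\<integral>\<^sup>+b1. G b1 \<partial>edge_measure I1) * emeasure (edge_measure I2) Z"
    by (rule nn_integral_multc[OF G])
  also have "(\<integral>\<^sup>+b1. G b1 \<partial>edge_measure I1)
      = (\<integral>\<^sup>+\<mu>. of_bool (component_verts v \<mu> = W) * g (component v \<mu>) \<partial>random_edges_law \<phi> W)"
    unfolding nn_integral_random_edges_law[OF lfW gm] I1_def G_def ..
  also have "emeasure (edge_measure I2) Z = ennreal (unit_prod (\<lambda>e. 1 - pair_prob \<phi> e) I2)"
    unfolding Z_def using I(3) by (intro emeasure_edges_void cI2) (auto simp: I_def)
  also have "unit_prod (\<lambda>e. 1 - pair_prob \<phi> e) I2 = expneg (\<integral>\<^sup>+e. neglog (pair_prob \<phi> e) \<partial>count_space I2)"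
    using I(3) by (intro unit_prod_eq_expneg cI2 pair_prob_bounds) (auto simp: I_def)
  also have "(\<integral>\<^sup>+e. neglog (pair_prob \<phi> e) \<partial>count_space I2)
      = (\<integral>\<^sup>+p. neglog (pair_prob \<phi> (case p of (y, x) \<Rightarrow> {x, y})) \<partial>count_space (V \<times> W))"
  proof (rule nn_integral_bij_count_space[symmetric])
    show "bij_betw (\<lambda>(y, x). {x, y}) (V \<times> W) I2"
      unfolding I2_def bij_betw_def inj_on_def using V(2) by (auto simp: doubleton_eq_iff)
  qed
  also have "\<dots> = (\<integral>\<^sup>+y. \<integral>\<^sup>+x. neglog (\<phi> y x) \<partial>count_space W \<partial>count_space V)"
    unfolding nn_integral_count_space_Times by (simp only: prod.case pair_prob_swap)
  also have "\<dots> = (\<integral>\<^sup>+y. (\<Sum>x\<in>W. neglog (\<phi> y x)) \<partial>count_space V)"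
    using W(1) by (simp add: nn_integral_count_space_finite)
  finally show ?thesis .
qed

end


section \<open>The Mecke equation\<close>

lemma ennreal_eq_suminf_of_bool:
  fixes h :: "ennreal \<Rightarrow> ennreal"
  assumes "N = of_nat k"
  shows "h N = (\<Sum>j. h (of_nat j) * of_bool (N = of_nat j))"
proof -
  have "(\<Sum>j. h (of_nat j) * of_bool (N = of_nat j)) = (\<Sum>j\<in>{k}. h (of_nat j) * of_bool (N = of_nat j))"
    using assms by (intro suminf_finite) auto
  then show ?thesis using assms by simp
qed

text \<open>The generating function of the Poisson distribution.\<close>

lemma poisson_weights_suminf:
  fixes l :: real
  assumes l: "0 \<le> l" and q: "0 \<le> q"
  shows "(\<Sum>k. ennreal (q ^ k) * ennreal (l ^ k / fact k * exp (- l))) = ennreal (exp (- (1 - q) * l))"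
proof -
  have "(\<lambda>k. (q * l) ^ k /\<^sub>R fact k) sums exp (q * l)" by (rule exp_converges)
  then have "(\<lambda>k. (q * l) ^ k /\<^sub>R fact k * exp (- l)) sums (exp (q * l) * exp (- l))" by (rule sums_mult2)
  moreover have "exp (q * l) * exp (- l) = exp (- (1 - q) * l)"
    by (simp add: exp_add[symmetric] algebra_simps)
  moreover have "(q * l) ^ k /\<^sub>R fact k * exp (- l) = q ^ k * (l ^ k / fact k * exp (- l))" for k
    by (simp add: power_mult_distrib field_simps)
  ultimately have s: "(\<lambda>k. q ^ k * (l ^ k / fact k * exp (- l))) sums exp (- (1 - q) * l)" by simp
  have "(\<Sum>k. ennreal (q ^ k * (l ^ k / fact k * exp (- l)))) = ennreal (exp (- (1 - q) * l))"
    using s l q by (subst suminf_ennreal2) (auto simp: sums_iff)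
  moreover have "ennreal (q ^ k) * ennreal (l ^ k / fact k * exp (- l))
      = ennreal (q ^ k * (l ^ k / fact k * exp (- l)))" for k
    using l q by (intro ennreal_mult[symmetric]) simp_all
  ultimately show ?thesis by (simp only:)
qed

lemma poisson_mean_suminf:
  fixes l :: real
  assumes l: "0 \<le> l"
  shows "(\<Sum>k. of_nat k * ennreal (l ^ k / fact k * exp (- l))) = ennreal l"
proof -
  have "(\<lambda>k. l ^ k /\<^sub>R fact k) sums exp l" by (rule exp_converges)
  then have "(\<lambda>k. l ^ k /\<^sub>R fact k * (l * exp (- l))) sums (exp l * (l * exp (- l)))" by (rule sums_mult2)
  moreover have "exp l * (l * exp (- l)) = l" by (simp add: exp_minus)
  moreover have "l ^ k /\<^sub>R fact k * (l * exp (- l)) = real (Suc k) * (l ^ Suc k / fact (Suc k) * exp (- l))" for k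
    by (simp add: field_simps del: of_nat_Suc)
  ultimately have "(\<lambda>k. real (Suc k) * (l ^ Suc k / fact (Suc k) * exp (- l))) sums l" by simp
  then have s: "(\<lambda>k. real k * (l ^ k / fact k * exp (- l))) sums l"
    by (subst (asm) sums_Suc_iff) simp
  have "(\<Sum>k. ennreal (real k * (l ^ k / fact k * exp (- l)))) = ennreal l"
    using s l by (subst suminf_ennreal2) (auto simp: sums_iff)
  moreover have "of_nat k * ennreal (l ^ k / fact k * exp (- l)) = ennreal (real k * (l ^ k / fact k * exp (- l)))" for k
    unfolding ennreal_of_nat_eq_real_of_nat using l by (intro ennreal_mult[symmetric]) simp_all
  ultimately show ?thesis by (simp only:)
qed

locale poisson_driven = prob_space M for M :: "'w measure" +
  fixes \<eta> :: "'w \<Rightarrow> 'a::polish_space set" and \<Lambda> :: "'a measure"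
  assumes poisson: "poisson_process M \<eta> \<Lambda>"
    and sets_intensity: "sets \<Lambda> = sets borel"
    and intensity_bounded: "\<And>B. B \<in> sets borel \<Longrightarrow> bounded B \<Longrightarrow> emeasure \<Lambda> B < \<infinity>"
    and intensity_diffuse: "\<And>x. emeasure \<Lambda> {x} = 0"
begin

lemma measurable_points: "\<eta> \<in> measurable M point_space"
  using poisson by (simp add: poisson_process_def)

lemma points_lf: "\<omega> \<in> space M \<Longrightarrow> locally_finite_set (\<eta> \<omega>)"
  by (rule measurable_point_lf[OF measurable_points])

lemma measurable_intensity_iff: "measurable \<Lambda> N = measurable borel N"
  by (rule measurable_cong_sets[OF sets_intensity refl])

lemma indep_counts:
  fixes n :: nat
  assumes "B ` {..<n} \<subseteq> sets borel" "disjoint_family_on B {..<n}"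
  shows "indep_vars (\<lambda>_. borel) (\<lambda>i \<omega>. npoints (\<eta> \<omega> \<inter> B i)) {..<n}"
  using poisson assms unfolding poisson_process_def by blast

lemma prob_count:
  assumes "B \<in> sets borel" "emeasure \<Lambda> B < \<infinity>"
  shows "prob {\<omega> \<in> space M. npoints (\<eta> \<omega> \<inter> B) = of_nat k} = measure \<Lambda> B ^ k / fact k * exp (- measure \<Lambda> B)"
  using poisson assms by (simp add: poisson_process_def)

lemma nn_integral_count:
  fixes h :: "ennreal \<Rightarrow> ennreal"
  assumes B: "B \<in> sets borel" "bounded B"
  shows "(\<integral>\<^sup>+\<omega>. h (npoints (\<eta> \<omega> \<inter> B)) \<partial>M)
    = (\<Sum>k. h (of_nat k) * ennreal (measure \<Lambda> B ^ k / fact k * exp (- measure \<Lambda> B)))"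
proof -
  note N = measurable_npoints[OF measurable_points B(1)]
  have S: "{\<omega> \<in> space M. npoints (\<eta> \<omega> \<inter> B) = of_nat k} \<in> sets M" for k
    using N by measurable
  have "(\<integral>\<^sup>+\<omega>. h (npoints (\<eta> \<omega> \<inter> B)) \<partial>M)
      = (\<integral>\<^sup>+\<omega>. (\<Sum>k. h (of_nat k) * indicator {\<omega> \<in> space M. npoints (\<eta> \<omega> \<inter> B) = of_nat k} \<omega>) \<partial>M)"
  proof (rule nn_integral_cong)
    fix \<omega> assume \<omega>: "\<omega> \<in> space M"
    have "finite (\<eta> \<omega> \<inter> B)" using points_lf[OF \<omega>] B(2) by (auto simp: locally_finite_set_def)
    then have "npoints (\<eta> \<omega> \<inter> B) = of_nat (card (\<eta> \<omega> \<inter> B))" by (simp add: emeasure_count_space_finite)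
    from ennreal_eq_suminf_of_bool[OF this, of h] \<omega>
    show "h (npoints (\<eta> \<omega> \<inter> B)) = (\<Sum>k. h (of_nat k) * indicator {\<omega> \<in> space M. npoints (\<eta> \<omega> \<inter> B) = of_nat k} \<omega>)"
      by (simp add: indicator_def)
  qed
  also have "\<dots> = (\<Sum>k. \<integral>\<^sup>+\<omega>. h (of_nat k) * indicator {\<omega> \<in> space M. npoints (\<eta> \<omega> \<inter> B) = of_nat k} \<omega> \<partial>M)"
    by (rule nn_integral_suminf) (intro borel_measurable_times_ennreal borel_measurable_const borel_measurable_indicator S)
  also have "\<dots> = (\<Sum>k. h (of_nat k) * ennreal (measure \<Lambda> B ^ k / fact k * exp (- measure \<Lambda> B)))"
    using S by (simp only: nn_integral_cmult_indicator emeasure_eq_measure prob_count[OF B(1) intensity_bounded[OF B]])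
  finally show ?thesis .
qed

lemma prob_void:
  assumes B: "B \<in> sets borel" "bounded B"
  shows "prob {\<omega> \<in> space M. \<eta> \<omega> \<inter> B = {}} = exp (- measure \<Lambda> B)"
proof -
  have "{\<omega> \<in> space M. \<eta> \<omega> \<inter> B = {}} = {\<omega> \<in> space M. npoints (\<eta> \<omega> \<inter> B) = of_nat 0}"
    by (simp add: emeasure_count_space_eq_0)
  then show ?thesis using prob_count[OF B(1) intensity_bounded[OF B], of 0] by (simp only: power_0 fact_0)
qed

lemma SUP_npoints_cball:
  "(SUP n. npoints (V \<inter> (B \<inter> cball undefined (real n)))) = npoints (V \<inter> B)"
proof -
  have "(SUP n. npoints (V \<inter> (B \<inter> cball undefined (real n)))) = npoints (\<Union>n. V \<inter> (B \<inter> cball undefined (real n)))"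
    by (rule SUP_emeasure_incseq) (auto simp: incseq_def)
  also have "(\<Union>n. V \<inter> (B \<inter> cball undefined (real n))) = V \<inter> B"
    by (simp add: UN_cball_real flip: Int_UN_distrib Int_assoc)
  finally show ?thesis .
qed

lemma mean_count:
  assumes B: "B \<in> sets borel"
  shows "(\<integral>\<^sup>+\<omega>. npoints (\<eta> \<omega> \<inter> B) \<partial>M) = emeasure \<Lambda> B"
proof -
  define C where "C n = B \<inter> cball undefined (real n)" for n
  have C: "C n \<in> sets borel" "bounded (C n)" for n
    using B by (auto simp: C_def intro: bounded_subset[OF bounded_cball])
  have "(\<integral>\<^sup>+\<omega>. npoints (\<eta> \<omega> \<inter> B) \<partial>M) = (\<integral>\<^sup>+\<omega>. (SUP n. npoints (\<eta> \<omega> \<inter> C n)) \<partial>M)"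
    by (simp only: C_def SUP_npoints_cball)
  also have "\<dots> = (SUP n. \<integral>\<^sup>+\<omega>. npoints (\<eta> \<omega> \<inter> C n) \<partial>M)"
  proof (rule nn_integral_monotone_convergence_SUP)
    show "incseq (\<lambda>n \<omega>. npoints (\<eta> \<omega> \<inter> C n))"
      by (intro incseq_SucI le_funI emeasure_mono) (auto simp: C_def)
  qed (rule measurable_npoints[OF measurable_points C(1)])
  also have "\<dots> = (SUP n. emeasure \<Lambda> (C n))"
  proof -
    have "(\<integral>\<^sup>+\<omega>. npoints (\<eta> \<omega> \<inter> C n) \<partial>M) = emeasure \<Lambda> (C n)" for n
      unfolding nn_integral_count[OF C, of "\<lambda>x. x"] poisson_mean_suminf[OF measure_nonneg]
      using intensity_bounded[OF C] by (intro emeasure_eq_ennreal_measure[symmetric]) (simp add: less_top)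
    then show ?thesis by simp
  qed
  also have "\<dots> = emeasure \<Lambda> (\<Union>n. C n)"
    by (rule SUP_emeasure_incseq) (use C in \<open>auto simp: incseq_def C_def sets_intensity\<close>)
  also have "(\<Union>n. C n) = B" by (simp add: C_def UN_cball_real flip: Int_UN_distrib)
  finally show ?thesis .
qed

lemma AE_notin_points: "AE \<omega> in M. x \<notin> \<eta> \<omega>"
proof -
  have "(\<integral>\<^sup>+\<omega>. npoints (\<eta> \<omega> \<inter> {x}) \<partial>M) = 0" using mean_count[of "{x}"] intensity_diffuse by simp
  then have "AE \<omega> in M. npoints (\<eta> \<omega> \<inter> {x}) = 0"
    using measurable_npoints[OF measurable_points, of "{x}"] by (subst (asm) nn_integral_0_iff_AE) auto
  then show ?thesis by eventually_elim (auto simp: emeasure_count_space_eq_0)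
qed

lemma AE_disjoint_points:
  assumes "finite W"
  shows "AE \<omega> in M. W \<inter> \<eta> \<omega> = {}"
proof -
  have "AE \<omega> in M. \<forall>x\<in>W. x \<notin> \<eta> \<omega>" using assms AE_notin_points by (intro AE_finite_allI)
  then show ?thesis by eventually_elim auto
qed

text \<open>On the void event all points in \<open>A\<close> lie in \<open>A - B\<close>, and the counts of \<open>A - B\<close> and \<open>B\<close> are
  independent.\<close>

lemma mean_count_void:
  assumes A: "A \<in> sets borel" and B: "B \<in> sets borel" "bounded B"
  shows "(\<integral>\<^sup>+\<omega>. npoints (\<eta> \<omega> \<inter> A) * of_bool (\<eta> \<omega> \<inter> B = {}) \<partial>M)
    = emeasure \<Lambda> (A - B) * ennreal (exp (- measure \<Lambda> B))"
proof -
  define D where "D i = (if i = 0 then A - B else B)" for i :: nat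
  have "indep_vars (\<lambda>_. borel) (\<lambda>i \<omega>. npoints (\<eta> \<omega> \<inter> D i)) {..<2}"
    by (rule indep_counts) (use A B in \<open>auto simp: D_def disjoint_family_on_def\<close>)
  from indep_vars_compose2[OF this, of "\<lambda>i N. if i = 0 then N else of_bool (N = 0)" "\<lambda>_. borel"]
  have ind: "indep_vars (\<lambda>_. borel) (\<lambda>i \<omega>. if i = 0 then npoints (\<eta> \<omega> \<inter> D i) else of_bool (npoints (\<eta> \<omega> \<inter> D i) = 0) :: ennreal) {..<2}"
    by simp
  have two: "{..<2::nat} = {0, 1}" by auto
  have "(\<integral>\<^sup>+\<omega>. npoints (\<eta> \<omega> \<inter> A) * of_bool (\<eta> \<omega> \<inter> B = {}) \<partial>M)
      = (\<integral>\<^sup>+\<omega>. npoints (\<eta> \<omega> \<inter> (A - B)) * of_bool (npoints (\<eta> \<omega> \<inter> B) = 0) \<partial>M)"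
  proof (rule nn_integral_cong)
    fix \<omega>
    show "npoints (\<eta> \<omega> \<inter> A) * of_bool (\<eta> \<omega> \<inter> B = {}) = npoints (\<eta> \<omega> \<inter> (A - B)) * of_bool (npoints (\<eta> \<omega> \<inter> B) = 0)"
    proof (cases "\<eta> \<omega> \<inter> B = {}")
      case True
      then have "\<eta> \<omega> \<inter> (A - B) = \<eta> \<omega> \<inter> A" by auto
      then show ?thesis using True by simp
    qed (simp add: emeasure_count_space_eq_0)
  qed
  also have "\<dots> = (\<integral>\<^sup>+\<omega>. (\<Prod>i\<in>{..<2}. if i = 0 then npoints (\<eta> \<omega> \<inter> D i) else of_bool (npoints (\<eta> \<omega> \<inter> D i) = 0)) \<partial>M)"
    unfolding two by (simp add: D_def)
  also have "\<dots> = (\<Prod>i\<in>{..<2}. \<integral>\<^sup>+\<omega>. (if i = 0 then npoints (\<eta> \<omega> \<inter> D i) else of_bool (npoints (\<eta> \<omega> \<inter> D i) = 0)) \<partial>M)"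
    by (rule indep_vars_nn_integral[OF _ ind]) auto
  also have "\<dots> = (\<integral>\<^sup>+\<omega>. npoints (\<eta> \<omega> \<inter> (A - B)) \<partial>M) * (\<integral>\<^sup>+\<omega>. of_bool (npoints (\<eta> \<omega> \<inter> B) = 0) \<partial>M)"
    unfolding two by (simp add: D_def)
  also have "(\<integral>\<^sup>+\<omega>. npoints (\<eta> \<omega> \<inter> (A - B)) \<partial>M) = emeasure \<Lambda> (A - B)"
    using A B by (intro mean_count) auto
  also have "(\<integral>\<^sup>+\<omega>. of_bool (npoints (\<eta> \<omega> \<inter> B) = 0) \<partial>M) = (\<integral>\<^sup>+\<omega>. indicator {\<omega> \<in> space M. \<eta> \<omega> \<inter> B = {}} \<omega> \<partial>M)"
    by (intro nn_integral_cong) (auto simp: emeasure_count_space_eq_0)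
  also have "\<dots> = emeasure M {\<omega> \<in> space M. \<eta> \<omega> \<inter> B = {}}"
    by (rule nn_integral_indicator[OF measurable_void[OF measurable_points B(1)]])
  also have "\<dots> = ennreal (exp (- measure \<Lambda> B))"
    by (simp only: emeasure_eq_measure prob_void[OF B])
  finally show ?thesis .
qed

text \<open>Both sides are integrals with respect to measures on pairs of a point and a point set, finite on bounded
  windows, so it suffices to compare them on products of a Borel set \<open>a\<close> and a void event of \<open>B\<close>. On such a
  product the right-hand side requires \<open>x\<close> to lie in \<open>a - B\<close> and \<open>\<eta>\<close> to avoid \<open>B\<close>, and the left-hand side is
  computed in \<open>mean_count_void\<close>.\<close>

theorem mecke:
  assumes h: "h \<in> borel_measurable (borel \<Otimes>\<^sub>M point_space)"
  shows "(\<integral>\<^sup>+\<omega>. \<integral>\<^sup>+x. h (x, \<eta> \<omega>) \<partial>count_space (\<eta> \<omega>) \<partial>M) = (\<integral>\<^sup>+x. \<integral>\<^sup>+\<omega>. h (x, insert x (\<eta> \<omega>)) \<partial>M \<partial>\<Lambda>)"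
proof -
  let ?S = "borel \<Otimes>\<^sub>M (point_space :: 'a set measure)"
  define N1 where "N1 \<omega> = distr (count_space (\<eta> \<omega>)) ?S (\<lambda>x. (x, \<eta> \<omega>))" for \<omega>
  define N2 where "N2 x = distr M ?S (\<lambda>\<omega>. (x, insert x (\<eta> \<omega>)))" for x
  have m1: "(\<lambda>x. (x, \<eta> \<omega>)) \<in> measurable (count_space (\<eta> \<omega>)) ?S" if "\<omega> \<in> space M" for \<omega>
    using points_lf[OF that] by (auto simp: space_pair_measure space_point_space)
  have m2: "(\<lambda>\<omega>. (x, insert x (\<eta> \<omega>))) \<in> measurable M ?S" for x
    by (intro measurable_Pair measurable_const measurable_insert_point measurable_points) simp_all
  have i1: "(\<integral>\<^sup>+p. g p \<partial>N1 \<omega>) = (\<integral>\<^sup>+x. g (x, \<eta> \<omega>) \<partial>count_space (\<eta> \<omega>))"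
    if "\<omega> \<in> space M" "g \<in> borel_measurable ?S" for g \<omega>
    unfolding N1_def by (rule nn_integral_distr[OF m1[OF that(1)]]) (simp add: that(2))
  have i2: "(\<integral>\<^sup>+p. g p \<partial>N2 x) = (\<integral>\<^sup>+\<omega>. g (x, insert x (\<eta> \<omega>)) \<partial>M)"
    if "g \<in> borel_measurable ?S" for g x
    unfolding N2_def by (rule nn_integral_distr[OF m2]) (simp add: that)
  have e1: "emeasure (N1 \<omega>) A = (\<integral>\<^sup>+x. indicator A (x, \<eta> \<omega>) \<partial>count_space (\<eta> \<omega>))"
    if "\<omega> \<in> space M" "A \<in> sets ?S" for A \<omega>
  proof -
    have "A \<in> sets (N1 \<omega>)" using that by (simp add: N1_def)
    from nn_integral_indicator[OF this] i1[OF that(1) borel_measurable_indicator[OF that(2)]] show ?thesis by simp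
  qed
  have e2: "emeasure (N2 x) A = (\<integral>\<^sup>+\<omega>. indicator A (x, insert x (\<eta> \<omega>)) \<partial>M)" if "A \<in> sets ?S" for A x
  proof -
    have "A \<in> sets (N2 x)" using that by (simp add: N2_def)
    from nn_integral_indicator[OF this] i2[OF borel_measurable_indicator[OF that]] show ?thesis by simp
  qed
  have s1: "sets (N1 \<omega>) = sets ?S" and s2: "sets (N2 x) = sets ?S" for \<omega> x
    by (simp_all add: N1_def N2_def)
  have k1: "(\<lambda>\<omega>. emeasure (N1 \<omega>) A) \<in> borel_measurable M" if A: "A \<in> sets ?S" for A
  proof -
    have "(\<lambda>p. indicator A (snd p, \<eta> (fst p)) :: ennreal) \<in> borel_measurable (M \<Otimes>\<^sub>M borel)"
      by (intro measurable_compose[OF _ borel_measurable_indicator[OF A]] measurable_Pair measurable_snd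
        measurable_compose[OF measurable_fst measurable_points])
    from point_sum_measurable[OF measurable_points this] show ?thesis
      by (rule measurable_cong[THEN iffD1, rotated]) (simp add: e1 A)
  qed
  have k2: "(\<lambda>x. emeasure (N2 x) A) \<in> borel_measurable \<Lambda>" if A: "A \<in> sets ?S" for A
  proof -
    have "(\<lambda>p. indicator A (fst p, insert (fst p) (\<eta> (snd p))) :: ennreal) \<in> borel_measurable (\<Lambda> \<Otimes>\<^sub>M M)"
    proof (intro measurable_compose[OF _ borel_measurable_indicator[OF A]] measurable_Pair measurable_insert_point
        measurable_compose[OF measurable_snd measurable_points])
      show "fst \<in> measurable (\<Lambda> \<Otimes>\<^sub>M M) borel"
        using measurable_fst[of \<Lambda> M] measurable_cong_sets[OF refl sets_intensity] by blast
      then show "fst \<in> measurable (\<Lambda> \<Otimes>\<^sub>M M) borel" .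
    qed
    from borel_measurable_nn_integral_fst[OF this] show ?thesis by (simp only: e2[OF A] fst_conv snd_conv)
  qed
  let ?E = "{a \<times> b |a b. a \<in> sets (borel :: 'a measure) \<and> b \<in> (void_events :: 'a set set set)}"
  let ?\<Omega> = "UNIV \<times> {V :: 'a set. locally_finite_set V}"
  have l: "emeasure (mix M ?S N1) (a \<times> b) = emeasure \<Lambda> (a - B) * ennreal (exp (- measure \<Lambda> B))"
    and r: "emeasure (mix \<Lambda> ?S N2) (a \<times> b) = emeasure \<Lambda> (a - B) * ennreal (exp (- measure \<Lambda> B))"
    if a: "a \<in> sets borel" and B: "B \<in> sets borel" "bounded B" and b: "b = {V. locally_finite_set V \<and> V \<inter> B = {}}" for a b B
  proof -
    have "b \<in> void_events" using B b by (auto simp: void_events_def)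
    then have ab: "a \<times> b \<in> sets ?S"
      using a by (intro pair_measureI) (auto simp: sets_point_space_void)
    have "emeasure (mix M ?S N1) (a \<times> b) = (\<integral>\<^sup>+\<omega>. emeasure (N1 \<omega>) (a \<times> b) \<partial>M)"
      by (rule emeasure_mix[OF s1 k1 ab])
    also have "\<dots> = (\<integral>\<^sup>+\<omega>. npoints (\<eta> \<omega> \<inter> a) * of_bool (\<eta> \<omega> \<inter> B = {}) \<partial>M)"
    proof (rule nn_integral_cong)
      fix \<omega> assume \<omega>: "\<omega> \<in> space M"
      have "emeasure (N1 \<omega>) (a \<times> b) = (\<integral>\<^sup>+x. indicator a x * of_bool (\<eta> \<omega> \<inter> B = {}) \<partial>count_space (\<eta> \<omega>))"
        unfolding e1[OF \<omega> ab] using points_lf[OF \<omega>] by (intro nn_integral_cong) (auto simp: b indicator_def)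
      also have "\<dots> = npoints (\<eta> \<omega> \<inter> a) * of_bool (\<eta> \<omega> \<inter> B = {})"
        unfolding npoints_eq_nn_integral by (rule nn_integral_multc) simp
      finally show "emeasure (N1 \<omega>) (a \<times> b) = npoints (\<eta> \<omega> \<inter> a) * of_bool (\<eta> \<omega> \<inter> B = {})" .
    qed
    also have "\<dots> = emeasure \<Lambda> (a - B) * ennreal (exp (- measure \<Lambda> B))" by (rule mean_count_void[OF a B])
    finally show "emeasure (mix M ?S N1) (a \<times> b) = emeasure \<Lambda> (a - B) * ennreal (exp (- measure \<Lambda> B))" .
    have void: "{\<omega> \<in> space M. \<eta> \<omega> \<inter> B = {}} \<in> sets M" by (rule measurable_void[OF measurable_points B(1)])
    have "emeasure (mix \<Lambda> ?S N2) (a \<times> b) = (\<integral>\<^sup>+x. emeasure (N2 x) (a \<times> b) \<partial>\<Lambda>)"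
      by (rule emeasure_mix[OF s2 k2 ab])
    also have "\<dots> = (\<integral>\<^sup>+x. ennreal (exp (- measure \<Lambda> B)) * indicator (a - B) x \<partial>\<Lambda>)"
    proof (rule nn_integral_cong)
      fix x
      have "emeasure (N2 x) (a \<times> b) = (\<integral>\<^sup>+\<omega>. indicator (a - B) x * indicator {\<omega> \<in> space M. \<eta> \<omega> \<inter> B = {}} \<omega> \<partial>M)"
        unfolding e2[OF ab] using points_lf by (intro nn_integral_cong) (auto simp: b indicator_def)
      also have "\<dots> = indicator (a - B) x * emeasure M {\<omega> \<in> space M. \<eta> \<omega> \<inter> B = {}}"
        by (rule nn_integral_cmult_indicator[OF void])
      also have "\<dots> = ennreal (exp (- measure \<Lambda> B)) * indicator (a - B) x"
        by (simp only: emeasure_eq_measure prob_void[OF B] mult.commute)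
      finally show "emeasure (N2 x) (a \<times> b) = ennreal (exp (- measure \<Lambda> B)) * indicator (a - B) x" .
    qed
    also have "\<dots> = ennreal (exp (- measure \<Lambda> B)) * emeasure \<Lambda> (a - B)"
      using a B by (intro nn_integral_cmult_indicator) (auto simp: sets_intensity)
    finally show "emeasure (mix \<Lambda> ?S N2) (a \<times> b) = emeasure \<Lambda> (a - B) * ennreal (exp (- measure \<Lambda> B))"
      by (simp only: mult.commute)
  qed
  have mix_eq: "mix M ?S N1 = mix \<Lambda> ?S N2"
  proof (rule measure_eqI_generator_eq[OF Int_stable_borel_void])
    show "?E \<subseteq> Pow ?\<Omega>" using void_events_bounds(1) by blast
    show "sets (mix M ?S N1) = sigma_sets ?\<Omega> ?E" "sets (mix \<Lambda> ?S N2) = sigma_sets ?\<Omega> ?E"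
      by (simp_all only: sets_mix sets_borel_point_space)
    show "emeasure (mix M ?S N1) X = emeasure (mix \<Lambda> ?S N2) X" if "X \<in> ?E" for X
    proof -
      obtain a B where "X = a \<times> {V. locally_finite_set V \<and> V \<inter> B = {}}" "a \<in> sets borel" "B \<in> sets borel" "bounded B"
        using \<open>X \<in> ?E\<close> unfolding void_events_def by blast
      then show ?thesis using l r by simp
    qed
    show "range (\<lambda>n. cball undefined (real n) \<times> {V :: 'a set. locally_finite_set V}) \<subseteq> ?E"
    proof (rule image_subsetI)
      fix n :: nat
      show "cball undefined (real n) \<times> {V :: 'a set. locally_finite_set V} \<in> ?E"
        using void_events_bounds(2)
        by (intro CollectI exI[of _ "cball undefined (real n)"] exI[of _ "{V. locally_finite_set V}"] conjI refl) simp_all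
    qed
    show "(\<Union>n. cball undefined (real n) \<times> {V :: 'a set. locally_finite_set V}) = ?\<Omega>"
    proof -
      have "(\<Union>n. cball undefined (real n) \<times> {V :: 'a set. locally_finite_set V}) =
          (\<Union>n. cball undefined (real n)) \<times> {V. locally_finite_set V}" by blast
      then show ?thesis by (simp only: UN_cball_real)
    qed
    show "emeasure (mix M ?S N1) (cball undefined (real n) \<times> {V. locally_finite_set V}) \<noteq> \<infinity>" for n
      using l[of "cball undefined (real n)" "{}" "{V. locally_finite_set V}"] intensity_bounded[of "cball undefined (real n)"]
      by (simp add: less_top)
  qed
  have "(\<integral>\<^sup>+\<omega>. \<integral>\<^sup>+x. h (x, \<eta> \<omega>) \<partial>count_space (\<eta> \<omega>) \<partial>M) = (\<integral>\<^sup>+\<omega>. \<integral>\<^sup>+p. h p \<partial>N1 \<omega> \<partial>M)"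
    by (intro nn_integral_cong) (simp add: i1 h)
  also have "\<dots> = (\<integral>\<^sup>+p. h p \<partial>mix M ?S N1)" by (rule nn_integral_mix(1)[OF s1 k1 h, symmetric])
  also have "\<dots> = (\<integral>\<^sup>+x. \<integral>\<^sup>+p. h p \<partial>N2 x \<partial>\<Lambda>)"
    unfolding mix_eq by (rule nn_integral_mix(1)[OF s2 k2 h])
  also have "\<dots> = (\<integral>\<^sup>+x. \<integral>\<^sup>+\<omega>. h (x, insert x (\<eta> \<omega>)) \<partial>M \<partial>\<Lambda>)" by (simp only: i2[OF h])
  finally show ?thesis .
qed

text \<open>As the intensity is diffuse, a given point almost surely does not belong to the process.\<close>

corollary mecke_reduced:
  assumes h: "h \<in> borel_measurable (borel \<Otimes>\<^sub>M point_space)"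
  shows "(\<integral>\<^sup>+\<omega>. \<integral>\<^sup>+x. h (x, \<eta> \<omega> - {x}) \<partial>count_space (\<eta> \<omega>) \<partial>M) = (\<integral>\<^sup>+x. \<integral>\<^sup>+\<omega>. h (x, \<eta> \<omega>) \<partial>M \<partial>\<Lambda>)"
proof -
  have "(\<lambda>p :: 'a \<times> 'a set. (fst p, snd p - {fst p})) \<in> measurable (borel \<Otimes>\<^sub>M point_space) (borel \<Otimes>\<^sub>M point_space)"
    by (intro measurable_Pair measurable_fst measurable_delete_point measurable_snd)
  from mecke[OF measurable_compose[OF this h]]
  have "(\<integral>\<^sup>+\<omega>. \<integral>\<^sup>+x. h (x, \<eta> \<omega> - {x}) \<partial>count_space (\<eta> \<omega>) \<partial>M)
      = (\<integral>\<^sup>+x. \<integral>\<^sup>+\<omega>. h (x, insert x (\<eta> \<omega>) - {x}) \<partial>M \<partial>\<Lambda>)" by (simp only: fst_conv snd_conv)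
  also have "\<dots> = (\<integral>\<^sup>+x. \<integral>\<^sup>+\<omega>. h (x, \<eta> \<omega>) \<partial>M \<partial>\<Lambda>)"
  proof (rule nn_integral_cong, rule nn_integral_cong_AE)
    fix x
    show "AE \<omega> in M. h (x, insert x (\<eta> \<omega>) - {x}) = h (x, \<eta> \<omega>)"
      using AE_notin_points[of x] by eventually_elim simp
  qed
  finally show ?thesis .
qed

section \<open>The Laplace functional\<close>

lemma expneg_mult_of_nat: "expneg (a * of_nat k) = expneg a ^ k"
  by (induction k) (simp_all add: distrib_left expneg_add)

text \<open>The counts of disjoint sets are independent Poisson variables.\<close>

lemma laplace_step:
  fixes n :: nat
  assumes B: "\<And>i. i < n \<Longrightarrow> B i \<in> sets borel \<and> bounded (B i)" "disjoint_family_on B {..<n}"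
  shows "(\<integral>\<^sup>+\<omega>. ennreal (expneg (\<Sum>i<n. a i * npoints (\<eta> \<omega> \<inter> B i))) \<partial>M)
    = ennreal (exp (- (\<Sum>i<n. (1 - expneg (a i)) * measure \<Lambda> (B i))))"
proof -
  have "indep_vars (\<lambda>_. borel) (\<lambda>i \<omega>. npoints (\<eta> \<omega> \<inter> B i)) {..<n}"
    by (rule indep_counts) (use B in auto)
  from indep_vars_compose2[OF this, of "\<lambda>i N. ennreal (expneg (a i * N))" "\<lambda>_. borel"]
  have ind: "indep_vars (\<lambda>_. borel) (\<lambda>i \<omega>. ennreal (expneg (a i * npoints (\<eta> \<omega> \<inter> B i)))) {..<n}"
    by simp
  have "(\<integral>\<^sup>+\<omega>. ennreal (expneg (\<Sum>i<n. a i * npoints (\<eta> \<omega> \<inter> B i))) \<partial>M)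
     = (\<integral>\<^sup>+\<omega>. (\<Prod>i<n. ennreal (expneg (a i * npoints (\<eta> \<omega> \<inter> B i)))) \<partial>M)"
    by (intro nn_integral_cong) (simp add: expneg_sum prod_ennreal)
  also have "\<dots> = (\<Prod>i<n. \<integral>\<^sup>+\<omega>. ennreal (expneg (a i * npoints (\<eta> \<omega> \<inter> B i))) \<partial>M)"
    by (rule indep_vars_nn_integral[OF _ ind]) auto
  also have "\<dots> = (\<Prod>i<n. ennreal (exp (- (1 - expneg (a i)) * measure \<Lambda> (B i))))"
  proof (rule prod.cong[OF refl])
    fix i assume "i \<in> {..<n}"
    then have Bi: "B i \<in> sets borel" "bounded (B i)" using B by auto
    show "(\<integral>\<^sup>+\<omega>. ennreal (expneg (a i * npoints (\<eta> \<omega> \<inter> B i))) \<partial>M) = ennreal (exp (- (1 - expneg (a i)) * measure \<Lambda> (B i)))"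
      unfolding nn_integral_count[OF Bi, of "\<lambda>N. ennreal (expneg (a i * N))"] expneg_mult_of_nat
      by (rule poisson_weights_suminf) simp_all
  qed
  also have "\<dots> = ennreal (exp (- (\<Sum>i<n. (1 - expneg (a i)) * measure \<Lambda> (B i))))"
    by (simp add: prod_ennreal exp_sum sum_negf[symmetric] flip: mult_minus_left)
  finally show ?thesis .
qed

lemma laplace_simple:
  assumes g: "simple_function borel (g :: 'a \<Rightarrow> ennreal)"
  shows "(\<integral>\<^sup>+\<omega>. ennreal (expneg (\<integral>\<^sup>+y. g y * indicator (cball z r) y \<partial>count_space (\<eta> \<omega>))) \<partial>M)
    = ennreal (expneg (\<integral>\<^sup>+y. ennreal (1 - expneg (g y * indicator (cball z r) y)) \<partial>\<Lambda>))"
proof -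
  have fin: "finite (range g)" using simple_functionD(1)[OF g] by simp
  obtain a :: "nat \<Rightarrow> ennreal" and n where a: "range g = a ` {i. i < n}" "inj_on a {i. i < n}"
    using finite_imp_nat_seg_image_inj_on[OF fin] by blast
  define B where "B i = g -` {a i} \<inter> cball z r" for i
  have B: "B i \<in> sets borel \<and> bounded (B i)" for i
    using simple_functionD(2)[OF g, of "{a i}"] by (auto simp: B_def intro: bounded_subset[OF bounded_cball])
  have disj: "disjoint_family_on B {..<n}"
    using a(2) by (auto simp: disjoint_family_on_def B_def inj_on_def)
  have sel: "(\<Sum>i<n. h (a i) * indicator (B i) y) = h (g y) * (indicator (cball z r) y :: ennreal)" for h and y
  proof -
    obtain j where j: "j < n" "g y = a j" using a(1) by (metis (mono_tags, lifting) UNIV_I image_iff mem_Collect_eq)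
    have "(\<Sum>i<n. h (a i) * indicator (B i) y) = (\<Sum>i\<in>{j}. h (a i) * (indicator (B i) y :: ennreal))"
      using j a(2) by (intro sum.mono_neutral_right) (auto simp: B_def inj_on_def indicator_def)
    then show ?thesis using j by (simp add: B_def indicator_def)
  qed
  have "(\<integral>\<^sup>+y. g y * indicator (cball z r) y \<partial>count_space V) = (\<Sum>i<n. a i * npoints (V \<inter> B i))" for V
  proof -
    have "(\<integral>\<^sup>+y. g y * indicator (cball z r) y \<partial>count_space V) = (\<integral>\<^sup>+y. (\<Sum>i<n. a i * indicator (B i) y) \<partial>count_space V)"
      using sel[of "\<lambda>x. x"] by simp
    also have "\<dots> = (\<Sum>i<n. \<integral>\<^sup>+y. a i * indicator (B i) y \<partial>count_space V)" by (rule nn_integral_sum) simp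
    also have "\<dots> = (\<Sum>i<n. a i * npoints (V \<inter> B i))" by (simp add: nn_integral_cmult npoints_eq_nn_integral)
    finally show ?thesis .
  qed
  then have "(\<integral>\<^sup>+\<omega>. ennreal (expneg (\<integral>\<^sup>+y. g y * indicator (cball z r) y \<partial>count_space (\<eta> \<omega>))) \<partial>M)
     = ennreal (exp (- (\<Sum>i<n. (1 - expneg (a i)) * measure \<Lambda> (B i))))"
    using laplace_step[of n B a] B disj by simp
  moreover have "(\<integral>\<^sup>+y. ennreal (1 - expneg (g y * indicator (cball z r) y)) \<partial>\<Lambda>)
     = ennreal (\<Sum>i<n. (1 - expneg (a i)) * measure \<Lambda> (B i))"
  proof -
    have "(\<integral>\<^sup>+y. ennreal (1 - expneg (g y * indicator (cball z r) y)) \<partial>\<Lambda>)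
        = (\<integral>\<^sup>+y. (\<Sum>i<n. ennreal (1 - expneg (a i)) * indicator (B i) y) \<partial>\<Lambda>)"
      unfolding sel[of "\<lambda>x. ennreal (1 - expneg x)"] by (intro nn_integral_cong) (auto split: split_indicator)
    also have "\<dots> = (\<Sum>i<n. \<integral>\<^sup>+y. ennreal (1 - expneg (a i)) * indicator (B i) y \<partial>\<Lambda>)"
      using B by (intro nn_integral_sum borel_measurable_times_ennreal borel_measurable_const borel_measurable_indicator)
        (auto simp: sets_intensity)
    also have "\<dots> = (\<Sum>i<n. ennreal (1 - expneg (a i)) * emeasure \<Lambda> (B i))"
      using B by (intro sum.cong refl nn_integral_cmult_indicator) (auto simp: sets_intensity)
    also have "\<dots> = (\<Sum>i<n. ennreal ((1 - expneg (a i)) * measure \<Lambda> (B i)))"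
      using B intensity_bounded by (intro sum.cong refl) (simp add: ennreal_mult emeasure_eq_ennreal_measure less_top)
    also have "\<dots> = ennreal (\<Sum>i<n. (1 - expneg (a i)) * measure \<Lambda> (B i))"
      by (intro sum_ennreal) simp
    finally show ?thesis .
  qed
  moreover have "0 \<le> (\<Sum>i<n. (1 - expneg (a i)) * measure \<Lambda> (B i))" by (intro sum_nonneg) simp
  ultimately show ?thesis by (simp add: expneg_ennreal)
qed

text \<open>Simple functions with bounded support increase to \<open>g\<close>; both sides are continuous along such a
  sequence.\<close>

theorem laplace_functional:
  assumes g: "g \<in> borel_measurable borel"
  shows "(\<integral>\<^sup>+\<omega>. ennreal (expneg (\<integral>\<^sup>+y. g y \<partial>count_space (\<eta> \<omega>))) \<partial>M)
    = ennreal (expneg (\<integral>\<^sup>+y. ennreal (1 - expneg (g y)) \<partial>\<Lambda>))"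
proof -
  obtain s :: "nat \<Rightarrow> 'a \<Rightarrow> ennreal" where s: "\<And>i. simple_function borel (s i)" "incseq s"
      "\<And>i x. s i x < top" "\<And>x. (SUP i. s i x) = g x"
    by (rule borel_measurable_implies_simple_function_sequence'[OF g]) blast
  define f where "f n y = s n y * indicator (cball undefined (real n)) y" for n and y :: 'a
  have fm: "f n \<in> borel_measurable borel" for n
    unfolding f_def[abs_def] by (intro borel_measurable_times_ennreal borel_measurable_simple_function s(1)) simp
  have inc: "incseq f"
  proof (intro incseq_SucI le_funI)
    fix n and y :: 'a
    have "s n y \<le> s (Suc n) y" using s(2) by (auto simp: incseq_Suc_iff le_fun_def)
    then show "f n y \<le> f (Suc n) y" by (auto simp: f_def split: split_indicator)
  qed
  then have incy: "incseq (\<lambda>n. f n y)" for y by (auto simp: incseq_def le_fun_def)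
  have sup: "(SUP n. f n y) = g y" for y
  proof -
    obtain m where m: "dist undefined y \<le> real m" using real_arch_simple by blast
    have "(\<lambda>n. s n y) \<longlonglongrightarrow> g y"
      using LIMSEQ_SUP[of "\<lambda>n. s n y"] s(2,4) by (simp add: incseq_def le_fun_def)
    moreover have "\<forall>\<^sub>F n in sequentially. s n y = f n y"
      by (rule eventually_sequentiallyI[of m]) (use m in \<open>auto simp: f_def\<close>)
    ultimately have "(\<lambda>n. f n y) \<longlonglongrightarrow> g y" by (rule Lim_transform_eventually)
    from LIMSEQ_unique[OF LIMSEQ_SUP[OF incy] this] show ?thesis .
  qed
  have lim: "(\<lambda>n. f n y) \<longlonglongrightarrow> g y" for y using LIMSEQ_SUP[OF incy[of y]] by (simp add: sup)
  have "(\<lambda>n. \<integral>\<^sup>+y. f n y \<partial>count_space V) \<longlonglongrightarrow> (\<integral>\<^sup>+y. g y \<partial>count_space V)" for V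
    by (rule nn_integral_LIMSEQ) (use inc lim in \<open>simp_all\<close>)
  then have p: "(\<lambda>n. ennreal (expneg (\<integral>\<^sup>+y. f n y \<partial>count_space V))) \<longlonglongrightarrow> ennreal (expneg (\<integral>\<^sup>+y. g y \<partial>count_space V))" for V
    by (intro tendsto_ennrealI tendsto_expneg)
  have meas: "(\<lambda>\<omega>. ennreal (expneg (\<integral>\<^sup>+y. k y \<partial>count_space (\<eta> \<omega>)))) \<in> borel_measurable M"
    if "k \<in> borel_measurable borel" for k
    using measurable_compose[OF measurable_compose[OF point_sum_measurable[OF measurable_points
        measurable_compose[OF measurable_snd that]] measurable_expneg] measurable_ennreal] by (simp only: snd_conv)
  have L: "(\<lambda>n. \<integral>\<^sup>+\<omega>. ennreal (expneg (\<integral>\<^sup>+y. f n y \<partial>count_space (\<eta> \<omega>))) \<partial>M)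
      \<longlonglongrightarrow> (\<integral>\<^sup>+\<omega>. ennreal (expneg (\<integral>\<^sup>+y. g y \<partial>count_space (\<eta> \<omega>))) \<partial>M)"
  proof (rule nn_integral_dominated_convergence[where w="\<lambda>_. 1"])
    show "(\<integral>\<^sup>+\<omega>. 1 \<partial>M) < \<infinity>" by (simp add: emeasure_space_1)
  qed (use p meas fm g in auto)
  have "(\<lambda>n. \<integral>\<^sup>+y. ennreal (1 - expneg (f n y)) \<partial>\<Lambda>) \<longlonglongrightarrow> (\<integral>\<^sup>+y. ennreal (1 - expneg (g y)) \<partial>\<Lambda>)"
  proof (rule nn_integral_LIMSEQ)
    show "incseq (\<lambda>n y. ennreal (1 - expneg (f n y)))"
      using incy by (auto simp: incseq_def le_fun_def intro!: ennreal_leI expneg_antimono)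
    show "(\<lambda>y. ennreal (1 - expneg (f n y))) \<in> borel_measurable \<Lambda>" for n
      unfolding measurable_intensity_iff
      by (intro measurable_compose[OF _ measurable_ennreal] borel_measurable_diff borel_measurable_const
        measurable_compose[OF fm measurable_expneg])
    show "(\<lambda>n. ennreal (1 - expneg (f n y))) \<longlonglongrightarrow> ennreal (1 - expneg (g y))" for y
      by (intro tendsto_ennrealI tendsto_diff tendsto_const tendsto_expneg lim)
  qed
  then have R: "(\<lambda>n. ennreal (expneg (\<integral>\<^sup>+y. ennreal (1 - expneg (f n y)) \<partial>\<Lambda>)))
      \<longlonglongrightarrow> ennreal (expneg (\<integral>\<^sup>+y. ennreal (1 - expneg (g y)) \<partial>\<Lambda>))"
    by (intro tendsto_ennrealI tendsto_expneg)
  have eq: "(\<integral>\<^sup>+\<omega>. ennreal (expneg (\<integral>\<^sup>+y. f n y \<partial>count_space (\<eta> \<omega>))) \<partial>M)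
      = ennreal (expneg (\<integral>\<^sup>+y. ennreal (1 - expneg (f n y)) \<partial>\<Lambda>))" for n
    unfolding f_def by (rule laplace_simple[OF s(1)])
  show ?thesis by (rule LIMSEQ_unique[OF L[unfolded eq] R])
qed

end


section \<open>The random connection model\<close>

locale connection_model = connection_function \<phi> for \<phi> :: "'a::polish_space \<Rightarrow> 'a \<Rightarrow> real" +
  fixes lam :: "'a measure" and v :: 'a
  assumes lam_borel: "sets lam = sets borel"
    and lam_bounded: "\<And>B. B \<in> sets borel \<Longrightarrow> bounded B \<Longrightarrow> emeasure lam B < \<infinity>"
    and lam_diffuse: "\<And>x. emeasure lam {x} = 0"
begin

definition phi_lam :: "'a set \<Rightarrow> ennreal" where
  "phi_lam V = (\<integral>\<^sup>+x. ennreal (1 - unit_prod (\<lambda>y. 1 - \<phi> x y) V) \<partial>lam)"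

lemma phi_lambda_eq: "phi_lambda lam \<phi> \<mu> = phi_lam (verts \<mu>)"
  by (simp add: phi_lambda_def phi_lam_def)

text \<open>The graph on \<open>W\<close>, \<open>V\<close> and \<open>v\<close>, with \<open>W\<close> playing the role of points that have already been selected
  for the component and \<open>V\<close> that of the remaining points. The size \<open>m + 1\<close> includes \<open>v\<close>.\<close>

definition size_restricted_mean :: "nat \<Rightarrow> ('a graph \<Rightarrow> ennreal) \<Rightarrow> 'a set \<Rightarrow> 'a set \<Rightarrow> ennreal" where
  "size_restricted_mean m g W V = (\<integral>\<^sup>+\<mu>. of_bool (gsize (component v \<mu>) = of_nat (Suc m) \<and> W \<subseteq> component_verts v \<mu>)
      * g (component v \<mu>) \<partial>random_edges_law \<phi> (insert v (W \<union> V)))"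

lemma measurable_lam_iff: "measurable lam N = measurable borel N"
  by (rule measurable_cong_sets[OF lam_borel refl])

lemma sigma_finite_lam: "sigma_finite_measure lam"
proof
  have sp: "space lam = UNIV" using sets_eq_imp_space_eq[OF lam_borel] by simp
  show "\<exists>A. countable A \<and> A \<subseteq> sets lam \<and> \<Union> A = space lam \<and> (\<forall>a\<in>A. emeasure lam a \<noteq> \<infinity>)"
  proof (intro exI conjI)
    show "countable (range (\<lambda>n. cball undefined (real n) :: 'a set))" by simp
    show "range (\<lambda>n. cball undefined (real n) :: 'a set) \<subseteq> sets lam" by (auto simp: lam_borel)
    show "\<Union> (range (\<lambda>n. cball undefined (real n) :: 'a set)) = space lam"
      by (simp only: UN_cball_real sp)
    show "\<forall>a\<in>range (\<lambda>n. cball undefined (real n) :: 'a set). emeasure lam a \<noteq> \<infinity>"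
      using lam_bounded by (auto simp: less_top[symmetric])
  qed
qed

lemma AE_lam_notin:
  assumes "finite W"
  shows "AE x in lam. x \<notin> W"
proof -
  have "AE x in lam. \<forall>w\<in>W. x \<noteq> w"
  proof (rule AE_finite_allI[OF assms])
    fix w
    have "{w} \<in> null_sets lam" using lam_diffuse by (auto simp: null_sets_def lam_borel)
    from AE_not_in[OF this] show "AE x in lam. x \<noteq> w" by simp
  qed
  then show ?thesis by eventually_elim auto
qed

lemma measurable_random_edges_law_subprob:
  "random_edges_law \<phi> \<in> measurable point_space (subprob_algebra graph_space)"
  by (rule measurable_prob_algebraD[OF measurable_random_edges_law])

lemma nn_integral_random_edges_law_cong:
  assumes V: "locally_finite_set V" and f: "f \<in> borel_measurable graph_space" "g \<in> borel_measurable graph_space"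
    and eq: "\<And>\<mu>. \<mu> \<in> graphs \<Longrightarrow> verts \<mu> = V \<Longrightarrow> f \<mu> = g \<mu>"
  shows "(\<integral>\<^sup>+\<mu>. f \<mu> \<partial>random_edges_law \<phi> V) = (\<integral>\<^sup>+\<mu>. g \<mu> \<partial>random_edges_law \<phi> V)"
  unfolding nn_integral_random_edges_law[OF V f(1)] nn_integral_random_edges_law[OF V f(2)]
  using edge_graph_graphs[OF V] by (intro nn_integral_cong eq) simp_all

lemma pred_component_size:
  "Measurable.pred graph_space (\<lambda>\<mu> :: 'a graph. gsize (component v \<mu>) = of_nat n)"
proof -
  have "(\<lambda>\<mu> :: 'a graph. gsize (component v \<mu>)) \<in> borel_measurable graph_space"
    by (rule measurable_compose[OF measurable_component measurable_gsize])
  moreover have "Measurable.pred borel (\<lambda>a :: ennreal. a = of_nat n)" by simp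
  ultimately show ?thesis by (rule measurable_compose)
qed

lemma measurable_size_restricted_integrand:
  fixes g :: "'a graph \<Rightarrow> ennreal"
  assumes g: "g \<in> borel_measurable graph_space" and W: "finite W"
  shows "(\<lambda>\<mu>. of_bool (gsize (component v \<mu>) = of_nat (Suc m) \<and> W \<subseteq> component_verts v \<mu>) * g (component v \<mu>))
    \<in> borel_measurable graph_space"
proof (rule borel_measurable_times_ennreal[OF measurable_of_bool_ennreal measurable_compose[OF measurable_component g]])
  show "Measurable.pred graph_space (\<lambda>\<mu>. gsize (component v \<mu>) = of_nat (Suc m) \<and> W \<subseteq> component_verts v \<mu>)"
    by (rule pred_intros_logic(3)[OF pred_component_size pred_subset_component_verts[OF W]])
qed

lemma measurable_size_restricted_mean:
  assumes g: "g \<in> borel_measurable graph_space" and W: "finite W"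
  shows "(\<lambda>p. size_restricted_mean m g (insert (fst p) W) (snd p)) \<in> borel_measurable (borel \<Otimes>\<^sub>M point_space)"
proof -
  let ?B = "borel \<Otimes>\<^sub>M (point_space :: 'a set measure)"
  have "(\<lambda>p. insert v (insert (fst p) (W \<union> snd p))) \<in> measurable ?B point_space"
    using W by (intro measurable_insert_point measurable_Un_point measurable_fst measurable_snd measurable_const)
      (auto simp: space_point_space locally_finite_set_finite)
  from measurable_compose[OF this measurable_random_edges_law_subprob]
  have L: "(\<lambda>p. random_edges_law \<phi> (insert v (insert (fst p) W \<union> snd p))) \<in> measurable ?B (subprob_algebra graph_space)"
    by simp
  have m: "(\<lambda>q. snd q) \<in> measurable (?B \<Otimes>\<^sub>M graph_space) graph_space"
    and m': "(\<lambda>q. fst (fst q)) \<in> measurable (?B \<Otimes>\<^sub>M graph_space) borel"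
    by (intro measurable_snd measurable_compose[OF measurable_fst measurable_fst])+
  have "(\<lambda>q. of_bool (fst (fst q) \<in> component_verts v (snd q)) *
      (of_bool (gsize (component v (snd q)) = of_nat (Suc m) \<and> W \<subseteq> component_verts v (snd q)) * g (component v (snd q))))
      \<in> borel_measurable (?B \<Otimes>\<^sub>M graph_space)"
    by (intro borel_measurable_times_ennreal[OF _ measurable_compose[OF m measurable_size_restricted_integrand[OF g W]]]
      measurable_of_bool_ennreal pred_component_verts m m')
  also have "(\<lambda>q. of_bool (fst (fst q) \<in> component_verts v (snd q)) *
      (of_bool (gsize (component v (snd q)) = of_nat (Suc m) \<and> W \<subseteq> component_verts v (snd q)) * g (component v (snd q))))
    = (\<lambda>q. of_bool (gsize (component v (snd q)) = of_nat (Suc m) \<and> insert (fst (fst q)) W \<subseteq> component_verts v (snd q)) * g (component v (snd q)))"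
    by (auto simp: fun_eq_iff)
  finally have f: "(\<lambda>(p, \<mu>). of_bool (gsize (component v \<mu>) = of_nat (Suc m) \<and> insert (fst p) W \<subseteq> component_verts v \<mu>) * g (component v \<mu>))
      \<in> borel_measurable (?B \<Otimes>\<^sub>M graph_space)"
    by (simp only: case_prod_unfold)
  show ?thesis unfolding size_restricted_mean_def by (rule nn_integral_measurable_subprob_algebra2[OF f L])
qed

lemma component_nonempty_imp_mem: "component_verts v \<mu> \<noteq> {} \<Longrightarrow> v \<in> component_verts v \<mu>"
  by (auto simp: component_verts_def)

lemma gsize_eq_of_nat_iff: "gsize \<mu> = of_nat n \<longleftrightarrow> finite (verts \<mu>) \<and> card (verts \<mu>) = n"
  by (cases "finite (verts \<mu>)") (auto simp: gsize_def emeasure_count_space_finite)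

text \<open>The summands of the right-hand side count the vertices of the component outside \<open>W\<close> and \<open>v\<close>.\<close>

lemma size_restricted_mean_step:
  assumes g: "g \<in> borel_measurable graph_space" and W: "finite W" "v \<notin> W"
    and V: "locally_finite_set V" "insert v W \<inter> V = {}"
  shows "(\<integral>\<^sup>+x. size_restricted_mean m g (insert x W) (V - {x}) \<partial>count_space V)
    = of_nat (m - card W) * size_restricted_mean m g W V"
proof -
  let ?U = "insert v (W \<union> V)"
  let ?f = "\<lambda>\<mu>. of_bool (gsize (component v \<mu>) = of_nat (Suc m) \<and> W \<subseteq> component_verts v \<mu>) * g (component v \<mu>)"
  have fm: "?f \<in> borel_measurable graph_space" by (rule measurable_size_restricted_integrand[OF g W(1)])
  have cV: "countable V" by (rule locally_finite_set_countable[OF V(1)])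
  have lfU: "locally_finite_set ?U"
    using locally_finite_set_Un[OF locally_finite_set_finite[OF W(1)] V(1)] by simp
  have xm: "(\<lambda>\<mu> :: 'a graph. of_bool (x \<in> component_verts v \<mu>) :: ennreal) \<in> borel_measurable graph_space" for x
    by (intro measurable_of_bool_ennreal pred_component_verts measurable_const) simp_all
  have "(\<integral>\<^sup>+x. size_restricted_mean m g (insert x W) (V - {x}) \<partial>count_space V)
    = (\<integral>\<^sup>+x. \<integral>\<^sup>+\<mu>. of_bool (x \<in> component_verts v \<mu>) * ?f \<mu> \<partial>random_edges_law \<phi> ?U \<partial>count_space V)"
  proof (rule nn_integral_cong)
    fix x assume "x \<in> space (count_space V)"
    then have "insert v (insert x W \<union> (V - {x})) = ?U" by auto
    then show "size_restricted_mean m g (insert x W) (V - {x}) = (\<integral>\<^sup>+\<mu>. of_bool (x \<in> component_verts v \<mu>) * ?f \<mu> \<partial>random_edges_law \<phi> ?U)"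
      unfolding size_restricted_mean_def by (simp only:) (intro nn_integral_cong, auto)
  qed
  also have "\<dots> = (\<integral>\<^sup>+\<mu>. \<integral>\<^sup>+x. of_bool (x \<in> component_verts v \<mu>) * ?f \<mu> \<partial>count_space V \<partial>random_edges_law \<phi> ?U)"
  proof (rule nn_integral_count_space_nn_integral[OF cV, symmetric])
    fix x
    have "(\<lambda>\<mu>. of_bool (x \<in> component_verts v \<mu>) * ?f \<mu>) \<in> borel_measurable graph_space"
      by (rule borel_measurable_times_ennreal[OF xm fm])
    then show "(\<lambda>\<mu>. of_bool (x \<in> component_verts v \<mu>) * ?f \<mu>) \<in> borel_measurable (random_edges_law \<phi> ?U)"
      by (rule measurable_cong_sets[OF sets_random_edges_law refl, THEN equalityD2, THEN subsetD])
  qed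
  also have "\<dots> = (\<integral>\<^sup>+\<mu>. npoints (V \<inter> component_verts v \<mu>) * ?f \<mu> \<partial>random_edges_law \<phi> ?U)"
  proof (rule nn_integral_cong)
    fix \<mu>
    have "(\<integral>\<^sup>+x. of_bool (x \<in> component_verts v \<mu>) * ?f \<mu> \<partial>count_space V)
      = (\<integral>\<^sup>+x. indicator (component_verts v \<mu>) x * ?f \<mu> \<partial>count_space V)"
      by (intro nn_integral_cong) (simp add: indicator_def)
    also have "\<dots> = npoints (V \<inter> component_verts v \<mu>) * ?f \<mu>"
      unfolding npoints_eq_nn_integral by (rule nn_integral_multc) simp
    finally show "(\<integral>\<^sup>+x. of_bool (x \<in> component_verts v \<mu>) * ?f \<mu> \<partial>count_space V) = npoints (V \<inter> component_verts v \<mu>) * ?f \<mu>" .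
  qed
  also have "\<dots> = (\<integral>\<^sup>+\<mu>. of_nat (m - card W) * ?f \<mu> \<partial>random_edges_law \<phi> ?U)"
  proof (rule nn_integral_random_edges_law_cong[OF lfU])
    have "(\<lambda>\<mu> :: 'a graph. npoints (component_verts v \<mu> \<inter> V)) \<in> borel_measurable graph_space"
      by (rule measurable_npoints[OF measurable_component_verts])
        (use cV in \<open>simp add: countable_imp_null_set_lborel sets.countable\<close>)
    then show "(\<lambda>\<mu>. npoints (V \<inter> component_verts v \<mu>) * ?f \<mu>) \<in> borel_measurable graph_space"
      by (intro borel_measurable_times_ennreal[OF _ fm]) (simp only: Int_commute)
    show "(\<lambda>\<mu>. of_nat (m - card W) * ?f \<mu>) \<in> borel_measurable graph_space"
      by (intro borel_measurable_times_ennreal[OF _ fm] borel_measurable_const)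
    fix \<mu> :: "'a graph" assume \<mu>: "verts \<mu> = ?U"
    let ?C = "component_verts v \<mu>"
    show "npoints (V \<inter> ?C) * ?f \<mu> = of_nat (m - card W) * ?f \<mu>"
    proof (cases "gsize (component v \<mu>) = of_nat (Suc m) \<and> W \<subseteq> ?C")
      case True
      then have C: "finite ?C" "card ?C = Suc m" "W \<subseteq> ?C" unfolding gsize_eq_of_nat_iff by simp_all
      then have "v \<in> ?C" by (intro component_nonempty_imp_mem) auto
      moreover have "?C \<subseteq> ?U" using component_verts_subset[of v \<mu>] \<mu> by simp
      ultimately have "V \<inter> ?C = ?C - insert v W" using C(3) V(2) by auto
      then have "card (V \<inter> ?C) = Suc m - Suc (card W)"
        using C W \<open>v \<in> ?C\<close> by (simp add: card_Diff_subset)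
      then have "npoints (V \<inter> ?C) = of_nat (m - card W)"
        using C(1) by (simp add: emeasure_count_space_finite)
      then show ?thesis by (simp only:)
    next
      case False
      then show ?thesis by (simp only: of_bool_eq(1) mult_zero_left mult_zero_right)
    qed
  qed
  also have "\<dots> = of_nat (m - card W) * size_restricted_mean m g W V"
    unfolding size_restricted_mean_def
    by (rule nn_integral_cmult) (rule measurable_cong_sets[OF sets_random_edges_law refl, THEN equalityD2, THEN subsetD, OF fm])
  finally show ?thesis .
qed

text \<open>Once \<open>m\<close> vertices have been selected, the component is \<open>insert v W\<close> and must be cut off from \<open>V\<close>.\<close>

lemma size_restricted_mean_cut:
  assumes g: "g \<in> borel_measurable graph_space" and W: "finite W" "v \<notin> W"
    and V: "locally_finite_set V" "insert v W \<inter> V = {}"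
  shows "size_restricted_mean (card W) g W V
    = (\<integral>\<^sup>+\<mu>. of_bool (component_verts v \<mu> = insert v W) * g (component v \<mu>) \<partial>random_edges_law \<phi> (insert v W))
      * ennreal (expneg (\<integral>\<^sup>+y. (\<Sum>x\<in>insert v W. neglog (\<phi> y x)) \<partial>count_space V))"
proof -
  have "gsize (component v \<mu>) = of_nat (Suc (card W)) \<and> W \<subseteq> component_verts v \<mu> \<longleftrightarrow> component_verts v \<mu> = insert v W" for \<mu>
  proof
    assume *: "gsize (component v \<mu>) = of_nat (Suc (card W)) \<and> W \<subseteq> component_verts v \<mu>"
    then have C: "finite (component_verts v \<mu>)" "card (component_verts v \<mu>) = Suc (card W)"
      unfolding gsize_eq_of_nat_iff by simp_all
    then have "v \<in> component_verts v \<mu>" by (intro component_nonempty_imp_mem) auto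
    then have "insert v W \<subseteq> component_verts v \<mu>" using * by auto
    then have "insert v W = component_verts v \<mu>" using C W by (intro card_subset_eq) auto
    then show "component_verts v \<mu> = insert v W" ..
  next
    assume "component_verts v \<mu> = insert v W"
    then show "gsize (component v \<mu>) = of_nat (Suc (card W)) \<and> W \<subseteq> component_verts v \<mu>"
      unfolding gsize_eq_of_nat_iff using W by auto
  qed
  then have "size_restricted_mean (card W) g W V
      = (\<integral>\<^sup>+\<mu>. of_bool (component_verts v \<mu> = insert v W) * g (component v \<mu>) \<partial>random_edges_law \<phi> (insert v W \<union> V))"
    by (simp add: size_restricted_mean_def)
  also have "\<dots> = (\<integral>\<^sup>+\<mu>. of_bool (component_verts v \<mu> = insert v W) * g (component v \<mu>) \<partial>random_edges_law \<phi> (insert v W))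
      * ennreal (expneg (\<integral>\<^sup>+y. (\<Sum>x\<in>insert v W. neglog (\<phi> y x)) \<partial>count_space V))"
    using W(1) by (intro random_edges_law_cut V g) auto
  finally show ?thesis .
qed

lemma measurable_phi_lam:
  assumes U: "U \<in> measurable M point_space"
  shows "(\<lambda>\<omega>. phi_lam (U \<omega>)) \<in> borel_measurable M"
proof -
  interpret L: sigma_finite_measure lam by (rule sigma_finite_lam)
  have s: "snd \<in> measurable (M \<Otimes>\<^sub>M lam) borel"
    using measurable_snd[of M lam] measurable_cong_sets[OF refl lam_borel, of "M \<Otimes>\<^sub>M lam"] by blast
  have "(\<lambda>p. ennreal (1 - unit_prod (\<lambda>y. 1 - \<phi> (snd p) y) (U (fst p)))) \<in> borel_measurable (M \<Otimes>\<^sub>M lam)"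
    by (intro measurable_compose[OF _ measurable_ennreal] borel_measurable_diff borel_measurable_const
      measurable_unit_prod_phi[where x=snd, OF measurable_compose[OF measurable_fst U] s])
  from L.borel_measurable_nn_integral_fst[OF this] show ?thesis by (simp only: phi_lam_def fst_conv snd_conv)
qed

end

locale poisson_rcm = connection_model \<phi> lam v for \<phi> :: "'a::polish_space \<Rightarrow> 'a \<Rightarrow> real" and lam and v +
  fixes M :: "'w measure" and \<eta> :: "'w \<Rightarrow> 'a set" and \<xi> :: "'w \<Rightarrow> 'a graph" and t :: real
  assumes t_pos: "0 < t" and model: "random_connection_model M \<eta> \<xi> t lam \<phi> v"
begin

sublocale P: poisson_driven M \<eta> "scale_measure (ennreal t) lam"
proof -
  interpret prob_space M using model by (simp add: random_connection_model_def)
  show "poisson_driven M \<eta> (scale_measure (ennreal t) lam)"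
  proof
    show "poisson_process M \<eta> (scale_measure (ennreal t) lam)" using model by (simp add: random_connection_model_def)
    show "sets (scale_measure (ennreal t) lam) = sets borel" by (simp add: lam_borel)
    show "emeasure (scale_measure (ennreal t) lam) B < \<infinity>" if "B \<in> sets borel" "bounded B" for B
      using lam_bounded[OF that] by (simp add: ennreal_mult_less_top)
    show "emeasure (scale_measure (ennreal t) lam) {x} = 0" for x by (simp add: lam_diffuse)
  qed
qed

lemma measurable_xi: "\<xi> \<in> measurable M graph_space"
  using model by (simp add: random_connection_model_def)

lemma verts_xi: "\<omega> \<in> space M \<Longrightarrow> verts (\<xi> \<omega>) = insert v (\<eta> \<omega>)"
  using model by (simp add: random_connection_model_def)

lemma measurable_conditional_law:
  "(\<lambda>\<omega>. random_edges_law \<phi> (insert v (\<eta> \<omega>))) \<in> measurable M (subprob_algebra graph_space)"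
  by (intro measurable_compose[OF _ measurable_random_edges_law_subprob] measurable_insert_point
    P.measurable_points measurable_const) simp

text \<open>The law of the graph is the mixture of the conditional laws given the points.\<close>

lemma distr_xi: "distr M graph_space \<xi> = M \<bind> (\<lambda>\<omega>. random_edges_law \<phi> (insert v (\<eta> \<omega>)))"
proof (rule measure_eqI)
  show "sets (distr M graph_space \<xi>) = sets (M \<bind> (\<lambda>\<omega>. random_edges_law \<phi> (insert v (\<eta> \<omega>))))"
    using sets_bind[OF sets_kernel[OF measurable_conditional_law] P.not_empty] by simp
  fix A assume "A \<in> sets (distr M graph_space \<xi>)"
  then have A: "A \<in> sets graph_space" by simp
  have top: "{V :: 'a set. locally_finite_set V} \<in> sets point_space"
    using sets.top[of "point_space :: 'a set measure"] by (simp only: space_point_space)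
  have "emeasure (distr M graph_space \<xi>) A = emeasure M (\<xi> -` A \<inter> space M)"
    by (rule emeasure_distr[OF measurable_xi A])
  also have "\<xi> -` A \<inter> space M = {\<omega> \<in> space M. \<eta> \<omega> \<in> {V. locally_finite_set V} \<and> \<xi> \<omega> \<in> A}"
    using P.points_lf by auto
  also have "emeasure M \<dots> = (\<integral>\<^sup>+\<omega>. indicator {V. locally_finite_set V} (\<eta> \<omega>) * emeasure (random_edges_law \<phi> (insert v (\<eta> \<omega>))) A \<partial>M)"
    using model top A unfolding random_connection_model_def by blast
  also have "\<dots> = (\<integral>\<^sup>+\<omega>. emeasure (random_edges_law \<phi> (insert v (\<eta> \<omega>))) A \<partial>M)"
    by (intro nn_integral_cong) (simp add: P.points_lf)
  also have "\<dots> = emeasure (M \<bind> (\<lambda>\<omega>. random_edges_law \<phi> (insert v (\<eta> \<omega>)))) A"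
    by (rule emeasure_bind[OF P.not_empty measurable_conditional_law A, symmetric])
  finally show "emeasure (distr M graph_space \<xi>) A = emeasure (M \<bind> (\<lambda>\<omega>. random_edges_law \<phi> (insert v (\<eta> \<omega>)))) A" .
qed

lemma nn_integral_xi:
  assumes g: "g \<in> borel_measurable graph_space"
  shows "(\<integral>\<^sup>+\<omega>. g (\<xi> \<omega>) \<partial>M) = (\<integral>\<^sup>+\<omega>. \<integral>\<^sup>+\<mu>. g \<mu> \<partial>random_edges_law \<phi> (insert v (\<eta> \<omega>)) \<partial>M)"
proof -
  have "(\<integral>\<^sup>+\<omega>. g (\<xi> \<omega>) \<partial>M) = (\<integral>\<^sup>+\<mu>. g \<mu> \<partial>distr M graph_space \<xi>)"
    by (rule nn_integral_distr[OF measurable_xi, symmetric]) (simp add: g)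
  also have "\<dots> = (\<integral>\<^sup>+\<omega>. \<integral>\<^sup>+\<mu>. g \<mu> \<partial>random_edges_law \<phi> (insert v (\<eta> \<omega>)) \<partial>M)"
    unfolding distr_xi by (rule nn_integral_bind[OF g measurable_conditional_law])
  finally show ?thesis .
qed

lemma nn_integral_intensity:
  "h \<in> borel_measurable borel \<Longrightarrow> (\<integral>\<^sup>+x. h x \<partial>scale_measure (ennreal t) lam) = ennreal t * (\<integral>\<^sup>+x. h x \<partial>lam)"
  by (rule nn_integral_scale_measure) (simp add: measurable_lam_iff)

text \<open>The mean of the process to which the points of \<open>W\<close> have been added, restricted to the event that they
  all belong to the component.\<close>

definition palm_mean :: "nat \<Rightarrow> ('a graph \<Rightarrow> ennreal) \<Rightarrow> 'a set \<Rightarrow> ennreal" where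
  "palm_mean m g W = (\<integral>\<^sup>+\<omega>. size_restricted_mean m g W (\<eta> \<omega>) \<partial>M)"

lemma palm_mean_empty:
  assumes g: "g \<in> borel_measurable graph_space"
  shows "palm_mean m g {} = (\<integral>\<^sup>+\<omega>. of_bool (gsize (component v (\<xi> \<omega>)) = of_nat (Suc m)) * g (component v (\<xi> \<omega>)) \<partial>M)"
  using nn_integral_xi[OF measurable_size_restricted_integrand[OF g, of "{}" m]]
  by (simp add: palm_mean_def size_restricted_mean_def)

lemma measurable_palm_mean:
  assumes g: "g \<in> borel_measurable graph_space" and W: "finite W"
  shows "(\<lambda>x. palm_mean m g (insert x W)) \<in> borel_measurable borel"
proof -
  have "(\<lambda>p. (fst p, \<eta> (snd p))) \<in> measurable (borel \<Otimes>\<^sub>M M) (borel \<Otimes>\<^sub>M point_space)"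
    by (intro measurable_Pair measurable_fst measurable_compose[OF measurable_snd P.measurable_points])
  from measurable_compose[OF this measurable_size_restricted_mean[OF g W]]
  have "(\<lambda>p. size_restricted_mean m g (insert (fst p) W) (\<eta> (snd p))) \<in> borel_measurable (borel \<Otimes>\<^sub>M M)"
    by (simp only: fst_conv snd_conv)
  from P.borel_measurable_nn_integral_fst[OF this] show ?thesis by (simp only: palm_mean_def fst_conv snd_conv)
qed

text \<open>Selecting one more vertex of the component: a sum over the points of the process on the left, an integral
  over added points on the right, equal by the Mecke equation.\<close>

lemma palm_mean_step:
  assumes g: "g \<in> borel_measurable graph_space" and W: "finite W" "v \<notin> W"
  shows "of_nat (m - card W) * palm_mean m g W = ennreal t * (\<integral>\<^sup>+x. palm_mean m g (insert x W) \<partial>lam)"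
proof -
  let ?h = "\<lambda>p. size_restricted_mean m g (insert (fst p) W) (snd p)"
  have m0: "(\<lambda>\<omega>. size_restricted_mean m g W (\<eta> \<omega>)) \<in> borel_measurable M"
  proof -
    have "(\<lambda>\<omega>. insert v (W \<union> \<eta> \<omega>)) \<in> measurable M point_space"
      using W by (intro measurable_insert_point measurable_Un_point P.measurable_points measurable_const)
        (auto simp: space_point_space locally_finite_set_finite)
    from measurable_compose[OF measurable_compose[OF this measurable_random_edges_law_subprob]
        nn_integral_measurable_subprob_algebra[OF measurable_size_restricted_integrand[OF g W(1), of m]]]
    show ?thesis unfolding size_restricted_mean_def .
  qed
  have "of_nat (m - card W) * palm_mean m g W = (\<integral>\<^sup>+\<omega>. of_nat (m - card W) * size_restricted_mean m g W (\<eta> \<omega>) \<partial>M)"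
    unfolding palm_mean_def by (rule nn_integral_cmult[OF m0, symmetric])
  also have "\<dots> = (\<integral>\<^sup>+\<omega>. \<integral>\<^sup>+x. ?h (x, \<eta> \<omega> - {x}) \<partial>count_space (\<eta> \<omega>) \<partial>M)"
  proof (rule nn_integral_cong_AE)
    have "finite (insert v W)" using W by simp
    from P.AE_disjoint_points[OF this] AE_space
    show "AE \<omega> in M. of_nat (m - card W) * size_restricted_mean m g W (\<eta> \<omega>) = (\<integral>\<^sup>+x. ?h (x, \<eta> \<omega> - {x}) \<partial>count_space (\<eta> \<omega>))"
    proof eventually_elim
      case (elim \<omega>)
      from size_restricted_mean_step[OF g W P.points_lf[OF elim(2)] elim(1)] show ?case by simp
    qed
  qed
  also have "\<dots> = (\<integral>\<^sup>+x. \<integral>\<^sup>+\<omega>. ?h (x, \<eta> \<omega>) \<partial>M \<partial>scale_measure (ennreal t) lam)"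
    by (rule P.mecke_reduced[OF measurable_size_restricted_mean[OF g W(1)]])
  also have "\<dots> = (\<integral>\<^sup>+x. palm_mean m g (insert x W) \<partial>scale_measure (ennreal t) lam)"
    by (simp only: palm_mean_def fst_conv snd_conv)
  also have "\<dots> = ennreal t * (\<integral>\<^sup>+x. palm_mean m g (insert x W) \<partial>lam)"
    by (rule nn_integral_intensity[OF measurable_palm_mean[OF g W(1)]])
  finally show ?thesis .
qed

text \<open>When all vertices are selected, the process only has to avoid edges to them, which the Laplace
  functional evaluates.\<close>

lemma palm_mean_full:
  assumes g: "g \<in> borel_measurable graph_space" and W: "finite W" "v \<notin> W"
  shows "palm_mean (card W) g W
    = (\<integral>\<^sup>+\<mu>. of_bool (component_verts v \<mu> = insert v W) * g (component v \<mu>) \<partial>random_edges_law \<phi> (insert v W))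
      * ennreal (expneg (ennreal t * phi_lam (insert v W)))"
proof -
  let ?c = "\<integral>\<^sup>+\<mu>. of_bool (component_verts v \<mu> = insert v W) * g (component v \<mu>) \<partial>random_edges_law \<phi> (insert v W)"
  let ?L = "\<lambda>y. \<Sum>x\<in>insert v W. neglog (\<phi> y x)"
  have neg: "(\<lambda>y. neglog (\<phi> y x)) \<in> borel_measurable borel" for x
  proof -
    have "(\<lambda>y. (y, x)) \<in> measurable borel (borel \<Otimes>\<^sub>M borel)" by (intro measurable_Pair measurable_ident_sets measurable_const) simp_all
    from measurable_compose[OF measurable_compose[OF this measurable_phi'] measurable_neglog] show ?thesis by simp
  qed
  have L: "?L \<in> borel_measurable borel" by (intro borel_measurable_sum neg)
  have Lm: "(\<lambda>\<omega>. ennreal (expneg (\<integral>\<^sup>+y. ?L y \<partial>count_space (\<eta> \<omega>)))) \<in> borel_measurable M"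
    using measurable_compose[OF measurable_compose[OF point_sum_measurable[OF P.measurable_points
        measurable_compose[OF measurable_snd L]] measurable_expneg] measurable_ennreal] by (simp only: snd_conv)
  have "palm_mean (card W) g W = (\<integral>\<^sup>+\<omega>. ?c * ennreal (expneg (\<integral>\<^sup>+y. ?L y \<partial>count_space (\<eta> \<omega>))) \<partial>M)"
    unfolding palm_mean_def
  proof (rule nn_integral_cong_AE)
    have "finite (insert v W)" using W by simp
    from P.AE_disjoint_points[OF this] AE_space
    show "AE \<omega> in M. size_restricted_mean (card W) g W (\<eta> \<omega>) = ?c * ennreal (expneg (\<integral>\<^sup>+y. ?L y \<partial>count_space (\<eta> \<omega>)))"
    proof eventually_elim
      case (elim \<omega>)
      from size_restricted_mean_cut[OF g W P.points_lf[OF elim(2)] elim(1)] show ?case .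
    qed
  qed
  also have "\<dots> = ?c * (\<integral>\<^sup>+\<omega>. ennreal (expneg (\<integral>\<^sup>+y. ?L y \<partial>count_space (\<eta> \<omega>))) \<partial>M)"
    by (rule nn_integral_cmult[OF Lm])
  also have "(\<integral>\<^sup>+\<omega>. ennreal (expneg (\<integral>\<^sup>+y. ?L y \<partial>count_space (\<eta> \<omega>))) \<partial>M)
      = ennreal (expneg (\<integral>\<^sup>+y. ennreal (1 - expneg (?L y)) \<partial>scale_measure (ennreal t) lam))"
    by (rule P.laplace_functional[OF L])
  also have "(\<integral>\<^sup>+y. ennreal (1 - expneg (?L y)) \<partial>scale_measure (ennreal t) lam) = ennreal t * (\<integral>\<^sup>+y. ennreal (1 - expneg (?L y)) \<partial>lam)"
    by (intro nn_integral_intensity measurable_compose[OF _ measurable_ennreal] borel_measurable_diff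
      borel_measurable_const measurable_compose[OF L measurable_expneg])
  also have "(\<integral>\<^sup>+y. ennreal (1 - expneg (?L y)) \<partial>lam) = phi_lam (insert v W)"
    unfolding phi_lam_def
  proof (rule nn_integral_cong)
    fix y
    have "unit_prod (\<lambda>x. 1 - \<phi> y x) (insert v W) = expneg (\<integral>\<^sup>+x. neglog (\<phi> y x) \<partial>count_space (insert v W))"
      using W by (intro unit_prod_phi_eq_expneg countable_finite) simp
    also have "(\<integral>\<^sup>+x. neglog (\<phi> y x) \<partial>count_space (insert v W)) = ?L y"
      using W by (intro nn_integral_count_space_finite) simp
    finally show "ennreal (1 - expneg (?L y)) = ennreal (1 - unit_prod (\<lambda>x. 1 - \<phi> y x) (insert v W))" by simp
  qed
  finally show ?thesis .
qed

end


section \<open>Change of the intensity\<close>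

text \<open>The density contributed by the void probability. The value \<open>0\<close> at infinity is the right one for either sign
  of \<open>d\<close>: a component for which \<open>\<phi>\<^sub>\<lambda>\<close> is infinite has probability \<open>0\<close> at every positive
  intensity.\<close>

definition exp_weight :: "real \<Rightarrow> ennreal \<Rightarrow> ennreal" where
  "exp_weight d a = (if a = \<infinity> then 0 else ennreal (exp (- d * enn2real a)))"

lemma measurable_exp_weight [measurable]: "exp_weight d \<in> borel_measurable borel"
  unfolding exp_weight_def[abs_def] by measurable

lemma exp_weight_mult_expneg:
  assumes "0 < s" "0 < t"
  shows "exp_weight (s - t) a * ennreal (expneg (ennreal t * a)) = ennreal (expneg (ennreal s * a))"
proof (cases "a = \<infinity>")
  case True
  then show ?thesis using assms by (simp add: exp_weight_def ennreal_mult_top)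
next
  case False
  then obtain r where r: "a = ennreal r" "0 \<le> r" by (cases a) auto
  then show ?thesis using assms
    by (simp add: exp_weight_def expneg_ennreal ennreal_mult[symmetric] exp_add[symmetric] algebra_simps)
qed

context connection_model
begin

lemma measurable_component_phi_lam:
  "(\<lambda>\<mu>. phi_lam (verts \<mu>)) \<in> borel_measurable graph_space"
  by (rule measurable_phi_lam[OF measurable_verts[OF measurable_ident_sets[OF refl]]])

text \<open>By induction on the number \<open>k\<close> of vertices still to be selected. Once all are selected the two sides differ by
  the void probability only, and each selection contributes one factor of the intensity.\<close>

lemma palm_mean_change_intensity:
  assumes s: "poisson_rcm \<phi> lam v M \<eta> \<xi> s" and t: "poisson_rcm \<phi> lam v M' \<eta>' \<xi>' t"
    and g: "g \<in> borel_measurable graph_space"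
    and W: "finite W" "v \<notin> W" "card W + k = m"
  shows "ennreal t ^ k * poisson_rcm.palm_mean \<phi> v M \<eta> m g W
    = ennreal s ^ k * poisson_rcm.palm_mean \<phi> v M' \<eta>' m (\<lambda>\<mu>. g \<mu> * exp_weight (s - t) (phi_lam (verts \<mu>))) W"
  using W
proof (induction k arbitrary: W)
  interpret S: poisson_rcm \<phi> lam v M \<eta> \<xi> s by fact
  interpret T: poisson_rcm \<phi> lam v M' \<eta>' \<xi>' t by fact
  let ?g = "\<lambda>\<mu>. g \<mu> * exp_weight (s - t) (phi_lam (verts \<mu>))"
  have gm: "?g \<in> borel_measurable graph_space"
    by (intro borel_measurable_times_ennreal[OF g] measurable_compose[OF measurable_component_phi_lam measurable_exp_weight])
  {
    case 0
    let ?K = "random_edges_law \<phi> (insert v W)"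
    let ?f = "\<lambda>\<mu>. of_bool (component_verts v \<mu> = insert v W) * g (component v \<mu>)"
    have m: "card W = m" using 0 by simp
    have fin: "finite (insert v W)" using 0 by simp
    have fm: "?f \<in> borel_measurable graph_space"
      by (intro borel_measurable_times_ennreal measurable_of_bool_ennreal pred_component_verts_eq fin
        measurable_compose[OF measurable_component g])
    then have fm': "?f \<in> borel_measurable ?K"
      by (rule measurable_cong_sets[OF sets_random_edges_law refl, THEN equalityD2, THEN subsetD])
    have "(\<integral>\<^sup>+\<mu>. of_bool (component_verts v \<mu> = insert v W) * ?g (component v \<mu>) \<partial>?K)
      = (\<integral>\<^sup>+\<mu>. ?f \<mu> * exp_weight (s - t) (phi_lam (insert v W)) \<partial>?K)"
      by (intro nn_integral_cong) (auto simp: of_bool_def)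
    also have "\<dots> = (\<integral>\<^sup>+\<mu>. ?f \<mu> \<partial>?K) * exp_weight (s - t) (phi_lam (insert v W))"
      by (rule nn_integral_multc[OF fm'])
    finally have "T.palm_mean (card W) ?g W = (\<integral>\<^sup>+\<mu>. ?f \<mu> \<partial>?K) *
        (exp_weight (s - t) (phi_lam (insert v W)) * ennreal (expneg (ennreal t * phi_lam (insert v W))))"
      unfolding T.palm_mean_full[OF gm 0(1,2)] by (simp only: mult.assoc)
    also have "\<dots> = S.palm_mean (card W) g W"
      unfolding S.palm_mean_full[OF g 0(1,2)] exp_weight_mult_expneg[OF S.t_pos T.t_pos] ..
    finally show ?case by (simp add: m)
  next
    case (Suc k)
    have k: "m - card W = Suc k" using Suc.prems by simp
    have step: "(\<integral>\<^sup>+x. ennreal t ^ k * S.palm_mean m g (insert x W) \<partial>lam)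
       = (\<integral>\<^sup>+x. ennreal s ^ k * T.palm_mean m ?g (insert x W) \<partial>lam)"
    proof (rule nn_integral_cong_AE)
      have "finite (insert v W)" using Suc.prems by simp
      from AE_lam_notin[OF this]
      show "AE x in lam. ennreal t ^ k * S.palm_mean m g (insert x W) = ennreal s ^ k * T.palm_mean m ?g (insert x W)"
      proof eventually_elim
        case (elim x)
        then show ?case using Suc.prems by (intro Suc.IH) auto
      qed
    qed
    have pS: "(\<lambda>x. S.palm_mean m g (insert x W)) \<in> borel_measurable lam"
      and pT: "(\<lambda>x. T.palm_mean m ?g (insert x W)) \<in> borel_measurable lam"
      unfolding measurable_lam_iff
      by (rule S.measurable_palm_mean[OF g Suc.prems(1)], rule T.measurable_palm_mean[OF gm Suc.prems(1)])
    have "of_nat (Suc k) * (ennreal t ^ Suc k * S.palm_mean m g W)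
        = ennreal t ^ Suc k * (of_nat (m - card W) * S.palm_mean m g W)"
      unfolding k by (simp only: mult.left_commute)
    also have "\<dots> = ennreal t ^ Suc k * (ennreal s * (\<integral>\<^sup>+x. S.palm_mean m g (insert x W) \<partial>lam))"
      by (simp only: S.palm_mean_step[OF g Suc.prems(1,2)])
    also have "\<dots> = ennreal t * ennreal s * (ennreal t ^ k * (\<integral>\<^sup>+x. S.palm_mean m g (insert x W) \<partial>lam))"
      by (simp only: power_Suc ac_simps)
    also have "ennreal t ^ k * (\<integral>\<^sup>+x. S.palm_mean m g (insert x W) \<partial>lam)
        = ennreal s ^ k * (\<integral>\<^sup>+x. T.palm_mean m ?g (insert x W) \<partial>lam)"
      using step unfolding nn_integral_cmult[OF pS] nn_integral_cmult[OF pT] .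
    also have "ennreal t * ennreal s * (ennreal s ^ k * (\<integral>\<^sup>+x. T.palm_mean m ?g (insert x W) \<partial>lam))
        = ennreal s ^ Suc k * (ennreal t * (\<integral>\<^sup>+x. T.palm_mean m ?g (insert x W) \<partial>lam))"
      by (simp only: power_Suc ac_simps)
    also have "\<dots> = ennreal s ^ Suc k * (of_nat (m - card W) * T.palm_mean m ?g W)"
      by (simp only: T.palm_mean_step[OF gm Suc.prems(1,2)])
    also have "\<dots> = of_nat (Suc k) * (ennreal s ^ Suc k * T.palm_mean m ?g W)"
      unfolding k by (simp only: mult.left_commute)
    finally show ?case
      by (subst (asm) ennreal_mult_cancel_left) (auto simp: of_nat_less_top)
  }
qed

theorem change_intensity:
  assumes s: "poisson_rcm \<phi> lam v M \<eta> \<xi> s" and t: "poisson_rcm \<phi> lam v M' \<eta>' \<xi>' t"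
    and g: "g \<in> borel_measurable graph_space"
  shows "ennreal t ^ m * (\<integral>\<^sup>+\<omega>. of_bool (gsize (component v (\<xi> \<omega>)) = of_nat (Suc m)) * g (component v (\<xi> \<omega>)) \<partial>M)
    = ennreal s ^ m * (\<integral>\<^sup>+\<omega>. of_bool (gsize (component v (\<xi>' \<omega>)) = of_nat (Suc m)) *
        (g (component v (\<xi>' \<omega>)) * exp_weight (s - t) (phi_lam (component_verts v (\<xi>' \<omega>)))) \<partial>M')"
proof -
  interpret S: poisson_rcm \<phi> lam v M \<eta> \<xi> s by fact
  interpret T: poisson_rcm \<phi> lam v M' \<eta>' \<xi>' t by fact
  let ?g = "\<lambda>\<mu>. g \<mu> * exp_weight (s - t) (phi_lam (verts \<mu>))"
  have gm: "?g \<in> borel_measurable graph_space"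
    by (intro borel_measurable_times_ennreal[OF g] measurable_compose[OF measurable_component_phi_lam measurable_exp_weight])
  have "ennreal t ^ m * S.palm_mean m g {} = ennreal s ^ m * T.palm_mean m ?g {}"
    by (rule palm_mean_change_intensity[OF s t g]) simp_all
  then show ?thesis unfolding S.palm_mean_empty[OF g] T.palm_mean_empty[OF gm] verts_component .
qed

end

section \<open>Deleting a vertex of the component\<close>

context poisson_rcm
begin

lemma measurable_component_delete:
  assumes g: "g \<in> borel_measurable graph_space"
    and \<mu>: "\<mu> \<in> measurable N graph_space" and x: "x \<in> measurable N borel"
  shows "(\<lambda>\<omega>. g (component v (delete_vertex (x \<omega>) (\<mu> \<omega>)))) \<in> borel_measurable N"
  by (rule measurable_compose[OF measurable_compose[OF measurable_delete_vertex[OF \<mu> x] measurable_component] g])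

lemma measurable_sum_delete:
  assumes g: "g \<in> borel_measurable graph_space"
  shows "(\<lambda>\<mu>. \<integral>\<^sup>+x. g (component v (delete_vertex x \<mu>)) \<partial>count_space (component_verts v \<mu> - {v}))
    \<in> borel_measurable graph_space"
proof -
  have V: "(\<lambda>\<mu>. component_verts v \<mu> - {v}) \<in> measurable graph_space (point_space :: 'a set measure)"
    by (rule measurable_delete_point[OF measurable_component_verts measurable_const]) simp
  have "(\<lambda>p. g (component v (delete_vertex (snd p) (fst p)))) \<in> borel_measurable (graph_space \<Otimes>\<^sub>M borel)"
    by (rule measurable_component_delete[OF g measurable_fst measurable_snd])
  from point_sum_measurable[OF V this] show ?thesis by (simp only: fst_conv snd_conv)
qed

text \<open>By the Mecke equation the sum over the points of the component becomes an integral over an added point \<open>x\<close>,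
  and deleting \<open>x\<close> restores the original graph. The integrand is the probability that \<open>x\<close> is joined
  to the component of \<open>v\<close>; its integral over \<open>x\<close> is \<open>\<phi>\<^sub>\<lambda>\<close>.\<close>

theorem mean_sum_delete:
  assumes g: "g \<in> borel_measurable graph_space"
  shows "(\<integral>\<^sup>+\<omega>. \<integral>\<^sup>+x. g (component v (delete_vertex x (\<xi> \<omega>))) \<partial>count_space (component_verts v (\<xi> \<omega>) - {v}) \<partial>M)
    = ennreal t * (\<integral>\<^sup>+\<omega>. g (component v (\<xi> \<omega>)) * phi_lam (component_verts v (\<xi> \<omega>)) \<partial>M)"
proof -
  define D where "D \<mu> = (\<integral>\<^sup>+x. g (component v (delete_vertex x \<mu>)) \<partial>count_space (component_verts v \<mu> - {v}))" for \<mu>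
  define F where "F x \<mu> = of_bool (x \<in> component_verts v \<mu>) * g (component v (delete_vertex x \<mu>))" for x \<mu>
  define h where "h p = (\<integral>\<^sup>+\<mu>. F (fst p) \<mu> \<partial>random_edges_law \<phi> (insert v (insert (fst p) (snd p))))" for p
  let ?B = "borel \<Otimes>\<^sub>M (point_space :: 'a set measure)"
  have Dm: "D \<in> borel_measurable graph_space" unfolding D_def[abs_def] by (rule measurable_sum_delete[OF g])
  have Fm2: "(\<lambda>(p, \<mu>). F (fst p) \<mu>) \<in> borel_measurable (?B \<Otimes>\<^sub>M graph_space)"
    unfolding F_def case_prod_unfold
    by (intro borel_measurable_times_ennreal measurable_of_bool_ennreal pred_component_verts
      measurable_component_delete[OF g] measurable_snd measurable_compose[OF measurable_fst measurable_fst])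
  have Fm: "F x \<in> borel_measurable graph_space" for x
    unfolding F_def[abs_def]
    by (intro borel_measurable_times_ennreal measurable_of_bool_ennreal pred_component_verts
      measurable_component_delete[OF g] measurable_ident_sets[OF refl] measurable_const) simp_all
  have Fm': "F x \<in> borel_measurable (random_edges_law \<phi> U)" for x U
    using Fm by (rule measurable_cong_sets[OF sets_random_edges_law refl, THEN equalityD2, THEN subsetD])
  have hm: "h \<in> borel_measurable ?B"
    unfolding h_def[abs_def]
  proof (rule nn_integral_measurable_subprob_algebra2[OF Fm2])
    show "(\<lambda>p. random_edges_law \<phi> (insert v (insert (fst p) (snd p)))) \<in> measurable ?B (subprob_algebra graph_space)"
      by (intro measurable_compose[OF _ measurable_random_edges_law_subprob] measurable_insert_point
        measurable_fst measurable_snd measurable_const) simp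
  qed
  have "(\<integral>\<^sup>+\<omega>. D (\<xi> \<omega>) \<partial>M) = (\<integral>\<^sup>+\<omega>. \<integral>\<^sup>+\<mu>. D \<mu> \<partial>random_edges_law \<phi> (insert v (\<eta> \<omega>)) \<partial>M)"
    by (rule nn_integral_xi[OF Dm])
  also have "\<dots> = (\<integral>\<^sup>+\<omega>. \<integral>\<^sup>+x. h (x, \<eta> \<omega> - {x}) \<partial>count_space (\<eta> \<omega>) \<partial>M)"
  proof (rule nn_integral_cong_AE)
    show "AE \<omega> in M. (\<integral>\<^sup>+\<mu>. D \<mu> \<partial>random_edges_law \<phi> (insert v (\<eta> \<omega>))) = (\<integral>\<^sup>+x. h (x, \<eta> \<omega> - {x}) \<partial>count_space (\<eta> \<omega>))"
      using P.AE_notin_points[of v] AE_space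
    proof eventually_elim
      case (elim \<omega>)
      let ?V = "\<eta> \<omega>" and ?K = "random_edges_law \<phi> (insert v (\<eta> \<omega>))"
      have lf: "locally_finite_set (insert v ?V)" using P.points_lf[OF elim(2)] by simp
      have cV: "countable ?V" by (rule locally_finite_set_countable[OF P.points_lf[OF elim(2)]])
      have Sm: "(\<lambda>\<mu>. \<integral>\<^sup>+x. F x \<mu> \<partial>count_space ?V) \<in> borel_measurable graph_space"
      proof -
        have V: "(\<lambda>\<mu>. ?V) \<in> measurable graph_space (point_space :: 'a set measure)"
          using P.points_lf[OF elim(2)] by (intro measurable_const) (simp add: space_point_space)
        have "(\<lambda>p. F (snd p) (fst p)) \<in> borel_measurable (graph_space \<Otimes>\<^sub>M borel)"
          unfolding F_def
          by (intro borel_measurable_times_ennreal measurable_of_bool_ennreal pred_component_verts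
            measurable_component_delete[OF g] measurable_snd measurable_fst)
        from point_sum_measurable[OF V this] show ?thesis by (simp only: fst_conv snd_conv)
      qed
      have "(\<integral>\<^sup>+\<mu>. D \<mu> \<partial>?K) = (\<integral>\<^sup>+\<mu>. \<integral>\<^sup>+x. F x \<mu> \<partial>count_space ?V \<partial>?K)"
      proof (rule nn_integral_random_edges_law_cong[OF lf Dm Sm])
        fix \<mu> :: "'a graph" assume \<mu>: "verts \<mu> = insert v ?V"
        have "component_verts v \<mu> - {v} = {x \<in> ?V. x \<in> component_verts v \<mu>}"
          using component_verts_subset[of v \<mu>] \<mu> elim(1) by auto
        then show "D \<mu> = (\<integral>\<^sup>+x. F x \<mu> \<partial>count_space ?V)"
          unfolding D_def F_def nn_integral_count_space_filter by (simp only:)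
      qed
      also have "\<dots> = (\<integral>\<^sup>+x. \<integral>\<^sup>+\<mu>. F x \<mu> \<partial>?K \<partial>count_space ?V)"
        by (rule nn_integral_count_space_nn_integral[OF cV Fm'])
      also have "\<dots> = (\<integral>\<^sup>+x. h (x, ?V - {x}) \<partial>count_space ?V)"
        by (intro nn_integral_cong) (simp add: h_def insert_absorb)
      finally show ?case .
    qed
  qed
  also have "\<dots> = (\<integral>\<^sup>+x. \<integral>\<^sup>+\<omega>. h (x, \<eta> \<omega>) \<partial>M \<partial>scale_measure (ennreal t) lam)"
    by (rule P.mecke_reduced[OF hm])
  also have "\<dots> = ennreal t * (\<integral>\<^sup>+x. \<integral>\<^sup>+\<omega>. h (x, \<eta> \<omega>) \<partial>M \<partial>lam)"
  proof (rule nn_integral_intensity)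
    have "(\<lambda>p. (fst p, \<eta> (snd p))) \<in> measurable (borel \<Otimes>\<^sub>M M) ?B"
      by (intro measurable_Pair measurable_fst measurable_compose[OF measurable_snd P.measurable_points])
    from P.borel_measurable_nn_integral_fst[OF measurable_compose[OF this hm]]
    show "(\<lambda>x. \<integral>\<^sup>+\<omega>. h (x, \<eta> \<omega>) \<partial>M) \<in> borel_measurable borel" by (simp only: fst_conv snd_conv)
  qed
  also have "(\<integral>\<^sup>+x. \<integral>\<^sup>+\<omega>. h (x, \<eta> \<omega>) \<partial>M \<partial>lam)
     = (\<integral>\<^sup>+x. \<integral>\<^sup>+\<omega>. g (component v (\<xi> \<omega>)) * ennreal (1 - unit_prod (\<lambda>y. 1 - \<phi> x y) (component_verts v (\<xi> \<omega>))) \<partial>M \<partial>lam)"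
  proof (rule nn_integral_cong_AE)
    have "finite {v}" by simp
    from AE_lam_notin[OF this]
    show "AE x in lam. (\<integral>\<^sup>+\<omega>. h (x, \<eta> \<omega>) \<partial>M)
       = (\<integral>\<^sup>+\<omega>. g (component v (\<xi> \<omega>)) * ennreal (1 - unit_prod (\<lambda>y. 1 - \<phi> x y) (component_verts v (\<xi> \<omega>))) \<partial>M)"
    proof eventually_elim
      case (elim x)
      let ?G = "\<lambda>\<mu>. g (component v \<mu>) * ennreal (1 - unit_prod (\<lambda>y. 1 - \<phi> x y) (component_verts v \<mu>))"
      have Gm: "?G \<in> borel_measurable graph_space"
        by (intro borel_measurable_times_ennreal measurable_compose[OF measurable_component g]
          measurable_compose[OF _ measurable_ennreal] borel_measurable_diff borel_measurable_const
          measurable_unit_prod_phi[OF measurable_component_verts, where x="\<lambda>_. x"] measurable_const) simp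
      have "(\<integral>\<^sup>+\<omega>. h (x, \<eta> \<omega>) \<partial>M) = (\<integral>\<^sup>+\<omega>. \<integral>\<^sup>+\<mu>. ?G \<mu> \<partial>random_edges_law \<phi> (insert v (\<eta> \<omega>)) \<partial>M)"
      proof (rule nn_integral_cong_AE)
        show "AE \<omega> in M. h (x, \<eta> \<omega>) = (\<integral>\<^sup>+\<mu>. ?G \<mu> \<partial>random_edges_law \<phi> (insert v (\<eta> \<omega>)))"
          using P.AE_notin_points[of x] AE_space
        proof eventually_elim
          case (elim \<omega>)
          have "h (x, \<eta> \<omega>) = (\<integral>\<^sup>+\<mu>. F x \<mu> \<partial>random_edges_law \<phi> (insert x (insert v (\<eta> \<omega>))))"
            unfolding h_def by (simp only: fst_conv snd_conv insert_commute[of v x])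
          also have "\<dots> = (\<integral>\<^sup>+\<mu>. ?G \<mu> \<partial>random_edges_law \<phi> (insert v (\<eta> \<omega>)))"
            unfolding F_def using elim P.points_lf[OF elim(2)] \<open>x \<notin> {v}\<close>
            by (intro random_edges_law_add_vertex g) auto
          finally show ?case .
        qed
      qed
      also have "\<dots> = (\<integral>\<^sup>+\<omega>. ?G (\<xi> \<omega>) \<partial>M)" by (rule nn_integral_xi[OF Gm, symmetric])
      finally show ?case .
    qed
  qed
  also have "\<dots> = (\<integral>\<^sup>+\<omega>. \<integral>\<^sup>+x. g (component v (\<xi> \<omega>)) * ennreal (1 - unit_prod (\<lambda>y. 1 - \<phi> x y) (component_verts v (\<xi> \<omega>))) \<partial>lam \<partial>M)"
  proof -
    interpret L: sigma_finite_measure lam by (rule sigma_finite_lam)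
    interpret PS: pair_sigma_finite M lam by unfold_locales
    have s: "snd \<in> measurable (M \<Otimes>\<^sub>M lam) borel"
      using measurable_snd[of M lam] measurable_cong_sets[OF refl lam_borel, of "M \<Otimes>\<^sub>M lam"] by blast
    have x1: "(\<lambda>p. \<xi> (fst p)) \<in> measurable (M \<Otimes>\<^sub>M lam) graph_space"
      by (rule measurable_compose[OF measurable_fst measurable_xi])
    have "(\<lambda>p. g (component v (\<xi> (fst p))) * ennreal (1 - unit_prod (\<lambda>y. 1 - \<phi> (snd p) y) (component_verts v (\<xi> (fst p)))))
        \<in> borel_measurable (M \<Otimes>\<^sub>M lam)"
      by (intro borel_measurable_times_ennreal measurable_compose[OF measurable_compose[OF x1 measurable_component] g]
        measurable_compose[OF _ measurable_ennreal] borel_measurable_diff borel_measurable_const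
        measurable_unit_prod_phi[where x=snd, OF measurable_compose[OF x1 measurable_component_verts] s])
    from PS.Fubini[OF this] show ?thesis by (simp only: fst_conv snd_conv)
  qed
  also have "\<dots> = (\<integral>\<^sup>+\<omega>. g (component v (\<xi> \<omega>)) * phi_lam (component_verts v (\<xi> \<omega>)) \<partial>M)"
  proof (rule nn_integral_cong)
    fix \<omega> assume \<omega>: "\<omega> \<in> space M"
    let ?C = "component_verts v (\<xi> \<omega>)"
    have "locally_finite_set ?C"
      using measurable_point_lf[OF measurable_compose[OF measurable_xi measurable_component_verts] \<omega>] .
    then have "(\<lambda>x :: 'a. ?C) \<in> measurable borel point_space"
      by (intro measurable_const) (simp add: space_point_space)
    from measurable_unit_prod_phi[OF this measurable_ident_sets[OF refl]]
    have "(\<lambda>x. ennreal (1 - unit_prod (\<lambda>y. 1 - \<phi> x y) ?C)) \<in> borel_measurable lam"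
      unfolding measurable_lam_iff
      by (intro measurable_compose[OF _ measurable_ennreal] borel_measurable_diff borel_measurable_const)
    then show "(\<integral>\<^sup>+x. g (component v (\<xi> \<omega>)) * ennreal (1 - unit_prod (\<lambda>y. 1 - \<phi> x y) ?C) \<partial>lam)
        = g (component v (\<xi> \<omega>)) * phi_lam ?C"
      unfolding phi_lam_def by (rule nn_integral_cmult)
  qed
  finally show ?thesis by (simp only: D_def)
qed

end


section \<open>Differentiating exponential transforms\<close>

lemma exp_minus_diff_bound:
  fixes a :: real
  assumes c: "0 < c" "c \<le> y" "c \<le> u" and a: "0 \<le> a"
  shows "\<bar>exp (- (y * a)) - exp (- (u * a))\<bar> \<le> \<bar>y - u\<bar> / c"
proof -
  have main: "exp (- (y * a)) - exp (- (u * a)) \<le> (u - y) / c" if "c \<le> y" "y \<le> u" for y u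
  proof -
    have "1 - (u - y) * a \<le> exp (- ((u - y) * a))" using exp_ge_add_one_self[of "- ((u - y) * a)"] by simp
    then have "exp (- (y * a)) * (1 - exp (- ((u - y) * a))) \<le> exp (- (y * a)) * ((u - y) * a)"
      by (intro mult_left_mono) auto
    also have "\<dots> \<le> exp (- (c * a)) * ((u - y) * a)"
      using that a by (intro mult_right_mono) (auto intro: mult_right_mono)
    also have "\<dots> \<le> (u - y) / c"
    proof -
      have "c * a \<le> exp (c * a)" using exp_ge_add_one_self[of "c * a"] by linarith
      then have "c * a * exp (- (c * a)) \<le> exp (c * a) * exp (- (c * a))" by (rule mult_right_mono) simp
      then have "c * a * exp (- (c * a)) \<le> 1" by (simp add: exp_minus)
      then have "(u - y) * (c * a * exp (- (c * a))) \<le> (u - y) * 1"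
        using that by (intro mult_left_mono) auto
      then show ?thesis using c(1) by (simp add: field_simps)
    qed
    also have "exp (- (y * a)) * (1 - exp (- ((u - y) * a))) = exp (- (y * a)) - exp (- (u * a))"
      by (simp add: right_diff_distrib exp_add[symmetric] algebra_simps)
    finally show ?thesis .
  qed
  have mono: "exp (- (u * a)) \<le> exp (- (y * a))" if "y \<le> u" for y u
    using that a by (simp add: mult_right_mono)
  have sym: "\<bar>exp (- (y * a)) - exp (- (u * a))\<bar> \<le> \<bar>y - u\<bar> / c" if "c \<le> y" "y \<le> u" for y u
    using main[OF that] mono[OF that(2)] that(2) by (simp add: abs_if)
  show ?thesis
    using sym[of y u] sym[of u y] c by (cases "y \<le> u") (auto simp: abs_minus_commute)
qed

lemma mult_exp_minus_le:
  fixes a :: real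
  assumes "0 < u" "0 \<le> a"
  shows "a * exp (- (u * a)) \<le> 1 / u"
proof -
  have "u * a \<le> exp (u * a)" using exp_ge_add_one_self[of "u * a"] by linarith
  then have "u * a * exp (- (u * a)) \<le> exp (u * a) * exp (- (u * a))" by (rule mult_right_mono) simp
  then have "u * a * exp (- (u * a)) \<le> 1" by (simp add: exp_minus)
  then show ?thesis using assms by (simp add: field_simps)
qed

text \<open>The difference quotients of \<open>exp (- y a)\<close> are bounded by \<open>2 / u\<close> for all \<open>y > u / 2\<close>, uniformly in
  \<open>a \<ge> 0\<close>. So a multiple of \<open>|F|\<close> dominates them after multiplication by \<open>F\<close>, even where \<open>F a\<close> is
  not integrable.\<close>

lemma exp_transform:
  fixes F a :: "'w \<Rightarrow> real"
  assumes F: "integrable M F" and a [measurable]: "a \<in> borel_measurable M" and nonneg: "\<And>\<omega>. 0 \<le> a \<omega>"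
    and u: "0 < u"
  shows integrable_exp_transform: "integrable M (\<lambda>\<omega>. F \<omega> * a \<omega> * exp (- (u * a \<omega>)))"
    and has_derivative_exp_transform: "((\<lambda>u. \<integral>\<omega>. F \<omega> * exp (- (u * a \<omega>)) \<partial>M) has_real_derivative
      - (\<integral>\<omega>. F \<omega> * a \<omega> * exp (- (u * a \<omega>)) \<partial>M)) (at u)"
proof -
  have Fm [measurable]: "F \<in> borel_measurable M" using F by (rule borel_measurable_integrable)
  have dom: "integrable M (\<lambda>\<omega>. \<bar>F \<omega>\<bar> * c)" for c :: real using F by (intro integrable_mult_left) simp
  show int1: "integrable M (\<lambda>\<omega>. F \<omega> * a \<omega> * exp (- (u * a \<omega>)))"
  proof (rule Bochner_Integration.integrable_bound[OF dom[of "1 / u"]])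
    show "AE \<omega> in M. norm (F \<omega> * a \<omega> * exp (- (u * a \<omega>))) \<le> norm (\<bar>F \<omega>\<bar> * (1 / u))"
    proof (rule AE_I2)
      fix \<omega>
      have "\<bar>F \<omega>\<bar> * (a \<omega> * exp (- (u * a \<omega>))) \<le> \<bar>F \<omega>\<bar> * (1 / u)"
        by (intro mult_left_mono mult_exp_minus_le u nonneg) simp
      then show "norm (F \<omega> * a \<omega> * exp (- (u * a \<omega>))) \<le> norm (\<bar>F \<omega>\<bar> * (1 / u))"
        using nonneg[of \<omega>] u by (simp add: abs_mult mult.assoc)
    qed
  qed measurable
  have int0: "integrable M (\<lambda>\<omega>. F \<omega> * exp (- (y * a \<omega>)))" if "0 \<le> y" for y
  proof (rule Bochner_Integration.integrable_bound[OF dom[of 1]])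
    show "AE \<omega> in M. norm (F \<omega> * exp (- (y * a \<omega>))) \<le> norm (\<bar>F \<omega>\<bar> * 1)"
      using nonneg that by (intro AE_I2) (simp add: abs_mult mult_left_le)
  qed measurable
  let ?S = "{u / 2<..}"
  have "((\<lambda>u. \<integral>\<omega>. F \<omega> * exp (- (u * a \<omega>)) \<partial>M) has_real_derivative
      - (\<integral>\<omega>. F \<omega> * a \<omega> * exp (- (u * a \<omega>)) \<partial>M)) (at u within ?S)"
    unfolding has_field_derivative_iff tendsto_at_iff_sequentially
  proof (intro allI impI)
    fix X :: "nat \<Rightarrow> real"
    assume X: "\<forall>i. X i \<in> ?S - {u}" "X \<longlonglongrightarrow> u"
    define q where "q i \<omega> = F \<omega> * ((exp (- (X i * a \<omega>)) - exp (- (u * a \<omega>))) / (X i - u))" for i \<omega>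
    have "(\<lambda>i. \<integral>\<omega>. q i \<omega> \<partial>M) \<longlonglongrightarrow> (\<integral>\<omega>. F \<omega> * (- a \<omega> * exp (- (u * a \<omega>))) \<partial>M)"
    proof (rule integral_dominated_convergence[OF _ _ dom[of "2 / u"]])
      show "AE \<omega> in M. (\<lambda>i. q i \<omega>) \<longlonglongrightarrow> F \<omega> * (- a \<omega> * exp (- (u * a \<omega>)))"
      proof (rule AE_I2)
        fix \<omega>
        have "((\<lambda>y. exp (- (y * a \<omega>))) has_real_derivative - a \<omega> * exp (- (u * a \<omega>))) (at u within ?S)"
          by (auto intro!: derivative_eq_intros)
        then have "(\<lambda>i. (exp (- (X i * a \<omega>)) - exp (- (u * a \<omega>))) / (X i - u)) \<longlonglongrightarrow> - a \<omega> * exp (- (u * a \<omega>))"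
          unfolding has_field_derivative_iff tendsto_at_iff_sequentially using X by (auto simp: comp_def)
        then show "(\<lambda>i. q i \<omega>) \<longlonglongrightarrow> F \<omega> * (- a \<omega> * exp (- (u * a \<omega>)))"
          unfolding q_def by (rule tendsto_mult_left)
      qed
      show "AE \<omega> in M. norm (q i \<omega>) \<le> \<bar>F \<omega>\<bar> * (2 / u)" for i
      proof (rule AE_I2)
        fix \<omega>
        have Xi: "u / 2 \<le> X i" "X i \<noteq> u" using X(1) by (auto simp: less_imp_le)
        have "\<bar>exp (- (X i * a \<omega>)) - exp (- (u * a \<omega>))\<bar> \<le> \<bar>X i - u\<bar> / (u / 2)"
          using u Xi nonneg by (intro exp_minus_diff_bound) auto
        then have "\<bar>exp (- (X i * a \<omega>)) - exp (- (u * a \<omega>))\<bar> / \<bar>X i - u\<bar> \<le> 2 / u"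
          using Xi u by (simp add: field_simps)
        then have "\<bar>F \<omega>\<bar> * (\<bar>exp (- (X i * a \<omega>)) - exp (- (u * a \<omega>))\<bar> / \<bar>X i - u\<bar>) \<le> \<bar>F \<omega>\<bar> * (2 / u)"
          by (intro mult_left_mono) auto
        then show "norm (q i \<omega>) \<le> \<bar>F \<omega>\<bar> * (2 / u)" by (simp add: q_def abs_mult abs_divide)
      qed
    qed (auto simp: q_def)
    moreover have "(\<integral>\<omega>. q i \<omega> \<partial>M) = ((\<integral>\<omega>. F \<omega> * exp (- (X i * a \<omega>)) \<partial>M) - (\<integral>\<omega>. F \<omega> * exp (- (u * a \<omega>)) \<partial>M)) / (X i - u)" for i
    proof -
      have "0 \<le> X i" using X(1) u by (auto simp: less_imp_le intro: order_trans[of 0 "u / 2"])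
      then have "((\<integral>\<omega>. F \<omega> * exp (- (X i * a \<omega>)) \<partial>M) - (\<integral>\<omega>. F \<omega> * exp (- (u * a \<omega>)) \<partial>M)) / (X i - u)
        = (\<integral>\<omega>. (F \<omega> * exp (- (X i * a \<omega>)) - F \<omega> * exp (- (u * a \<omega>))) / (X i - u) \<partial>M)"
        using int0[of "X i"] int0[of u] u by simp
      also have "\<dots> = (\<integral>\<omega>. q i \<omega> \<partial>M)" by (simp add: q_def right_diff_distrib)
      finally show ?thesis ..
    qed
    moreover have "(\<integral>\<omega>. F \<omega> * (- a \<omega> * exp (- (u * a \<omega>))) \<partial>M) = - (\<integral>\<omega>. F \<omega> * a \<omega> * exp (- (u * a \<omega>)) \<partial>M)"
      by (simp add: mult.assoc)
    ultimately show "((\<lambda>y. ((\<integral>\<omega>. F \<omega> * exp (- (y * a \<omega>)) \<partial>M) - (\<integral>\<omega>. F \<omega> * exp (- (u * a \<omega>)) \<partial>M)) / (y - u)) \<circ> X)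
        \<longlonglongrightarrow> - (\<integral>\<omega>. F \<omega> * a \<omega> * exp (- (u * a \<omega>)) \<partial>M)"
      by (simp add: comp_def)
  qed
  then show "((\<lambda>u. \<integral>\<omega>. F \<omega> * exp (- (u * a \<omega>)) \<partial>M) has_real_derivative
      - (\<integral>\<omega>. F \<omega> * a \<omega> * exp (- (u * a \<omega>)) \<partial>M)) (at u)"
    using u by (subst (asm) at_within_open) auto
qed

text \<open>An identity for nonnegative functionals passes to signed ones through their positive and negative
  parts.\<close>

lemma signed_transfer:
  fixes f :: "'a \<Rightarrow> real" and g :: "'b \<Rightarrow> real"
  assumes f: "f \<in> borel_measurable M" and g: "integrable N g" and c: "0 \<le> c"
    and pos: "(\<integral>\<^sup>+x. ennreal (f x) \<partial>M) = ennreal c * (\<integral>\<^sup>+x. ennreal (g x) \<partial>N)"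
    and neg: "(\<integral>\<^sup>+x. ennreal (- f x) \<partial>M) = ennreal c * (\<integral>\<^sup>+x. ennreal (- g x) \<partial>N)"
  shows "integrable M f" and "(\<integral>x. f x \<partial>M) = c * (\<integral>x. g x \<partial>N)"
proof -
  have fin: "(\<integral>\<^sup>+x. ennreal (g x) \<partial>N) < \<infinity>" "(\<integral>\<^sup>+x. ennreal (- g x) \<partial>N) < \<infinity>"
    using g by (auto simp: real_integrable_def less_top)
  then show int: "integrable M f"
    unfolding real_integrable_def pos neg using f by (auto simp: ennreal_mult_eq_top_iff less_top)
  show "(\<integral>x. f x \<partial>M) = c * (\<integral>x. g x \<partial>N)"
    unfolding real_lebesgue_integral_def[OF int] real_lebesgue_integral_def[OF g] pos neg
    using c by (simp add: enn2real_mult right_diff_distrib)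
qed

section \<open>The expected increment\<close>

text \<open>\<open>F_fin f v\<close> as a function of the component.\<close>

definition finite_part :: "('a graph \<Rightarrow> real) \<Rightarrow> 'a graph \<Rightarrow> real" where
  "finite_part f \<mu> = (if gsize \<mu> < \<infinity> then f \<mu> else 0)"

lemma F_fin_eq: "F_fin f v \<mu> = finite_part f (component v \<mu>)"
  by (simp add: F_fin_def finite_part_def)

lemma measurable_finite_part:
  assumes "f \<in> borel_measurable graph_space"
  shows "finite_part f \<in> borel_measurable (graph_space :: 'a::polish_space graph measure)"
  unfolding finite_part_def[abs_def]
proof (rule measurable_If[OF assms])
  have "gsize \<in> borel_measurable (graph_space :: 'a graph measure)" by (rule measurable_gsize)
  then show "{\<mu> \<in> space graph_space. gsize (\<mu> :: 'a graph) < \<infinity>} \<in> sets graph_space"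
    by (intro borel_measurable_less) simp_all
qed simp

lemma integral_count_space_pos_neg:
  fixes g :: "'a \<Rightarrow> real"
  assumes "(\<integral>\<^sup>+x. ennreal \<bar>g x\<bar> \<partial>count_space A) < \<infinity>"
  shows "integrable (count_space A) g"
    and "(\<integral>x. g x \<partial>count_space A) = enn2real (\<integral>\<^sup>+x. ennreal (g x) \<partial>count_space A) - enn2real (\<integral>\<^sup>+x. ennreal (- g x) \<partial>count_space A)"
proof -
  show "integrable (count_space A) g" using assms by (intro integrableI_bounded) auto
  from real_lebesgue_integral_def[OF this]
  show "(\<integral>x. g x \<partial>count_space A) = enn2real (\<integral>\<^sup>+x. ennreal (g x) \<partial>count_space A) - enn2real (\<integral>\<^sup>+x. ennreal (- g x) \<partial>count_space A)" .
qed

context poisson_rcm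
begin

text \<open>The real version of \<^const>\<open>M_comp\<close>; the two agree wherever size and \<open>\<phi>\<^sub>\<lambda>\<close> of the component are
  finite.\<close>

definition martingale_weight :: "'w \<Rightarrow> real" where
  "martingale_weight \<omega> = enn2real (gsize (component v (\<xi> \<omega>))) - 1 - t * enn2real (phi_lam (component_verts v (\<xi> \<omega>)))"

lemma measurable_xi_component: "g \<in> borel_measurable graph_space \<Longrightarrow> (\<lambda>\<omega>. g (component v (\<xi> \<omega>))) \<in> borel_measurable M"
  by (rule measurable_compose[OF measurable_compose[OF measurable_xi measurable_component]])

lemma measurable_xi_phi: "(\<lambda>\<omega>. phi_lam (component_verts v (\<xi> \<omega>))) \<in> borel_measurable M"
  by (rule measurable_phi_lam[OF measurable_compose[OF measurable_xi measurable_component_verts]])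

lemma measurable_xi_size: "(\<lambda>\<omega>. gsize (component v (\<xi> \<omega>))) \<in> borel_measurable M"
  by (rule measurable_xi_component[OF measurable_gsize])

text \<open>The sum of \<open>F(\<xi>)\<close> over the component without \<open>v\<close> is \<open>(|C| - 1) F(\<xi>)\<close>, and \<open>mean_sum_delete\<close>, applied to
  the positive and the negative part, evaluates the sum of \<open>F(\<xi> - \<delta>\<^sub>x)\<close>. Both sums are kept over all graphs,
  since the second may be nonzero for an infinite component, where the first vanishes: deleting a
  cut vertex can leave a finite component.\<close>

theorem mean_nabla:
  assumes f: "f \<in> borel_measurable graph_space"
    and F: "integrable M (\<lambda>\<omega>. F_fin f v (\<xi> \<omega>))"
    and mom: "(\<integral>\<^sup>+\<omega>. ennreal \<bar>F_fin f v (\<xi> \<omega>)\<bar> * (gsize (component v (\<xi> \<omega>)) + phi_lambda lam \<phi> (component v (\<xi> \<omega>))) \<partial>M) < \<infinity>"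
  shows "AE \<omega> in M. F_fin f v (\<xi> \<omega>) \<noteq> 0 \<longrightarrow> phi_lam (component_verts v (\<xi> \<omega>)) < \<infinity>"
    and "integrable M (\<lambda>\<omega>. martingale_weight \<omega> * F_fin f v (\<xi> \<omega>))"
    and "AE \<omega> in M. integrable (comp_others v (\<xi> \<omega>)) (\<lambda>x. nabla (F_fin f v) x (\<xi> \<omega>))"
    and "integrable M (\<lambda>\<omega>. \<integral>x. nabla (F_fin f v) x (\<xi> \<omega>) \<partial>comp_others v (\<xi> \<omega>))"
    and "(\<integral>\<omega>. (\<integral>x. nabla (F_fin f v) x (\<xi> \<omega>) \<partial>comp_others v (\<xi> \<omega>)) \<partial>M)
      = (\<integral>\<omega>. martingale_weight \<omega> * F_fin f v (\<xi> \<omega>) \<partial>M)"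
proof -
  define h where "h = finite_part f"
  have hm: "h \<in> borel_measurable graph_space" unfolding h_def by (rule measurable_finite_part[OF f])
  define H where "H \<omega> = h (component v (\<xi> \<omega>))" for \<omega>
  define S where "S \<omega> = gsize (component v (\<xi> \<omega>))" for \<omega>
  define \<Phi> where "\<Phi> \<omega> = phi_lam (component_verts v (\<xi> \<omega>))" for \<omega>
  have FH: "F_fin f v (\<xi> \<omega>) = H \<omega>" for \<omega> by (simp add: H_def h_def F_fin_eq)
  have Hm [measurable]: "H \<in> borel_measurable M" unfolding H_def[abs_def] by (rule measurable_xi_component[OF hm])
  have Sm [measurable]: "S \<in> borel_measurable M" unfolding S_def[abs_def] by (rule measurable_xi_size)
  have Pm [measurable]: "\<Phi> \<in> borel_measurable M" unfolding \<Phi>_def[abs_def] by (rule measurable_xi_phi)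
  have H0: "H \<omega> = 0" if "S \<omega> = \<infinity>" for \<omega> using that by (simp add: H_def h_def finite_part_def S_def)
  have momS: "(\<integral>\<^sup>+\<omega>. ennreal \<bar>H \<omega>\<bar> * S \<omega> \<partial>M) < \<infinity>" and momP: "(\<integral>\<^sup>+\<omega>. ennreal \<bar>H \<omega>\<bar> * \<Phi> \<omega> \<partial>M) < \<infinity>"
  proof -
    have "(\<integral>\<^sup>+\<omega>. ennreal \<bar>H \<omega>\<bar> * (S \<omega> + \<Phi> \<omega>) \<partial>M) < \<infinity>"
      using mom by (simp add: FH S_def \<Phi>_def phi_lambda_eq)
    moreover have "(\<integral>\<^sup>+\<omega>. ennreal \<bar>H \<omega>\<bar> * S \<omega> \<partial>M) \<le> (\<integral>\<^sup>+\<omega>. ennreal \<bar>H \<omega>\<bar> * (S \<omega> + \<Phi> \<omega>) \<partial>M)"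
      "(\<integral>\<^sup>+\<omega>. ennreal \<bar>H \<omega>\<bar> * \<Phi> \<omega> \<partial>M) \<le> (\<integral>\<^sup>+\<omega>. ennreal \<bar>H \<omega>\<bar> * (S \<omega> + \<Phi> \<omega>) \<partial>M)"
      by (intro nn_integral_mono mult_left_mono; simp)+
    ultimately show "(\<integral>\<^sup>+\<omega>. ennreal \<bar>H \<omega>\<bar> * S \<omega> \<partial>M) < \<infinity>" "(\<integral>\<^sup>+\<omega>. ennreal \<bar>H \<omega>\<bar> * \<Phi> \<omega> \<partial>M) < \<infinity>"
      by (auto intro: le_less_trans)
  qed
  have AEP: "AE \<omega> in M. H \<omega> \<noteq> 0 \<longrightarrow> \<Phi> \<omega> < \<infinity>"
  proof -
    have "AE \<omega> in M. ennreal \<bar>H \<omega>\<bar> * \<Phi> \<omega> \<noteq> \<infinity>"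
      using momP by (intro nn_integral_noteq_infinite) auto
    then show ?thesis by eventually_elim (auto simp: ennreal_mult_eq_top_iff less_top)
  qed
  then show "AE \<omega> in M. F_fin f v (\<xi> \<omega>) \<noteq> 0 \<longrightarrow> phi_lam (component_verts v (\<xi> \<omega>)) < \<infinity>"
    by (simp add: FH \<Phi>_def)
  have intS: "integrable M (\<lambda>\<omega>. enn2real (S \<omega>) * H \<omega>)"
  proof (rule integrableI_bounded)
    have "ennreal (norm (enn2real (S \<omega>) * H \<omega>)) \<le> ennreal \<bar>H \<omega>\<bar> * S \<omega>" for \<omega>
    proof (cases "S \<omega> = \<infinity>")
      case False
      then show ?thesis by (cases "S \<omega>") (auto simp: abs_mult ennreal_mult[symmetric] mult.commute)
    qed (simp add: H0)
    then show "(\<integral>\<^sup>+\<omega>. ennreal (norm (enn2real (S \<omega>) * H \<omega>)) \<partial>M) < \<infinity>"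
      by (intro le_less_trans[OF nn_integral_mono momS]) simp
  qed measurable
  have intP: "integrable M (\<lambda>\<omega>. enn2real (\<Phi> \<omega>) * H \<omega>)"
  proof (rule integrableI_bounded)
    have "ennreal (norm (enn2real (\<Phi> \<omega>) * H \<omega>)) \<le> ennreal \<bar>H \<omega>\<bar> * \<Phi> \<omega>" for \<omega>
      by (cases "\<Phi> \<omega>") (auto simp: abs_mult ennreal_mult[symmetric] mult.commute)
    then show "(\<integral>\<^sup>+\<omega>. ennreal (norm (enn2real (\<Phi> \<omega>) * H \<omega>)) \<partial>M) < \<infinity>"
      by (intro le_less_trans[OF nn_integral_mono momP]) simp
  qed measurable
  have intH: "integrable M H" using F by (simp add: FH)
  have split: "martingale_weight \<omega> * F_fin f v (\<xi> \<omega>) = enn2real (S \<omega>) * H \<omega> - H \<omega> - t * (enn2real (\<Phi> \<omega>) * H \<omega>)" for \<omega>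
    by (simp add: martingale_weight_def FH S_def \<Phi>_def algebra_simps)
  show "integrable M (\<lambda>\<omega>. martingale_weight \<omega> * F_fin f v (\<xi> \<omega>))"
    unfolding split using intS intH intP by (intro Bochner_Integration.integrable_diff integrable_mult_right)
  define C where "C \<omega> = component_verts v (\<xi> \<omega>) - {v}" for \<omega>
  define d where "d x \<omega> = h (component v (delete_vertex x (\<xi> \<omega>)))" for x \<omega>
  have nab: "nabla (F_fin f v) x (\<xi> \<omega>) = H \<omega> - d x \<omega>" for x \<omega>
    unfolding nabla_def FH by (simp add: d_def h_def F_fin_eq)
  have co: "comp_others v (\<xi> \<omega>) = count_space (C \<omega>)" for \<omega> by (simp add: comp_others_def C_def)
  have del: "(\<integral>\<^sup>+\<omega>. \<integral>\<^sup>+x. ennreal (k (d x \<omega>)) \<partial>count_space (C \<omega>) \<partial>M) = ennreal t * (\<integral>\<^sup>+\<omega>. ennreal (k (H \<omega>)) * \<Phi> \<omega> \<partial>M)"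
    and delm: "(\<lambda>\<omega>. \<integral>\<^sup>+x. ennreal (k (d x \<omega>)) \<partial>count_space (C \<omega>)) \<in> borel_measurable M"
    if k: "k \<in> borel_measurable borel" for k :: "real \<Rightarrow> real"
  proof -
    have km: "(\<lambda>\<mu>. ennreal (k (h \<mu>))) \<in> borel_measurable graph_space"
      by (rule measurable_compose[OF measurable_compose[OF hm k] measurable_ennreal])
    show "(\<integral>\<^sup>+\<omega>. \<integral>\<^sup>+x. ennreal (k (d x \<omega>)) \<partial>count_space (C \<omega>) \<partial>M) = ennreal t * (\<integral>\<^sup>+\<omega>. ennreal (k (H \<omega>)) * \<Phi> \<omega> \<partial>M)"
      using mean_sum_delete[OF km] by (simp only: d_def C_def H_def \<Phi>_def)
    show "(\<lambda>\<omega>. \<integral>\<^sup>+x. ennreal (k (d x \<omega>)) \<partial>count_space (C \<omega>)) \<in> borel_measurable M"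
      using measurable_compose[OF measurable_xi measurable_sum_delete[OF km]] by (simp only: d_def C_def)
  qed
  define A where "A \<omega> = (\<integral>\<^sup>+x. ennreal \<bar>d x \<omega>\<bar> \<partial>count_space (C \<omega>))" for \<omega>
  define Yp where "Yp \<omega> = (\<integral>\<^sup>+x. ennreal (d x \<omega>) \<partial>count_space (C \<omega>))" for \<omega>
  define Yn where "Yn \<omega> = (\<integral>\<^sup>+x. ennreal (- d x \<omega>) \<partial>count_space (C \<omega>))" for \<omega>
  have absm: "(\<lambda>r :: real. \<bar>r\<bar>) \<in> borel_measurable borel" by simp
  have negm: "(\<lambda>r :: real. - r) \<in> borel_measurable borel" by simp
  have idm: "(\<lambda>r :: real. r) \<in> borel_measurable borel" by simp
  have Am: "A \<in> borel_measurable M" unfolding A_def[abs_def] by (rule delm[OF absm])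
  have Ypm [measurable]: "Yp \<in> borel_measurable M" unfolding Yp_def[abs_def] by (rule delm[OF idm])
  have Ynm [measurable]: "Yn \<in> borel_measurable M" unfolding Yn_def[abs_def] by (rule delm[OF negm])
  have "(\<integral>\<^sup>+\<omega>. A \<omega> \<partial>M) < \<infinity>"
    unfolding A_def del[OF absm] using momP by (simp add: ennreal_mult_less_top)
  then have AEA: "AE \<omega> in M. A \<omega> < \<infinity>"
    using nn_integral_noteq_infinite[OF Am] by (auto simp: less_top)
  have good: "integrable (count_space (C \<omega>)) (\<lambda>x. H \<omega> - d x \<omega>) \<and>
      (\<integral>x. H \<omega> - d x \<omega> \<partial>count_space (C \<omega>)) = (enn2real (S \<omega>) - 1) * H \<omega> - (enn2real (Yp \<omega>) - enn2real (Yn \<omega>))"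
    if A: "A \<omega> < \<infinity>" and \<omega>: "\<omega> \<in> space M" for \<omega>
  proof -
    note dI = integral_count_space_pos_neg[OF A[unfolded A_def]]
    have const: "integrable (count_space (C \<omega>)) (\<lambda>x. H \<omega>) \<and> (\<integral>x. H \<omega> \<partial>count_space (C \<omega>)) = (enn2real (S \<omega>) - 1) * H \<omega>"
    proof (cases "H \<omega> = 0")
      case False
      then have fin: "finite (component_verts v (\<xi> \<omega>))"
        using H0[of \<omega>] by (cases "finite (component_verts v (\<xi> \<omega>))") (auto simp: S_def gsize_def)
      have "v \<in> component_verts v (\<xi> \<omega>)" using verts_xi[OF \<omega>] by (intro mem_component_verts_self) simp
      then have "real (card (C \<omega>)) = enn2real (S \<omega>) - 1"
        using fin card_gt_0_iff[of "component_verts v (\<xi> \<omega>)"]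
        by (auto simp: C_def S_def gsize_def emeasure_count_space_finite card_Diff_singleton of_nat_diff Suc_le_eq)
      moreover have "finite (C \<omega>)" using fin by (simp add: C_def)
      ultimately show ?thesis
        by (simp add: integrable_count_space lebesgue_integral_count_space_finite)
    qed simp
    show ?thesis using const dI by (simp add: Yp_def Yn_def)
  qed
  show "AE \<omega> in M. integrable (comp_others v (\<xi> \<omega>)) (\<lambda>x. nabla (F_fin f v) x (\<xi> \<omega>))"
    unfolding nab co using AEA AE_space by eventually_elim (use good in blast)
  have N: "AE \<omega> in M. (\<integral>x. nabla (F_fin f v) x (\<xi> \<omega>) \<partial>comp_others v (\<xi> \<omega>))
      = (enn2real (S \<omega>) * H \<omega> - H \<omega>) - (enn2real (Yp \<omega>) - enn2real (Yn \<omega>))"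
    unfolding nab co using AEA AE_space
  proof eventually_elim
    case (elim \<omega>)
    then show ?case using good[of \<omega>] by (simp add: left_diff_distrib)
  qed
  have part: "integrable M (\<lambda>\<omega>. enn2real (Y \<omega>)) \<and> (\<integral>\<omega>. enn2real (Y \<omega>) \<partial>M) = t * (\<integral>\<omega>. enn2real (\<Phi> \<omega>) * max 0 (k (H \<omega>)) \<partial>M)"
    if Y: "\<And>\<omega>. Y \<omega> = (\<integral>\<^sup>+x. ennreal (k (d x \<omega>)) \<partial>count_space (C \<omega>))" and k: "k \<in> borel_measurable borel"
      and kle: "\<And>r. k r \<le> \<bar>r\<bar>" for Y and k :: "real \<Rightarrow> real"
  proof -
    have "Y = (\<lambda>\<omega>. \<integral>\<^sup>+x. ennreal (k (d x \<omega>)) \<partial>count_space (C \<omega>))" by (rule ext) (rule Y)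
    with delm[OF k] have Ym: "Y \<in> borel_measurable M" by (simp only:)
    have kH: "(\<lambda>\<omega>. k (H \<omega>)) \<in> borel_measurable M" by (rule measurable_compose[OF Hm k])
    have le: "(\<integral>\<^sup>+\<omega>. ennreal (k (H \<omega>)) * \<Phi> \<omega> \<partial>M) \<le> (\<integral>\<^sup>+\<omega>. ennreal \<bar>H \<omega>\<bar> * \<Phi> \<omega> \<partial>M)"
      by (intro nn_integral_mono mult_right_mono ennreal_leI kle) simp
    have eq: "(\<integral>\<^sup>+\<omega>. Y \<omega> \<partial>M) = ennreal t * (\<integral>\<^sup>+\<omega>. ennreal (k (H \<omega>)) * \<Phi> \<omega> \<partial>M)"
      unfolding Y by (rule del[OF k])
    have fin: "(\<integral>\<^sup>+\<omega>. Y \<omega> \<partial>M) < \<infinity>"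
      unfolding eq using le_less_trans[OF le momP] by (simp add: ennreal_mult_less_top)
    have AEY: "AE \<omega> in M. Y \<omega> \<noteq> \<infinity>" using fin nn_integral_noteq_infinite[OF Ym] by simp
    have e1: "(\<integral>\<^sup>+\<omega>. ennreal (enn2real (Y \<omega>)) \<partial>M) = (\<integral>\<^sup>+\<omega>. Y \<omega> \<partial>M)"
      by (rule nn_integral_cong_AE) (use AEY in \<open>eventually_elim, simp add: less_top\<close>)
    have int: "integrable M (\<lambda>\<omega>. enn2real (Y \<omega>))"
      using fin Ym by (intro integrableI_bounded) (simp_all add: e1)
    have "(\<integral>\<omega>. enn2real (Y \<omega>) \<partial>M) = enn2real (\<integral>\<^sup>+\<omega>. Y \<omega> \<partial>M)"
      using Ym by (subst integral_eq_nn_integral) (simp_all add: e1)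
    also have "\<dots> = t * enn2real (\<integral>\<^sup>+\<omega>. ennreal (k (H \<omega>)) * \<Phi> \<omega> \<partial>M)"
      unfolding eq using t_pos by (simp add: enn2real_mult)
    also have "(\<integral>\<^sup>+\<omega>. ennreal (k (H \<omega>)) * \<Phi> \<omega> \<partial>M) = (\<integral>\<^sup>+\<omega>. ennreal (enn2real (\<Phi> \<omega>) * max 0 (k (H \<omega>))) \<partial>M)"
    proof (rule nn_integral_cong_AE)
      show "AE \<omega> in M. ennreal (k (H \<omega>)) * \<Phi> \<omega> = ennreal (enn2real (\<Phi> \<omega>) * max 0 (k (H \<omega>)))"
        using AEP
      proof eventually_elim
        case (elim \<omega>)
        show ?case
        proof (cases "k (H \<omega>) \<le> 0")
          case True
          then show ?thesis by (simp add: ennreal_neg)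
        next
          case False
          then have "H \<omega> \<noteq> 0" using kle[of 0] by auto
          then have "ennreal (enn2real (\<Phi> \<omega>)) = \<Phi> \<omega>" using elim by simp
          then show ?thesis using False by (simp add: ennreal_mult max_def mult.commute)
        qed
      qed
    qed
    also have "enn2real \<dots> = (\<integral>\<omega>. enn2real (\<Phi> \<omega>) * max 0 (k (H \<omega>)) \<partial>M)"
      using kH Pm by (subst integral_eq_nn_integral) auto
    finally show ?thesis using int by simp
  qed
  have yp: "integrable M (\<lambda>\<omega>. enn2real (Yp \<omega>)) \<and> (\<integral>\<omega>. enn2real (Yp \<omega>) \<partial>M) = t * (\<integral>\<omega>. enn2real (\<Phi> \<omega>) * max 0 (H \<omega>) \<partial>M)"
    by (rule part[OF Yp_def idm]) simp
  have yn: "integrable M (\<lambda>\<omega>. enn2real (Yn \<omega>)) \<and> (\<integral>\<omega>. enn2real (Yn \<omega>) \<partial>M) = t * (\<integral>\<omega>. enn2real (\<Phi> \<omega>) * max 0 (- H \<omega>) \<partial>M)"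
    by (rule part[OF Yn_def negm]) simp
  have intPk: "integrable M (\<lambda>\<omega>. enn2real (\<Phi> \<omega>) * max 0 (H \<omega>))" "integrable M (\<lambda>\<omega>. enn2real (\<Phi> \<omega>) * max 0 (- H \<omega>))"
    by (rule Bochner_Integration.integrable_bound[OF intP]; auto simp: abs_mult intro!: mult_left_mono)+
  have diff: "(\<integral>\<omega>. enn2real (Yp \<omega>) \<partial>M) - (\<integral>\<omega>. enn2real (Yn \<omega>) \<partial>M) = t * (\<integral>\<omega>. enn2real (\<Phi> \<omega>) * H \<omega> \<partial>M)"
  proof -
    have "(\<integral>\<omega>. enn2real (\<Phi> \<omega>) * H \<omega> \<partial>M) = (\<integral>\<omega>. enn2real (\<Phi> \<omega>) * max 0 (H \<omega>) - enn2real (\<Phi> \<omega>) * max 0 (- H \<omega>) \<partial>M)"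
      by (intro Bochner_Integration.integral_cong) (auto simp: max_def)
    then show ?thesis using yp yn intPk by (simp add: right_diff_distrib)
  qed
  have Rint: "integrable M (\<lambda>\<omega>. (enn2real (S \<omega>) * H \<omega> - H \<omega>) - (enn2real (Yp \<omega>) - enn2real (Yn \<omega>)))"
    using intS intH yp yn by (intro Bochner_Integration.integrable_diff) auto
  have Nm: "(\<lambda>\<omega>. \<integral>x. nabla (F_fin f v) x (\<xi> \<omega>) \<partial>comp_others v (\<xi> \<omega>)) \<in> borel_measurable M"
  proof -
    have Cm: "C \<in> measurable M point_space"
      unfolding C_def[abs_def]
      by (rule measurable_delete_point[OF measurable_compose[OF measurable_xi measurable_component_verts] measurable_const]) simp
    have "(\<lambda>p. d (snd p) (fst p)) \<in> borel_measurable (M \<Otimes>\<^sub>M borel)"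
      unfolding d_def
      by (rule measurable_compose[OF measurable_compose[OF measurable_delete_vertex[OF
        measurable_compose[OF measurable_fst measurable_xi] measurable_snd] measurable_component] hm])
    then have e: "(\<lambda>p. H (fst p) - d (snd p) (fst p)) \<in> borel_measurable (M \<Otimes>\<^sub>M borel)"
      by (intro borel_measurable_diff measurable_compose[OF measurable_fst Hm])
    have n: "(\<lambda>\<omega>. \<integral>\<^sup>+x. ennreal (k (H \<omega> - d x \<omega>)) \<partial>count_space (C \<omega>)) \<in> borel_measurable M"
      if "k \<in> borel_measurable borel" for k :: "real \<Rightarrow> real"
      using point_sum_measurable[OF Cm measurable_compose[OF measurable_compose[OF e that] measurable_ennreal]]
      by (simp only: fst_conv snd_conv)
    define B where "B \<omega> = (\<integral>\<^sup>+x. ennreal \<bar>H \<omega> - d x \<omega>\<bar> \<partial>count_space (C \<omega>))" for \<omega>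
    define Bp where "Bp \<omega> = (\<integral>\<^sup>+x. ennreal (H \<omega> - d x \<omega>) \<partial>count_space (C \<omega>))" for \<omega>
    define Bn where "Bn \<omega> = (\<integral>\<^sup>+x. ennreal (- (H \<omega> - d x \<omega>)) \<partial>count_space (C \<omega>))" for \<omega>
    have [measurable]: "B \<in> borel_measurable M" "Bp \<in> borel_measurable M" "Bn \<in> borel_measurable M"
      unfolding B_def[abs_def] Bp_def[abs_def] Bn_def[abs_def] by (rule n[OF absm], rule n[OF idm], rule n[OF negm])
    have "(\<integral>x. H \<omega> - d x \<omega> \<partial>count_space (C \<omega>)) = (if B \<omega> < \<infinity> then enn2real (Bp \<omega>) - enn2real (Bn \<omega>) else 0)" for \<omega>
    proof (cases "B \<omega> < \<infinity>")
      case True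
      then show ?thesis using integral_count_space_pos_neg(2)[OF True[unfolded B_def]] by (simp add: Bp_def Bn_def)
    next
      case False
      then have "\<not> integrable (count_space (C \<omega>)) (\<lambda>x. H \<omega> - d x \<omega>)"
        by (auto simp: integrable_iff_bounded B_def)
      then show ?thesis using False by (simp add: not_integrable_integral_eq)
    qed
    then show ?thesis unfolding nab co by (simp only:) measurable
  qed
  show "integrable M (\<lambda>\<omega>. \<integral>x. nabla (F_fin f v) x (\<xi> \<omega>) \<partial>comp_others v (\<xi> \<omega>))"
    using integrable_cong_AE[OF Nm borel_measurable_integrable[OF Rint] N] Rint by simp
  have "(\<integral>\<omega>. (\<integral>x. nabla (F_fin f v) x (\<xi> \<omega>) \<partial>comp_others v (\<xi> \<omega>)) \<partial>M)
      = (\<integral>\<omega>. (enn2real (S \<omega>) * H \<omega> - H \<omega>) - (enn2real (Yp \<omega>) - enn2real (Yn \<omega>)) \<partial>M)"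
    by (rule integral_cong_AE[OF Nm borel_measurable_integrable[OF Rint] N])
  also have "\<dots> = (\<integral>\<omega>. enn2real (S \<omega>) * H \<omega> \<partial>M) - (\<integral>\<omega>. H \<omega> \<partial>M) - t * (\<integral>\<omega>. enn2real (\<Phi> \<omega>) * H \<omega> \<partial>M)"
    using intS intH yp yn diff by simp
  also have "\<dots> = (\<integral>\<omega>. martingale_weight \<omega> * F_fin f v (\<xi> \<omega>) \<partial>M)"
    unfolding split using intS intH intP by simp
  finally show "(\<integral>\<omega>. (\<integral>x. nabla (F_fin f v) x (\<xi> \<omega>) \<partial>comp_others v (\<xi> \<omega>)) \<partial>M)
      = (\<integral>\<omega>. martingale_weight \<omega> * F_fin f v (\<xi> \<omega>) \<partial>M)" .
qed

end


section \<open>The derivative for components of a given size\<close>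

text \<open>Half of \<open>u\<close> is spent on making \<open>F a exp (- (u / 2) a)\<close> integrable; the rest gives
  differentiability.\<close>

lemma isCont_exp_transform_deriv:
  fixes F a :: "'w \<Rightarrow> real"
  assumes F: "integrable M F" and a: "a \<in> borel_measurable M" and nonneg: "\<And>\<omega>. 0 \<le> a \<omega>"
    and u: "0 < u"
  shows "isCont (\<lambda>u. \<integral>\<omega>. F \<omega> * a \<omega> * exp (- (u * a \<omega>)) \<partial>M) u"
proof -
  define w where "w = u / 2"
  have w: "0 < w" "0 < u - w" using u by (simp_all add: w_def)
  define g where "g y = (\<integral>\<omega>. F \<omega> * a \<omega> * exp (- (w * a \<omega>)) * exp (- (y * a \<omega>)) \<partial>M)" for y
  have g: "isCont g (u - w)"
    unfolding g_def[abs_def]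
    by (rule DERIV_isCont[OF has_derivative_exp_transform[OF integrable_exp_transform[OF F a nonneg w(1)] a nonneg w(2)]])
  have "isCont (\<lambda>y. y - w) u" by (intro continuous_intros)
  from isCont_o2[OF this g] have "isCont (\<lambda>y. g (y - w)) u" .
  moreover have "g (y - w) = (\<integral>\<omega>. F \<omega> * a \<omega> * exp (- (y * a \<omega>)) \<partial>M)" for y
  proof -
    have "exp (- (w * a \<omega>)) * exp (- ((y - w) * a \<omega>)) = exp (- (y * a \<omega>))" for \<omega>
      by (simp add: exp_add[symmetric] algebra_simps)
    then show ?thesis unfolding g_def by (simp only: mult.assoc)
  qed
  ultimately show ?thesis by simp
qed

lemma F_size_eq: "F_size f v n \<mu> = of_bool (gsize (component v \<mu>) = of_nat n) * f (component v \<mu>)"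
  by (simp add: F_size_def)

lemma gsize_cases:
  obtains (infinite) "gsize \<mu> = \<infinity>" | (finite) k where "gsize \<mu> = of_nat k"
proof (cases "finite (verts \<mu>)")
  case True
  then show ?thesis using that(2)[of "card (verts \<mu>)"] by (simp add: gsize_def emeasure_count_space_finite)
next
  case False
  then show ?thesis using that(1) by (simp add: gsize_def)
qed

lemma F_size_sum:
  "F_fin f v \<mu> - (\<Sum>i<n. F_size f v i \<mu>) = F_fin f v \<mu> * of_bool (of_nat n \<le> gsize (component v \<mu>))"
proof (cases "component v \<mu>" rule: gsize_cases)
  case infinite
  then show ?thesis by (simp add: F_fin_def F_size_def)
next
  case (finite k)
  have "(\<Sum>i<n. F_size f v i \<mu>) = (\<Sum>i<n. if i = k then f (component v \<mu>) else 0)"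
    using finite by (intro sum.cong) (auto simp: F_size_def)
  then show ?thesis using finite by (simp add: F_fin_def of_nat_less_top)
qed

lemma abs_F_size_suminf:
  "ennreal \<bar>c * (F_fin f v \<mu> * of_bool (of_nat n \<le> gsize (component v \<mu>)))\<bar> = (\<Sum>k. ennreal \<bar>c * F_size f v (n + k) \<mu>\<bar>)"
proof (cases "component v \<mu>" rule: gsize_cases)
  case infinite
  then have "F_size f v j \<mu> = 0" for j by (simp add: F_size_def)
  then show ?thesis using infinite by (simp add: F_fin_def)
next
  case (finite k)
  have F: "F_size f v (n + j) \<mu> = (if n + j = k then f (component v \<mu>) else 0)" for j
    using finite by (simp add: F_size_def eq_commute[of k] del: of_nat_add)
  have "(\<Sum>j. ennreal \<bar>c * F_size f v (n + j) \<mu>\<bar>) = (\<Sum>j\<in>(if n \<le> k then {k - n} else {}). ennreal \<bar>c * F_size f v (n + j) \<mu>\<bar>)"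
    by (intro suminf_finite) (auto simp: F split: if_splits)
  then show ?thesis using finite by (auto simp: F_fin_def F of_nat_less_top)
qed

lemma abs_F_size_le: "\<bar>F_size f v n \<mu>\<bar> \<le> \<bar>F_fin f v \<mu>\<bar>"
proof (cases "gsize (component v \<mu>) = of_nat n")
  case True
  then show ?thesis by (simp add: F_size_def F_fin_def of_nat_less_top)
qed (simp add: F_size_def)

context connection_model
begin

lemma signed_change_intensity:
  fixes h :: "'a graph \<Rightarrow> real"
  assumes s: "poisson_rcm \<phi> lam v M \<eta> \<xi> s" and t: "poisson_rcm \<phi> lam v M' \<eta>' \<xi>' t"
    and h: "h \<in> borel_measurable graph_space"
    and int: "integrable M' (\<lambda>\<omega>. F_size h v (Suc m) (\<xi>' \<omega>) * enn2real (exp_weight (s - t) (phi_lam (component_verts v (\<xi>' \<omega>)))))"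
  shows "integrable M (\<lambda>\<omega>. F_size h v (Suc m) (\<xi> \<omega>))"
    and "(\<integral>\<omega>. F_size h v (Suc m) (\<xi> \<omega>) \<partial>M)
      = (s / t) ^ m * (\<integral>\<omega>. F_size h v (Suc m) (\<xi>' \<omega>) * enn2real (exp_weight (s - t) (phi_lam (component_verts v (\<xi>' \<omega>)))) \<partial>M')"
proof -
  interpret S: poisson_rcm \<phi> lam v M \<eta> \<xi> s by fact
  interpret T: poisson_rcm \<phi> lam v M' \<eta>' \<xi>' t by fact
  have tr: "(\<integral>\<^sup>+\<omega>. ennreal (F_size k v (Suc m) (\<xi> \<omega>)) \<partial>M) = ennreal ((s / t) ^ m) *
      (\<integral>\<^sup>+\<omega>. ennreal (F_size k v (Suc m) (\<xi>' \<omega>) * enn2real (exp_weight (s - t) (phi_lam (component_verts v (\<xi>' \<omega>))))) \<partial>M')"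
    if k: "k \<in> borel_measurable graph_space" for k
  proof -
    let ?A = "\<integral>\<^sup>+\<omega>. ennreal (F_size k v (Suc m) (\<xi> \<omega>)) \<partial>M"
    let ?B = "\<integral>\<^sup>+\<omega>. ennreal (F_size k v (Suc m) (\<xi>' \<omega>) * enn2real (exp_weight (s - t) (phi_lam (component_verts v (\<xi>' \<omega>))))) \<partial>M'"
    have km: "(\<lambda>\<mu>. ennreal (k \<mu>)) \<in> borel_measurable graph_space" by (rule measurable_compose[OF k measurable_ennreal])
    have w: "ennreal (enn2real (exp_weight d b)) = exp_weight d b" for d b
      by (auto simp: exp_weight_def)
    have "?A = (\<integral>\<^sup>+\<omega>. of_bool (gsize (component v (\<xi> \<omega>)) = of_nat (Suc m)) * ennreal (k (component v (\<xi> \<omega>))) \<partial>M)"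
      unfolding F_size_eq by (intro nn_integral_cong) (auto simp: of_bool_def)
    moreover have "?B = (\<integral>\<^sup>+\<omega>. of_bool (gsize (component v (\<xi>' \<omega>)) = of_nat (Suc m)) *
        (ennreal (k (component v (\<xi>' \<omega>))) * exp_weight (s - t) (phi_lam (component_verts v (\<xi>' \<omega>)))) \<partial>M')"
      unfolding F_size_eq by (intro nn_integral_cong) (auto simp: of_bool_def ennreal_mult'' w)
    ultimately have "ennreal t ^ m * ?A = ennreal s ^ m * ?B"
      using change_intensity[OF s t km, of m] by (simp only:)
    also have "ennreal s ^ m = ennreal t ^ m * ennreal ((s / t) ^ m)"
      using S.t_pos T.t_pos by (simp add: ennreal_power ennreal_mult[symmetric] power_divide)
    finally have "ennreal t ^ m * ?A = ennreal t ^ m * (ennreal ((s / t) ^ m) * ?B)" by (simp only: mult.assoc)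
    then show ?thesis
      using T.t_pos by (subst (asm) ennreal_mult_cancel_left) (auto simp: ennreal_power)
  qed
  have fm: "(\<lambda>\<omega>. F_size h v (Suc m) (\<xi> \<omega>)) \<in> borel_measurable M"
    unfolding F_size_eq
    by (intro borel_measurable_times S.measurable_xi_component[OF h]
      measurable_compose[OF measurable_compose[OF S.measurable_xi pred_component_size], of of_bool borel]) simp
  have neg: "F_size (\<lambda>\<mu>. - h \<mu>) v (Suc m) \<mu> = - F_size h v (Suc m) \<mu>" for \<mu> by (simp add: F_size_def)
  have hm: "(\<lambda>\<mu>. - h \<mu>) \<in> borel_measurable graph_space" using h by (rule borel_measurable_uminus)
  have c: "0 \<le> (s / t) ^ m" using S.t_pos T.t_pos by simp
  note * = signed_transfer[OF fm int c tr[OF h]]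
  have n: "(\<integral>\<^sup>+\<omega>. ennreal (- F_size h v (Suc m) (\<xi> \<omega>)) \<partial>M) = ennreal ((s / t) ^ m) *
      (\<integral>\<^sup>+\<omega>. ennreal (- (F_size h v (Suc m) (\<xi>' \<omega>) * enn2real (exp_weight (s - t) (phi_lam (component_verts v (\<xi>' \<omega>)))))) \<partial>M')"
    using tr[OF hm] by (simp only: neg mult_minus_left)
  show "integrable M (\<lambda>\<omega>. F_size h v (Suc m) (\<xi> \<omega>))"
    "(\<integral>\<omega>. F_size h v (Suc m) (\<xi> \<omega>) \<partial>M)
      = (s / t) ^ m * (\<integral>\<omega>. F_size h v (Suc m) (\<xi>' \<omega>) * enn2real (exp_weight (s - t) (phi_lam (component_verts v (\<xi>' \<omega>)))) \<partial>M')"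
    using *[OF n] by simp_all
qed

text \<open>With \<open>t0\<close> as reference intensity, the mean at \<open>s\<close> is \<open>(s / t0) ^ m\<close> times the exponential transform of \<open>F\<close> at
  \<open>s - t0\<close>, with exponent \<open>\<phi>\<^sub>\<lambda>\<close>.\<close>

lemma size_derivative:
  fixes f :: "'a graph \<Rightarrow> real"
  assumes R: "\<And>t. 0 < t \<Longrightarrow> poisson_rcm \<phi> lam v (P t) \<eta> \<xi> t" and t0: "0 < t0"
    and f: "f \<in> borel_measurable graph_space"
    and int: "integrable (P t0) (\<lambda>\<omega>. F_size f v (Suc m) (\<xi> \<omega>))"
    and fin: "AE \<omega> in P t0. F_size f v (Suc m) (\<xi> \<omega>) \<noteq> 0 \<longrightarrow> phi_lam (component_verts v (\<xi> \<omega>)) < \<infinity>"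
  defines "D \<equiv> \<lambda>s. inverse s * (real m * (\<integral>\<omega>. F_size f v (Suc m) (\<xi> \<omega>) \<partial>P s)
        - s * (\<integral>\<omega>. enn2real (phi_lam (component_verts v (\<xi> \<omega>))) * F_size f v (Suc m) (\<xi> \<omega>) \<partial>P s))"
  shows "\<And>s. t0 < s \<Longrightarrow> ((\<lambda>s. \<integral>\<omega>. F_size f v (Suc m) (\<xi> \<omega>) \<partial>P s) has_real_derivative D s) (at s)"
    and "\<And>s. t0 < s \<Longrightarrow> isCont D s"
proof -
  interpret T: poisson_rcm \<phi> lam v "P t0" \<eta> \<xi> t0 using R t0 .
  define H where "H \<omega> = F_size f v (Suc m) (\<xi> \<omega>)" for \<omega>
  define a where "a \<omega> = enn2real (phi_lam (component_verts v (\<xi> \<omega>)))" for \<omega>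
  have am: "a \<in> borel_measurable (P t0)"
    unfolding a_def[abs_def] by (rule measurable_compose[OF T.measurable_xi_phi]) simp
  have a0: "0 \<le> a \<omega>" for \<omega> by (simp add: a_def)
  have Hint: "integrable (P t0) H" using int by (simp add: H_def[abs_def])
  have Hm: "H \<in> borel_measurable (P t0)" by (rule borel_measurable_integrable[OF Hint])
  define L where "L u = (\<integral>\<omega>. H \<omega> * exp (- (u * a \<omega>)) \<partial>P t0)" for u
  define N where "N u = (\<integral>\<omega>. H \<omega> * a \<omega> * exp (- (u * a \<omega>)) \<partial>P t0)" for u
  have L': "(L has_real_derivative - N u) (at u)" if "0 < u" for u
    unfolding L_def[abs_def] N_def by (rule has_derivative_exp_transform[OF Hint am a0 that])
  have Ncont: "isCont N u" if "0 < u" for u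
    unfolding N_def[abs_def] by (rule isCont_exp_transform_deriv[OF Hint am a0 that])
  let ?W = "\<lambda>s \<omega>. enn2real (exp_weight (s - t0) (phi_lam (component_verts v (\<xi> \<omega>))))"
  have W: "AE \<omega> in P t0. H \<omega> * ?W s \<omega> = H \<omega> * exp (- ((s - t0) * a \<omega>))" for s
    using fin
  proof eventually_elim
    case (elim \<omega>)
    then show ?case
      by (cases "H \<omega> = 0") (simp_all add: H_def exp_weight_def a_def less_top algebra_simps)
  qed
  have Wm: "?W s \<in> borel_measurable (P t0)" for s
    by (rule measurable_compose[OF measurable_compose[OF T.measurable_xi_phi measurable_exp_weight]]) simp
  have em: "(\<lambda>\<omega>. exp (- (u * a \<omega>))) \<in> borel_measurable (P t0)" for u
    using am by measurable
  have intL: "integrable (P t0) (\<lambda>\<omega>. H \<omega> * exp (- (u * a \<omega>)))" if "0 \<le> u" for u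
  proof (rule Bochner_Integration.integrable_bound[OF Hint])
    show "AE \<omega> in P t0. norm (H \<omega> * exp (- (u * a \<omega>))) \<le> norm (H \<omega>)"
      using a0 that by (intro AE_I2) (simp add: abs_mult mult_left_le)
  qed (intro borel_measurable_times Hm em)
  have X: "(\<integral>\<omega>. F_size f v (Suc m) (\<xi> \<omega>) \<partial>P s) = (s / t0) ^ m * L (s - t0)" if s: "t0 < s" for s
  proof -
    have "integrable (P t0) (\<lambda>\<omega>. H \<omega> * ?W s \<omega>)"
      by (rule integrable_cong_AE[THEN iffD2, OF _ _ W intL])
        (use s in \<open>auto intro!: borel_measurable_times Hm em Wm\<close>)
    note * = signed_change_intensity(2)[OF R R[OF t0] f this[unfolded H_def]]
    have "(\<integral>\<omega>. H \<omega> * ?W s \<omega> \<partial>P t0) = L (s - t0)"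
      unfolding L_def by (rule integral_cong_AE[OF _ _ W]) (intro borel_measurable_times Hm em Wm)+
    then show ?thesis using * s t0 by (simp add: H_def)
  qed
  have Y: "(\<integral>\<omega>. a \<omega> * F_size f v (Suc m) (\<xi> \<omega>) \<partial>P s) = (s / t0) ^ m * N (s - t0)" if s: "t0 < s" for s
  proof -
    define h where "h \<mu> = enn2real (phi_lam (verts \<mu>)) * f \<mu>" for \<mu>
    have "(\<lambda>\<mu>. enn2real (phi_lam (verts \<mu>))) \<in> borel_measurable graph_space"
      by (rule measurable_compose[OF measurable_component_phi_lam]) simp
    then have hm: "h \<in> borel_measurable graph_space" unfolding h_def[abs_def] using f by (rule borel_measurable_times)
    have hF: "F_size h v (Suc m) (\<xi> \<omega>) = a \<omega> * F_size f v (Suc m) (\<xi> \<omega>)" for \<omega>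
      by (simp add: F_size_def h_def a_def)
    have AE: "AE \<omega> in P t0. F_size h v (Suc m) (\<xi> \<omega>) * ?W s \<omega> = H \<omega> * a \<omega> * exp (- ((s - t0) * a \<omega>))"
      using W[of s] by eventually_elim (simp add: hF H_def mult.assoc mult.left_commute)
    have mm: "(\<lambda>\<omega>. F_size h v (Suc m) (\<xi> \<omega>) * ?W s \<omega>) \<in> borel_measurable (P t0)"
      unfolding hF by (intro borel_measurable_times am Wm Hm[unfolded H_def[abs_def]])
    have mm': "(\<lambda>\<omega>. H \<omega> * a \<omega> * exp (- ((s - t0) * a \<omega>))) \<in> borel_measurable (P t0)"
      by (intro borel_measurable_times am Hm em)
    have iN: "integrable (P t0) (\<lambda>\<omega>. H \<omega> * a \<omega> * exp (- ((s - t0) * a \<omega>)))"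
      by (rule integrable_exp_transform[OF Hint am a0]) (use s in simp)
    have "integrable (P t0) (\<lambda>\<omega>. F_size h v (Suc m) (\<xi> \<omega>) * ?W s \<omega>)"
      by (rule integrable_cong_AE[THEN iffD2, OF mm mm' AE iN])
    note * = signed_change_intensity(2)[OF R R[OF t0] hm this]
    have "(\<integral>\<omega>. F_size h v (Suc m) (\<xi> \<omega>) * ?W s \<omega> \<partial>P t0) = N (s - t0)"
      unfolding N_def by (rule integral_cong_AE[OF mm mm' AE])
    then show ?thesis using * s t0 by (simp add: hF)
  qed
  have Deq: "D s = inverse s * (real m * ((s / t0) ^ m * L (s - t0)) - s * ((s / t0) ^ m * N (s - t0)))" if "t0 < s" for s
    unfolding D_def using X[OF that] Y[OF that] by (simp add: a_def)
  have ev: "\<forall>\<^sub>F y in nhds s. t0 < y" if "t0 < s" for s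
    using that by (rule eventually_nhds_in_open[of "{t0<..}", simplified])
  show "((\<lambda>s. \<integral>\<omega>. F_size f v (Suc m) (\<xi> \<omega>) \<partial>P s) has_real_derivative D s) (at s)" if s: "t0 < s" for s
  proof -
    have "((\<lambda>s. L (s - t0)) has_real_derivative - N (s - t0) * 1) (at s)"
      by (rule DERIV_chain2[OF L']) (use s in \<open>auto intro!: derivative_eq_intros\<close>)
    then have "((\<lambda>s. (s / t0) ^ m * L (s - t0)) has_real_derivative
       (real m * (s / t0) ^ (m - 1) * (1 / t0)) * L (s - t0) + (s / t0) ^ m * (- N (s - t0))) (at s)"
      using t0 by (auto intro!: derivative_eq_intros)
    also have "(real m * (s / t0) ^ (m - 1) * (1 / t0)) * L (s - t0) + (s / t0) ^ m * (- N (s - t0)) = D s"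
      unfolding Deq[OF s] using s t0 by (cases m) (simp_all add: field_simps)
    finally show ?thesis
    proof (rule DERIV_cong_ev[THEN iffD1, rotated -1, OF _ refl _ refl])
      show "\<forall>\<^sub>F y in nhds s. (y / t0) ^ m * L (y - t0) = (\<integral>\<omega>. F_size f v (Suc m) (\<xi> \<omega>) \<partial>P y)"
        using ev[OF s] by eventually_elim (simp add: X)
    qed
  qed
  show "isCont D s" if s: "t0 < s" for s
  proof -
    have Lc: "isCont L u" if "0 < u" for u using DERIV_isCont[OF L'[OF that]] .
    have "isCont (\<lambda>s. inverse s * (real m * ((s / t0) ^ m * L (s - t0)) - s * ((s / t0) ^ m * N (s - t0)))) s"
    proof -
      have sh: "isCont (\<lambda>s. s - t0) s" by (intro continuous_intros)
      have "isCont (\<lambda>s. L (s - t0)) s" "isCont (\<lambda>s. N (s - t0)) s"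
        by (rule isCont_o2[OF sh Lc], use s in simp, rule isCont_o2[OF sh Ncont], use s in simp)
      then show ?thesis using s t0 by (intro continuous_intros) auto
    qed
    moreover have "\<forall>\<^sub>F y in nhds s. inverse y * (real m * ((y / t0) ^ m * L (y - t0)) - y * ((y / t0) ^ m * N (y - t0))) = D y"
      using ev[OF s] by eventually_elim (simp add: Deq)
    note isCont_cong[OF this]
    ultimately show ?thesis by (simp only:)
  qed
qed

end

section \<open>Summing over the sizes\<close>

theorem theorem9p4:
  fixes lam :: "'a::polish_space measure"
    and phi :: "'a \<Rightarrow> 'a \<Rightarrow> real"
    and P :: "real \<Rightarrow> 'w measure"
    and eta :: "'w \<Rightarrow> 'a set"
    and xi :: "'w \<Rightarrow> 'a graph"
    and v :: 'a
    and f :: "'a graph \<Rightarrow> real"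
    and t0 t1 :: real
  assumes lam_borel: "sets lam = sets borel"
    and lam_locally_finite: "\<And>B. B \<in> sets borel \<Longrightarrow> bounded B \<Longrightarrow> emeasure lam B < \<infinity>"
    and lam_diffuse: "\<And>x. emeasure lam {x} = 0"
    and phi_measurable: "(\<lambda>(x, y). phi x y) \<in> borel_measurable (borel \<Otimes>\<^sub>M borel)"
    and phi_range: "\<And>x y. 0 \<le> phi x y \<and> phi x y \<le> 1"
    and phi_sym: "\<And>x y. phi x y = phi y x"
    and D_phi_finite: "AE x in lam. (\<integral>\<^sup>+y. ennreal (phi x y) \<partial>lam) < \<infinity>"
    and rcm: "\<And>t. 0 < t \<Longrightarrow> random_connection_model (P t) eta xi t lam phi v"
    and f_measurable: "f \<in> borel_measurable graph_space"
    and t0_t1: "0 < t0" "t0 < t1"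
    and F_integrable: "\<And>t. t \<in> {t0..t1} \<Longrightarrow> integrable (P t) (\<lambda>\<omega>. F_fin f v (xi \<omega>))"
    and tails: "\<And>\<epsilon>. \<epsilon> \<in> {0<..<t1 - t0} \<Longrightarrow>
      (\<lambda>n. SUP t\<in>{t0 + \<epsilon>..t1}. \<Sum>k. \<integral>\<^sup>+\<omega>.
          e2ennreal \<bar>M_comp lam phi v t (xi \<omega>) * ereal (F_size f v (Suc n + k) (xi \<omega>))\<bar> \<partial>P t)
        \<longlonglongrightarrow> 0"
    and moments: "\<And>t. t \<in> {t0..t1} \<Longrightarrow>
      (\<integral>\<^sup>+\<omega>. ennreal \<bar>F_fin f v (xi \<omega>)\<bar>
          * (gsize (component v (xi \<omega>)) + phi_lambda lam phi (component v (xi \<omega>))) \<partial>P t) < \<infinity>"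
  shows "(\<forall>t\<in>{t0<..t1}.
            (AE \<omega> in P t. integrable (comp_others v (xi \<omega>)) (\<lambda>x. nabla (F_fin f v) x (xi \<omega>)))
          \<and> integrable (P t) (\<lambda>\<omega>. \<integral>x. nabla (F_fin f v) x (xi \<omega>) \<partial>comp_others v (xi \<omega>))
          \<and> ((\<lambda>s. \<integral>\<omega>. F_fin f v (xi \<omega>) \<partial>P s) has_real_derivative
               inverse t * (\<integral>\<omega>. (\<integral>x. nabla (F_fin f v) x (xi \<omega>) \<partial>comp_others v (xi \<omega>)) \<partial>P t))
             (at t within {t0<..t1}))
        \<and> continuous_on {t0<..t1} (\<lambda>t.
            inverse t * (\<integral>\<omega>. (\<integral>x. nabla (F_fin f v) x (xi \<omega>) \<partial>comp_others v (xi \<omega>)) \<partial>P t))"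
proof -
  interpret connection_model phi lam v
    by (rule connection_model.intro[OF connection_function.intro[OF phi_measurable phi_range phi_sym]
      connection_model_axioms.intro[OF lam_borel lam_locally_finite lam_diffuse]])
  have R: "poisson_rcm phi lam v (P t) eta xi t" if "0 < t" for t
    by (rule poisson_rcm.intro[OF connection_model_axioms poisson_rcm_axioms.intro[OF that rcm[OF that]]])
  \<comment> \<open>The means of the pieces of fixed size and their sum, then the derivatives \<open>D n\<close> and their sum \<open>G\<close>.
    The identities \<open>D_eq\<close> and \<open>X_sums\<close> below make these roles precise.\<close>
  define X where "X n t = (\<integral>\<omega>. F_size f v n (xi \<omega>) \<partial>P t)" for n t
  define E where "E t = (\<integral>\<omega>. F_fin f v (xi \<omega>) \<partial>P t)" for t
  define a where "a \<omega> = enn2real (phi_lam (component_verts v (xi \<omega>)))" for \<omega>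
  define w where "w t \<omega> = enn2real (gsize (component v (xi \<omega>))) - 1 - t * a \<omega>" for t \<omega>
  define D where "D n t = inverse t * ((real n - 1) * X n t - t * (\<integral>\<omega>. a \<omega> * F_size f v n (xi \<omega>) \<partial>P t))" for n t
  define G where "G t = inverse t * (\<integral>\<omega>. w t \<omega> * F_fin f v (xi \<omega>) \<partial>P t)" for t
  have pos: "0 < t" if "t \<in> {t0..t1}" for t using that t0_t1 by auto
  have mw: "poisson_rcm.martingale_weight phi lam v xi t \<omega> = w t \<omega>" if "0 < t" for t \<omega>
    unfolding poisson_rcm.martingale_weight_def[OF R[OF that]] w_def a_def ..
  note nabla = poisson_rcm.mean_nabla[OF R f_measurable]
  have F0: "F_size f v 0 (xi \<omega>) = 0" if "0 < t" "\<omega> \<in> space (P t)" for t \<omega>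
  proof -
    interpret T: poisson_rcm phi lam v "P t" eta xi t using R that(1) .
    have "v \<in> component_verts v (xi \<omega>)" using T.verts_xi[OF that(2)] by (intro mem_component_verts_self) simp
    then have "gsize (component v (xi \<omega>)) \<noteq> 0" by (auto simp: gsize_def emeasure_count_space_eq_0)
    then show ?thesis by (simp add: F_size_def)
  qed
  have Fn_m: "(\<lambda>\<omega>. F_size f v n (xi \<omega>)) \<in> borel_measurable (P t)" if "0 < t" for n t
  proof -
    interpret T: poisson_rcm phi lam v "P t" eta xi t using R that .
    show ?thesis
      unfolding F_size_eq
      by (intro borel_measurable_times T.measurable_xi_component[OF f_measurable]
        measurable_compose[OF measurable_compose[OF T.measurable_xi pred_component_size], of of_bool borel]) simp
  qed
  have a_m: "a \<in> borel_measurable (P t)" if "0 < t" for t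
  proof -
    interpret T: poisson_rcm phi lam v "P t" eta xi t using R that .
    show ?thesis unfolding a_def[abs_def] by (rule measurable_compose[OF T.measurable_xi_phi]) simp
  qed
  have w_m: "w t \<in> borel_measurable (P t)" if "0 < t" for t
  proof -
    interpret T: poisson_rcm phi lam v "P t" eta xi t using R that .
    show ?thesis unfolding w_def[abs_def]
      by (intro borel_measurable_diff borel_measurable_times borel_measurable_const a_m that
        measurable_compose[OF T.measurable_xi_size]) simp
  qed
  have Fn_int: "integrable (P t) (\<lambda>\<omega>. F_size f v n (xi \<omega>))" if t: "t \<in> {t0..t1}" for n t
    by (rule Bochner_Integration.integrable_bound[OF F_integrable[OF t] Fn_m[OF pos[OF t]]])
      (rule AE_I2, simp add: abs_F_size_le)
  have wF_int: "integrable (P t) (\<lambda>\<omega>. w t \<omega> * F_fin f v (xi \<omega>))" if t: "t \<in> {t0..t1}" for t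
    using nabla(2)[OF pos[OF t] F_integrable[OF t] moments[OF t]] by (simp only: mw[OF pos[OF t]])
  have wFn_int: "integrable (P t) (\<lambda>\<omega>. w t \<omega> * F_size f v n (xi \<omega>))" if t: "t \<in> {t0..t1}" for n t
    by (rule Bochner_Integration.integrable_bound[OF wF_int[OF t] borel_measurable_times[OF w_m[OF pos[OF t]] Fn_m[OF pos[OF t]]]])
      (rule AE_I2, simp add: abs_mult mult_left_mono abs_F_size_le)
  have wFn: "w t \<omega> * F_size f v n (xi \<omega>) = (real n - 1) * F_size f v n (xi \<omega>) - t * (a \<omega> * F_size f v n (xi \<omega>))" for t n \<omega>
  proof (cases "gsize (component v (xi \<omega>)) = of_nat n")
    case True
    then have "enn2real (gsize (component v (xi \<omega>))) = real n" by (simp add: ennreal_of_nat_eq_real_of_nat)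
    then show ?thesis by (simp add: w_def algebra_simps)
  qed (simp add: F_size_def)
  have D_eq: "D n t = inverse t * (\<integral>\<omega>. w t \<omega> * F_size f v n (xi \<omega>) \<partial>P t)" if t: "t \<in> {t0..t1}" for n t
  proof -
    have "t * (a \<omega> * F_size f v n (xi \<omega>)) = (real n - 1) * F_size f v n (xi \<omega>) - w t \<omega> * F_size f v n (xi \<omega>)" for \<omega>
      using wFn[of t \<omega> n] by simp
    moreover have "integrable (P t) (\<lambda>\<omega>. (real n - 1) * F_size f v n (xi \<omega>) - w t \<omega> * F_size f v n (xi \<omega>))"
      using Fn_int[OF t] wFn_int[OF t] by simp
    ultimately have ta: "integrable (P t) (\<lambda>\<omega>. t * (a \<omega> * F_size f v n (xi \<omega>)))" by simp
    have "(\<integral>\<omega>. w t \<omega> * F_size f v n (xi \<omega>) \<partial>P t)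
        = (\<integral>\<omega>. (real n - 1) * F_size f v n (xi \<omega>) - t * (a \<omega> * F_size f v n (xi \<omega>)) \<partial>P t)"
      by (simp only: wFn)
    also have "\<dots> = (real n - 1) * X n t - t * (\<integral>\<omega>. a \<omega> * F_size f v n (xi \<omega>) \<partial>P t)"
      using Fn_int[OF t] ta by (simp add: X_def)
    finally show ?thesis by (simp add: D_def)
  qed
  \<comment> \<open>The component contains \<open>v\<close>, so size \<open>0\<close> does not occur and the series start with size \<open>1\<close>, which
    is also where the change of intensity applies.\<close>
  have X0: "X 0 t = 0" and D0: "D 0 t = 0" if "t \<in> {t0..t1}" for t
  proof -
    have "X 0 t = (\<integral>\<omega>. 0 \<partial>P t)" unfolding X_def
      by (rule Bochner_Integration.integral_cong) (use F0[OF pos[OF that]] in auto)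
    then show "X 0 t = 0" by simp
    have "(\<integral>\<omega>. w t \<omega> * F_size f v 0 (xi \<omega>) \<partial>P t) = (\<integral>\<omega>. 0 \<partial>P t)"
      by (rule Bochner_Integration.integral_cong) (use F0[OF pos[OF that]] in auto)
    then show "D 0 t = 0" by (simp add: D_eq[OF that])
  qed
  have Mw: "(\<integral>\<^sup>+\<omega>. e2ennreal \<bar>M_comp lam phi v t (xi \<omega>) * ereal (F_size f v j (xi \<omega>))\<bar> \<partial>P t)
      = (\<integral>\<^sup>+\<omega>. ennreal \<bar>w t \<omega> * F_size f v j (xi \<omega>)\<bar> \<partial>P t)" if t: "t \<in> {t0..t1}" for t j
  proof (rule nn_integral_cong_AE)
    show "AE \<omega> in P t. e2ennreal \<bar>M_comp lam phi v t (xi \<omega>) * ereal (F_size f v j (xi \<omega>))\<bar> = ennreal \<bar>w t \<omega> * F_size f v j (xi \<omega>)\<bar>"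
      using nabla(1)[OF pos[OF t] F_integrable[OF t] moments[OF t]]
    proof eventually_elim
      case (elim \<omega>)
      show ?case
      proof (cases "F_size f v j (xi \<omega>) = 0")
        case False
        then have sz: "gsize (component v (xi \<omega>)) = ennreal (real j)" and "F_fin f v (xi \<omega>) \<noteq> 0"
          by (auto simp: F_size_def F_fin_def ennreal_of_nat_eq_real_of_nat split: if_splits)
        then have ph: "phi_lam (component_verts v (xi \<omega>)) = ennreal (a \<omega>)" using elim by (simp add: a_def)
        have "0 \<le> a \<omega>" by (simp add: a_def)
        then have "M_comp lam phi v t (xi \<omega>) = ereal (w t \<omega>)"
          unfolding M_comp_def phi_lambda_eq verts_component ph w_def sz by (simp add: one_ereal_def)
        then have "\<bar>M_comp lam phi v t (xi \<omega>) * ereal (F_size f v j (xi \<omega>))\<bar> = enn2ereal (ennreal \<bar>w t \<omega> * F_size f v j (xi \<omega>)\<bar>)"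
          by (simp only: times_ereal.simps(1) abs_ereal.simps(1) enn2ereal_ennreal abs_ge_zero)
        then show ?thesis by (simp only: e2ennreal_enn2ereal)
      qed (simp add: zero_ereal_def[symmetric])
    qed
  qed
  \<comment> \<open>Multiplication by \<open>t\<close> cancels the factor \<open>inverse t\<close> in \<open>G\<close> and \<open>D\<close>; as \<open>t \<ge> t0 > 0\<close>, the factor is
    harmless for uniform convergence.\<close>
  define T where "T n t = (\<Sum>k. \<integral>\<^sup>+\<omega>. e2ennreal \<bar>M_comp lam phi v t (xi \<omega>) * ereal (F_size f v (Suc n + k) (xi \<omega>))\<bar> \<partial>P t)" for n t
  have tail: "ennreal (t * \<bar>G t - (\<Sum>m<n. D (Suc m) t)\<bar>) \<le> T n t" if t: "t \<in> {t0..t1}" for n t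
  proof -
    let ?r = "\<lambda>\<omega>. w t \<omega> * (F_fin f v (xi \<omega>) * of_bool (of_nat (Suc n) \<le> gsize (component v (xi \<omega>))))"
    have r: "?r \<omega> = w t \<omega> * F_fin f v (xi \<omega>) - (\<Sum>i<Suc n. w t \<omega> * F_size f v i (xi \<omega>))" for \<omega>
      unfolding F_size_sum[symmetric] right_diff_distrib sum_distrib_left ..
    have rI: "integrable (P t) ?r" unfolding r
      by (intro Bochner_Integration.integrable_diff Bochner_Integration.integrable_sum wF_int[OF t] wFn_int[OF t])
    have "(\<Sum>m<n. D (Suc m) t) = (\<Sum>i<Suc n. D i t)" unfolding sum.lessThan_Suc_shift D0[OF t] by simp
    then have "G t - (\<Sum>m<n. D (Suc m) t) = inverse t * (\<integral>\<omega>. ?r \<omega> \<partial>P t)"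
      unfolding r using wF_int[OF t] wFn_int[OF t] by (simp add: G_def D_eq[OF t] sum_distrib_left right_diff_distrib del: sum.lessThan_Suc)
    then have "t * \<bar>G t - (\<Sum>m<n. D (Suc m) t)\<bar> = norm (\<integral>\<omega>. ?r \<omega> \<partial>P t)"
      using pos[OF t] by (simp add: abs_mult)
    then have "ennreal (t * \<bar>G t - (\<Sum>m<n. D (Suc m) t)\<bar>) \<le> (\<integral>\<^sup>+\<omega>. ennreal \<bar>?r \<omega>\<bar> \<partial>P t)"
      using integral_norm_bound_ennreal[OF rI] by simp
    also have "\<dots> = (\<integral>\<^sup>+\<omega>. (\<Sum>k. ennreal \<bar>w t \<omega> * F_size f v (Suc n + k) (xi \<omega>)\<bar>) \<partial>P t)"
      by (simp only: abs_F_size_suminf)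
    also have "\<dots> = (\<Sum>k. \<integral>\<^sup>+\<omega>. ennreal \<bar>w t \<omega> * F_size f v (Suc n + k) (xi \<omega>)\<bar> \<partial>P t)"
    proof (rule nn_integral_suminf)
      fix k
      have "(\<lambda>\<omega>. \<bar>w t \<omega> * F_size f v (Suc n + k) (xi \<omega>)\<bar>) \<in> borel_measurable (P t)"
        by (intro borel_measurable_abs borel_measurable_times w_m[OF pos[OF t]] Fn_m[OF pos[OF t]])
      from measurable_compose[OF this measurable_ennreal]
      show "(\<lambda>\<omega>. ennreal \<bar>w t \<omega> * F_size f v (Suc n + k) (xi \<omega>)\<bar>) \<in> borel_measurable (P t)" .
    qed
    also have "\<dots> = T n t" unfolding T_def Mw[OF t] ..
    finally show ?thesis .
  qed
  have unif: "uniform_limit {t0 + \<epsilon>..t1} (\<lambda>n t. \<Sum>m<n. D (Suc m) t) G sequentially"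
    if \<epsilon>: "\<epsilon> \<in> {0<..<t1 - t0}" for \<epsilon>
  proof (rule uniform_limitI)
    fix e :: real assume e: "0 < e"
    have "0 < ennreal (e * t0)" using e t0_t1 by simp
    from order_tendstoD(2)[OF tails[OF \<epsilon>] this]
    show "\<forall>\<^sub>F n in sequentially. \<forall>t\<in>{t0 + \<epsilon>..t1}. dist (\<Sum>m<n. D (Suc m) t) (G t) < e"
    proof eventually_elim
      case (elim n)
      show ?case
      proof
        fix t assume t: "t \<in> {t0 + \<epsilon>..t1}"
        then have t': "t \<in> {t0..t1}" using \<epsilon> by auto
        have "ennreal (t * \<bar>G t - (\<Sum>m<n. D (Suc m) t)\<bar>) \<le> T n t" by (rule tail[OF t'])
        also have "\<dots> \<le> (SUP t\<in>{t0 + \<epsilon>..t1}. T n t)" using t by (rule SUP_upper)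
        also have "\<dots> < ennreal (e * t0)" using elim by (simp only: T_def)
        finally have "t * \<bar>G t - (\<Sum>m<n. D (Suc m) t)\<bar> < e * t0"
          using e t0_t1 by (simp add: ennreal_less_iff pos[OF t'] less_imp_le)
        moreover have "t0 * \<bar>G t - (\<Sum>m<n. D (Suc m) t)\<bar> \<le> t * \<bar>G t - (\<Sum>m<n. D (Suc m) t)\<bar>"
          using t' by (intro mult_right_mono) auto
        ultimately have "t0 * \<bar>G t - (\<Sum>m<n. D (Suc m) t)\<bar> < t0 * e" by (simp add: mult.commute)
        then have "\<bar>G t - (\<Sum>m<n. D (Suc m) t)\<bar> < e" using t0_t1 by simp
        then show "dist (\<Sum>m<n. D (Suc m) t) (G t) < e" by (simp add: dist_real_def abs_minus_commute)
      qed
    qed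
  qed
  have t0_mem: "t0 \<in> {t0..t1}" using t0_t1 by simp
  have fin0: "AE \<omega> in P t0. F_size f v (Suc m) (xi \<omega>) \<noteq> 0 \<longrightarrow> phi_lam (component_verts v (xi \<omega>)) < \<infinity>" for m
    using nabla(1)[OF pos[OF t0_mem] F_integrable[OF t0_mem] moments[OF t0_mem]]
  proof eventually_elim
    case (elim \<omega>)
    then show ?case using abs_F_size_le[of f v "Suc m" "xi \<omega>"] by auto
  qed
  have D_Suc: "D (Suc m) = (\<lambda>s. inverse s * (real m * (\<integral>\<omega>. F_size f v (Suc m) (xi \<omega>) \<partial>P s)
        - s * (\<integral>\<omega>. enn2real (phi_lam (component_verts v (xi \<omega>))) * F_size f v (Suc m) (xi \<omega>) \<partial>P s)))" for m
    by (rule ext) (simp add: D_def X_def a_def)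
  note sd = size_derivative[OF R t0_t1(1) f_measurable Fn_int[OF t0_mem] fin0]
  have X_deriv: "(X (Suc m) has_real_derivative D (Suc m) s) (at s)" if "t0 < s" for m s
    unfolding D_Suc X_def[abs_def] by (rule sd(1)[OF _ that])
  have D_cont: "isCont (D (Suc m)) s" if "t0 < s" for m s
    unfolding D_Suc by (rule sd(2)[OF _ that])
  have X_sums: "(\<lambda>m. X (Suc m) t) sums E t" if t: "t \<in> {t0..t1}" for t
    unfolding sums_def
  proof -
    have "(\<lambda>n. \<integral>\<omega>. (\<Sum>i<Suc n. F_size f v i (xi \<omega>)) \<partial>P t) \<longlonglongrightarrow> E t"
      unfolding E_def
    proof (rule integral_dominated_convergence[where w="\<lambda>\<omega>. \<bar>F_fin f v (xi \<omega>)\<bar>"])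
      have S: "(\<Sum>i<n. F_size f v i (xi \<omega>)) = F_fin f v (xi \<omega>) * (1 - of_bool (of_nat n \<le> gsize (component v (xi \<omega>))))" for n \<omega>
        using F_size_sum[where f=f and v=v and n=n and \<mu>="xi \<omega>"] by (simp add: right_diff_distrib)
      \<comment> \<open>The partial sums are eventually constant: the full value once \<open>n\<close> reaches the size.\<close>
      show "AE \<omega> in P t. (\<lambda>n. \<Sum>i<Suc n. F_size f v i (xi \<omega>)) \<longlonglongrightarrow> F_fin f v (xi \<omega>)"
      proof (rule AE_I2)
        fix \<omega>
        have "\<forall>\<^sub>F n in sequentially. (\<Sum>i<Suc n. F_size f v i (xi \<omega>)) = F_fin f v (xi \<omega>)"
        proof (cases "component v (xi \<omega>)" rule: gsize_cases)
          case infinite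
          then have "F_fin f v (xi \<omega>) = 0" by (simp add: F_fin_def)
          then show ?thesis unfolding S by simp
        next
          case (finite k)
          show ?thesis unfolding S finite
            by (rule eventually_sequentiallyI[of k]) (simp del: of_nat_Suc)
        qed
        then show "(\<lambda>n. \<Sum>i<Suc n. F_size f v i (xi \<omega>)) \<longlonglongrightarrow> F_fin f v (xi \<omega>)" by (rule tendsto_eventually)
      qed
      show "AE \<omega> in P t. norm (\<Sum>i<Suc n. F_size f v i (xi \<omega>)) \<le> \<bar>F_fin f v (xi \<omega>)\<bar>" for n
        unfolding S by (rule AE_I2) (simp add: abs_mult)
      show "(\<lambda>\<omega>. F_fin f v (xi \<omega>)) \<in> borel_measurable (P t)" by (rule borel_measurable_integrable[OF F_integrable[OF t]])
      show "(\<lambda>\<omega>. \<Sum>i<Suc n. F_size f v i (xi \<omega>)) \<in> borel_measurable (P t)" for n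
        by (intro borel_measurable_sum Fn_m pos[OF t])
      show "integrable (P t) (\<lambda>\<omega>. \<bar>F_fin f v (xi \<omega>)\<bar>)" using F_integrable[OF t] by simp
    qed
    moreover have "(\<integral>\<omega>. (\<Sum>i<Suc n. F_size f v i (xi \<omega>)) \<partial>P t) = (\<Sum>m<n. X (Suc m) t)" for n
    proof -
      have "(\<integral>\<omega>. (\<Sum>i<Suc n. F_size f v i (xi \<omega>)) \<partial>P t) = (\<Sum>i<Suc n. X i t)"
        unfolding X_def by (rule Bochner_Integration.integral_sum) (rule Fn_int[OF t])
      then show ?thesis unfolding sum.lessThan_Suc_shift X0[OF t] by simp
    qed
    ultimately show "(\<lambda>n. \<Sum>m<n. X (Suc m) t) \<longlonglongrightarrow> E t" by simp
  qed
  have local: "(E has_real_derivative G t) (at t within {t0<..t1}) \<and> continuous (at t within {t0<..t1}) G"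
    if t: "t \<in> {t0<..t1}" for t
  proof -
    \<comment> \<open>Uniform convergence holds away from \<open>t0\<close> only. The interval \<open>[t0 + \<epsilon>, t1]\<close> contains a relative
      neighbourhood of \<open>t\<close>, also for \<open>t = t1\<close>, so it yields the same derivative.\<close>
    define \<epsilon> where "\<epsilon> = (t - t0) / 2"
    have \<epsilon>: "\<epsilon> \<in> {0<..<t1 - t0}" "t0 + \<epsilon> < t" using t t0_t1 by (auto simp: \<epsilon>_def field_simps)
    let ?S = "{t0 + \<epsilon>..t1}"
    have S: "t0 < s" "s \<in> {t0..t1}" if "s \<in> ?S" for s using that \<epsilon> by auto
    have tS: "t \<in> ?S" using t \<epsilon> by auto
    have nhd: "at t within {t0<..t1} = at t within ?S"
      by (rule at_within_nhd[of t "{t0 + \<epsilon><..}"]) (use \<epsilon> in auto)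
    have "\<exists>g. \<forall>x\<in>?S. (\<lambda>m. X (Suc m) x) sums g x \<and> (g has_real_derivative G x) (at x within ?S)"
    proof (rule has_field_derivative_series[OF _ _ unif[OF \<epsilon>(1)] tS])
      show "(X (Suc m) has_real_derivative D (Suc m) s) (at s within ?S)" if "s \<in> ?S" for m s
        by (rule has_field_derivative_at_within[OF X_deriv[OF S(1)[OF that]]])
      show "summable (\<lambda>m. X (Suc m) t)" using X_sums[OF S(2)[OF tS]] by (rule sums_summable)
    qed simp
    then obtain g where g: "\<And>x. x \<in> ?S \<Longrightarrow> (\<lambda>m. X (Suc m) x) sums g x"
      "\<And>x. x \<in> ?S \<Longrightarrow> (g has_real_derivative G x) (at x within ?S)" by blast
    have gE: "g x = E x" if "x \<in> ?S" for x
      using sums_unique2[OF g(1)[OF that] X_sums[OF S(2)[OF that]]] .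
    have "(E has_real_derivative G t) (at t within ?S)"
      by (rule has_field_derivative_transform_within[OF g(2)[OF tS] zero_less_one tS gE])
    moreover have "continuous_on ?S G"
    proof (rule uniform_limit_theorem[OF _ unif[OF \<epsilon>(1)]])
      show "\<forall>\<^sub>F n in sequentially. continuous_on ?S (\<lambda>t. \<Sum>m<n. D (Suc m) t)"
        by (intro always_eventually allI continuous_on_sum continuous_at_imp_continuous_on ballI D_cont S(1))
    qed simp
    then have "continuous (at t within ?S) G" using tS by (simp add: continuous_on_eq_continuous_within)
    ultimately show ?thesis by (simp add: nhd)
  qed
  have G_eq: "inverse t * (\<integral>\<omega>. (\<integral>x. nabla (F_fin f v) x (xi \<omega>) \<partial>comp_others v (xi \<omega>)) \<partial>P t) = G t"
    if "t \<in> {t0<..t1}" for t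
  proof -
    have t: "t \<in> {t0..t1}" using that by auto
    show ?thesis
      unfolding nabla(5)[OF pos[OF t] F_integrable[OF t] moments[OF t]] G_def by (simp only: mw[OF pos[OF t]])
  qed
  show ?thesis
  proof (intro conjI ballI)
    fix t assume t: "t \<in> {t0<..t1}"
    then have t': "t \<in> {t0..t1}" by auto
    show "AE \<omega> in P t. integrable (comp_others v (xi \<omega>)) (\<lambda>x. nabla (F_fin f v) x (xi \<omega>))"
      by (rule nabla(3)[OF pos[OF t'] F_integrable[OF t'] moments[OF t']])
    show "integrable (P t) (\<lambda>\<omega>. \<integral>x. nabla (F_fin f v) x (xi \<omega>) \<partial>comp_others v (xi \<omega>))"
      by (rule nabla(4)[OF pos[OF t'] F_integrable[OF t'] moments[OF t']])
    show "((\<lambda>s. \<integral>\<omega>. F_fin f v (xi \<omega>) \<partial>P s) has_real_derivative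
        inverse t * (\<integral>\<omega>. (\<integral>x. nabla (F_fin f v) x (xi \<omega>) \<partial>comp_others v (xi \<omega>)) \<partial>P t)) (at t within {t0<..t1})"
      unfolding G_eq[OF t] using local[OF t] by (simp add: E_def[abs_def])
  next
    have Gc: "continuous_on {t0<..t1} G" using local by (simp add: continuous_on_eq_continuous_within)
    show "continuous_on {t0<..t1} (\<lambda>t.
        inverse t * (\<integral>\<omega>. (\<integral>x. nabla (F_fin f v) x (xi \<omega>) \<partial>comp_others v (xi \<omega>)) \<partial>P t))"
      by (rule continuous_on_eq[OF Gc G_eq[symmetric]])
  qed
qed

end
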